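(* Let $n\ge1$ be an integer, $\nu>0$, $a\in\mathbb{R}\setminus\{0\}$, and consider the system of vortices with equal vorticities $$X^i_t=X^i_0+\sqrt{2\nu}\,W^i_t+\int_0^t\sum_{j\neq i}a\,K(X^i_s-X^j_s)\,ds,\qquad 1\le i\le n.$$ Let $p_\infty(z^1,\dots,z^n)=\frac{1}{(4\pi\nu)^n}e^{-\frac{1}{4\nu}\sum_{i=1}^n|z^i|^2}$. Assume that $(X^1_0,\dots,X^n_0)$ has a density $p_0=\rho_0$ with respect to the Lebesgue measure on $\mathbb{R}^{2n}$ such that the relative entropy $\int_{\mathbb{R}^{2n}}p_0\ln\left(\frac{p_0}{p_\infty}\right)$ is finite, and let $\rho_s$ denote the density of $(X^1_s,\dots,X^n_s)$. Then $$\forall s\ge0,\quad\int_{\mathbb{R}^{2n}}\rho_s\ln\left(\frac{\rho_s}{(1+s)^{-n}p_\infty\left(\frac{\cdot}{\sqrt{1+s}}\right)}\right)\le\frac{1}{1+s}\int_{\mathbb{R}^{2n}}\rho_0\ln\left(\frac{\rho_0}{p_\infty}\right)=\frac{1}{1+s}\int_{\mathbb{R}^{2n}}p_0\ln\left(\frac{p_0}{p_\infty}\right).$$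
   Context: $K:\mathbb{R}^2\setminus\{0\}\to\mathbb{R}^2$ is the Biot and Savart kernel $K(x)=\frac{x^\perp}{2\pi|x|^2}$, where $x^\perp=(-x_2,x_1)$. $W^1,\dots,W^n$ are independent two-dimensional standard Brownian motions, independent of the initial vector $(X^1_0,\dots,X^n_0)\in(\mathbb{R}^2)^n$. It is known that the SDE has a unique strong solution as soon as $\mathbb{P}(\exists i\neq j:\ X^i_0=X^j_0)=0$ (the particles almost surely never collide), and that for $s>0$ the vector $(X^1_s,\dots,X^n_s)$ has a density with respect to the Lebesgue measure. *)

theory Defs
  imports "HOL-Probability.Probability"
begin

text \<open>The sigma-algebra on the sample space generated by the variables \<open>Y t\<close>, \<open>t \<in> T\<close>.\<close>

definition generated_events ::
    "'a measure \<Rightarrow> ('t \<Rightarrow> 'a \<Rightarrow> 'b::topological_space) \<Rightarrow> 't set \<Rightarrow> 'a set set" where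
  "generated_events M Y T =
     sigma_sets (space M) {Y t -` A \<inter> space M | t A. t \<in> T \<and> A \<in> sets borel}"

text \<open>Standard Brownian motion with values in a Euclidean space, with time set \<open>{0..}\<close>.\<close>

definition standard_brownian_motion ::
    "'a measure \<Rightarrow> (real \<Rightarrow> 'a \<Rightarrow> 'b::euclidean_space) \<Rightarrow> bool" where
  "standard_brownian_motion M B \<longleftrightarrow>
     (\<forall>t\<ge>0. B t \<in> borel_measurable M) \<and>
     (AE \<omega> in M. B 0 \<omega> = 0) \<and>
     (AE \<omega> in M. continuous_on {0..} (\<lambda>t. B t \<omega>)) \<and>
     (\<forall>s t. 0 \<le> s \<and> s < t \<longrightarrow>
        distributed M lborel (\<lambda>\<omega>. B t \<omega> - B s \<omega>)
          (\<lambda>x. ennreal (\<Prod>b\<in>Basis. normal_density 0 (sqrt (t - s)) (x \<bullet> b)))) \<and>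
     (\<forall>(\<tau> :: nat \<Rightarrow> real) m. mono \<tau> \<and> 0 \<le> \<tau> 0 \<longrightarrow>
        prob_space.indep_vars M (\<lambda>_. borel) (\<lambda>k \<omega>. B (\<tau> (Suc k)) \<omega> - B (\<tau> k) \<omega>) {..<m})"

definition perp :: "real^2 \<Rightarrow> real^2" where
  "perp x = vector [- x $ 2, x $ 1]"

text \<open>The kernel is only meaningful away from the origin. As a total function it
  takes the value 0 there, which is never used for the processes below.\<close>

definition biot_savart :: "real^2 \<Rightarrow> real^2" where
  "biot_savart x = (1 / (2 * pi * (norm x)\<^sup>2)) *\<^sub>R perp x"

text \<open>The driving data of the system: the \<open>W i\<close> are Brownian motions, and the
  initial vector \<open>X 0\<close> (index \<open>None\<close>) and the processes \<open>W i\<close> (indices \<open>Some i\<close>)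
  are mutually independent.\<close>

definition vortex_data ::
    "'a measure \<Rightarrow> ('n::finite \<Rightarrow> real \<Rightarrow> 'a \<Rightarrow> real^2) \<Rightarrow> (real \<Rightarrow> 'a \<Rightarrow> real^2^'n) \<Rightarrow> bool" where
  "vortex_data M W X \<longleftrightarrow>
     (\<forall>i. standard_brownian_motion M (W i)) \<and>
     X 0 \<in> borel_measurable M \<and>
     prob_space.indep_sets M
       (case_option (generated_events M X {0}) (\<lambda>i. generated_events M (W i) {0..})) UNIV"

text \<open>Strong solutions: the process is adapted to the filtration generated by the
  initial vector and the Brownian motions, augmented by the null sets. Its
  paths stay in the domain of the drift, that is, the particles do not
  collide. The drift is then continuous in time along almost every path, so the integral below
  is a genuine one.\<close>

definition vortex_solution ::
    "'a measure \<Rightarrow> real \<Rightarrow> real \<Rightarrow> ('n::finite \<Rightarrow> real \<Rightarrow> 'a \<Rightarrow> real^2) \<Rightarrow>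
     (real \<Rightarrow> 'a \<Rightarrow> real^2^'n) \<Rightarrow> bool" where
  "vortex_solution M \<nu> a W X \<longleftrightarrow>
     (\<forall>t\<ge>0. X t \<in> borel_measurable (sigma (space M)
        (generated_events M X {0} \<union> (\<Union>i. generated_events M (W i) {0..t}) \<union> null_sets M))) \<and>
     (AE \<omega> in M. continuous_on {0..} (\<lambda>t. X t \<omega>)) \<and>
     (AE \<omega> in M. \<forall>t\<ge>0. \<forall>i j. i \<noteq> j \<longrightarrow> X t \<omega> $ i \<noteq> X t \<omega> $ j) \<and>
     (AE \<omega> in M. \<forall>t\<ge>0. \<forall>i.
        X t \<omega> $ i = X 0 \<omega> $ i + sqrt (2 * \<nu>) *\<^sub>R W i t \<omega> +
          (LINT s:{0..t}|lborel.
             (\<Sum>j\<in>UNIV - {i}. a *\<^sub>R biot_savart (X s \<omega> $ i - X s \<omega> $ j))))"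

text \<open>The functions are meant to be probability densities with respect to Lebesgue measure,
  with \<open>q\<close> positive. The convention \<open>0 ln 0 = 0\<close> is built in, and the negative part
  of the integrand is always integrable. Hence the relative entropy, as an element of
  \<open>[0, \<infinity>]\<close>, is finite iff the integrand is integrable; otherwise the
  real-valued integral below is the junk value 0.\<close>

definition relative_entropy :: "('b::euclidean_space \<Rightarrow> real) \<Rightarrow> ('b \<Rightarrow> real) \<Rightarrow> real" where
  "relative_entropy p q = (LINT z|lborel. p z * ln (p z / q z))"

definition finite_relative_entropy :: "('b::euclidean_space \<Rightarrow> real) \<Rightarrow> ('b \<Rightarrow> real) \<Rightarrow> bool" where
  "finite_relative_entropy p q \<longleftrightarrow> integrable lborel (\<lambda>z. p z * ln (p z / q z))"

definition has_density ::
    "'a measure \<Rightarrow> ('a \<Rightarrow> 'b::euclidean_space) \<Rightarrow> ('b \<Rightarrow> real) \<Rightarrow> bool" where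
  "has_density M Y p \<longleftrightarrow> (\<forall>z. 0 \<le> p z) \<and> distributed M lborel Y (\<lambda>z. ennreal (p z))"

definition p_infty :: "real \<Rightarrow> real^2^'n::finite \<Rightarrow> real" where
  "p_infty \<nu> z =
     1 / (4 * pi * \<nu>) ^ CARD('n) * exp (- (1 / (4 * \<nu>)) * (\<Sum>i\<in>UNIV. (norm (z $ i))\<^sup>2))"

end

theory Submission
  imports Defs "HOL-Real_Asymp.Real_Asymp"
begin

text \<open>The drift is divergence free and tangent to the spheres centred at the origin, so it does
  not affect the entropy relative to a centred Gaussian, while the heat flow contracts it. This is
  made rigorous without stochastic calculus by a splitting scheme. The kernel is regularised near
  the origin. In each time step, the distance vector of every pair of particles is rotated by an
  angle depending on its length, which preserves every centred Gaussian measure, and then the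
  increments of the Brownian motions are added. The noise is additive and the particles do not
  collide, so the scheme converges along almost every path, by Gronwall's lemma.

  Relative entropy is bounded through the Donsker--Varadhan formula, which passes to the limit.
  With \<open>1 + t = k / N\<close> the convolution from time \<open>t\<close> to time \<open>t + 1 / N\<close> has to contract the
  entropy by the factor \<open>k / (k + 1)\<close>. Dually, for \<open>m = k + 1\<close> and \<open>P\<close> the average over the
  conditional law of the normalised sum of \<open>m - 1\<close> independent Gaussian vectors given the normalised
  sum of all \<open>m\<close>, the integral of \<open>exp (m / (m - 1) * P \<phi>)\<close> is at most the power \<open>m / (m - 1)\<close> of
  the integral of \<open>exp \<phi>\<close>. This follows from Jensen's inequality and the Loomis--Whitney inequality.\<close>

subsection \<open>The standard Gaussian measure and rotations\<close>

text \<open>The kernel is singular and the densities are only assumed to exist, so the entropy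
  cannot be differentiated along the Fokker-Planck equation. Time is discretised instead, without
  any loss in the constants: with step \<open>1 / N\<close> the reference variances are proportional
  to N, N + 1, ..., the step from time \<open>k / N\<close> multiplies the bound by (N + k) / (N + k
  + 1), and the product telescopes to 1 / (1 + k / N) exactly. As consecutive variances have the
  ratio (m - 1) / m with an integer m, one Gaussian is a sum of m independent vectors and the other
  is the sum without one of them. This is where the Loomis-Whitney inequality enters, in the place
  of a logarithmic Sobolev inequality. Equal vorticities make the two particles of a pair move by
  opposite amounts; the pair turns about its midpoint and the sum of the squared norms is kept. No
  deterministic lower bound for the distances is available, so the regularisation is fixed first and
  compared with the path afterwards: once its parameter is below the least distance on [0, s], the
  path solves the regularised system as well.\<close>

definition std_gauss :: "'a::euclidean_space measure" where
  "std_gauss = density lborel (\<lambda>x. ennreal (exp (- (norm x)\<^sup>2 / 2) / sqrt (2 * pi) ^ DIM('a)))"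

lemma normal_density_prod:
  fixes x :: "'a::euclidean_space"
  assumes \<sigma>: "\<sigma> > 0"
  shows "(\<Prod>b\<in>Basis. normal_density 0 \<sigma> (x \<bullet> b)) =
    exp (- (norm x)\<^sup>2 / (2 * \<sigma>\<^sup>2)) / (sqrt (2 * pi) * \<sigma>) ^ DIM('a)"
proof -
  have "(norm x)\<^sup>2 = (\<Sum>b\<in>Basis. (x \<bullet> b)\<^sup>2)"
    using euclidean_inner[of x x] by (simp add: power2_norm_eq_inner) (simp add: power2_eq_square)
  hence "exp (- (norm x)\<^sup>2 / (2 * \<sigma>\<^sup>2)) = (\<Prod>b\<in>Basis. exp (- (x \<bullet> b)\<^sup>2 / (2 * \<sigma>\<^sup>2)))"
    by (simp flip: exp_sum add: sum_divide_distrib sum_negf)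
  thus ?thesis
    using \<sigma> by (simp add: normal_density_def prod_dividef prod.distrib real_sqrt_mult)
qed

lemma std_gauss_density_prod:
  fixes x :: "'a::euclidean_space"
  shows "exp (- (norm x)\<^sup>2 / 2) / sqrt (2 * pi) ^ DIM('a) = (\<Prod>b\<in>Basis. std_normal_density (x \<bullet> b))"
  using normal_density_prod[of 1 x] by simp

lemma space_std_gauss [simp]: "space std_gauss = UNIV"
  and sets_std_gauss [simp, measurable_cong]: "sets std_gauss = sets borel"
  by (simp_all add: std_gauss_def)

lemma prob_space_std_gauss: "prob_space std_gauss"
proof
  have "emeasure std_gauss (space (std_gauss :: 'a measure)) =
      (\<integral>\<^sup>+x. ennreal (exp (- (norm x)\<^sup>2 / 2) / sqrt (2 * pi) ^ DIM('a)) \<partial>(lborel :: 'a measure))"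
    unfolding std_gauss_def by (subst emeasure_density) auto
  also have "\<dots> = (\<integral>\<^sup>+x. (\<Prod>b\<in>Basis. ennreal (std_normal_density (x \<bullet> b))) \<partial>(lborel :: 'a measure))"
    by (simp only: std_gauss_density_prod) (simp add: prod_ennreal)
  also have "\<dots> = (\<Prod>b\<in>(Basis :: 'a set). (\<integral>\<^sup>+x. ennreal (std_normal_density x) \<partial>lborel))"
    by (rule nn_integral_lborel_prod) auto
  also have "(\<integral>\<^sup>+x. ennreal (std_normal_density x) \<partial>lborel) = 1"
    by (subst nn_integral_eq_integral)
      (auto intro!: integrable_normal_density simp: integral_normal_density)
  finally show "emeasure std_gauss (space (std_gauss :: 'a measure)) = 1" by simp
qed

interpretation std_gauss: prob_space std_gauss
  by (rule prob_space_std_gauss)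

interpretation std_gauss_pair: pair_prob_space std_gauss std_gauss ..

interpretation std_gauss_PiM: product_prob_space "\<lambda>_. std_gauss" I for I
  by standard

section \<open>Rotation invariance of Lebesgue measure and of Gaussian measures\<close>

lemma nn_integral_lborel_plus:
  fixes c :: "'a::euclidean_space"
  assumes [measurable]: "f \<in> borel_measurable borel"
  shows "(\<integral>\<^sup>+x. f (x + c) \<partial>lborel) = (\<integral>\<^sup>+x. f x \<partial>lborel)"
proof -
  have "(\<integral>\<^sup>+x. f x \<partial>lborel) = (\<integral>\<^sup>+x. f x \<partial>distr lborel borel ((+) c))"
    by (simp add: lborel_distr_plus)
  also have "\<dots> = (\<integral>\<^sup>+x. f (c + x) \<partial>lborel)"
    by (subst nn_integral_distr) auto
  finally show ?thesis by (simp add: add.commute)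
qed

lemma nn_integral_shear_snd:
  fixes f :: "'a::euclidean_space \<times> 'a \<Rightarrow> ennreal"
  assumes [measurable]: "f \<in> borel_measurable (borel \<Otimes>\<^sub>M borel)"
  shows "(\<integral>\<^sup>+x. \<integral>\<^sup>+y. f (x, y + t *\<^sub>R x) \<partial>lborel \<partial>lborel) = (\<integral>\<^sup>+x. \<integral>\<^sup>+y. f (x, y) \<partial>lborel \<partial>lborel)"
  by (intro nn_integral_cong nn_integral_lborel_plus) measurable

lemma nn_integral_shear_fst:
  fixes f :: "'a::euclidean_space \<times> 'a \<Rightarrow> ennreal"
  assumes [measurable]: "f \<in> borel_measurable (borel \<Otimes>\<^sub>M borel)"
  shows "(\<integral>\<^sup>+x. \<integral>\<^sup>+y. f (x + t *\<^sub>R y, y) \<partial>lborel \<partial>lborel) = (\<integral>\<^sup>+x. \<integral>\<^sup>+y. f (x, y) \<partial>lborel \<partial>lborel)"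
proof -
  have "(\<integral>\<^sup>+x. \<integral>\<^sup>+y. f (x + t *\<^sub>R y, y) \<partial>lborel \<partial>lborel) = (\<integral>\<^sup>+y. \<integral>\<^sup>+x. f (x + t *\<^sub>R y, y) \<partial>lborel \<partial>lborel)"
    by (rule lborel_pair.Fubini'[symmetric]) measurable
  also have "\<dots> = (\<integral>\<^sup>+y. \<integral>\<^sup>+x. f (x, y) \<partial>lborel \<partial>lborel)"
    by (intro nn_integral_cong nn_integral_lborel_plus) measurable
  also have "\<dots> = (\<integral>\<^sup>+x. \<integral>\<^sup>+y. f (x, y) \<partial>lborel \<partial>lborel)"
    by (rule lborel_pair.Fubini') measurable
  finally show ?thesis .
qed

lemma nn_integral_lborel_rotate:
  fixes f :: "'a::euclidean_space \<times> 'a \<Rightarrow> ennreal"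
  assumes [measurable]: "f \<in> borel_measurable (borel \<Otimes>\<^sub>M borel)"
    and cs: "c\<^sup>2 + s\<^sup>2 = 1" and s: "s \<noteq> 0"
  shows "(\<integral>\<^sup>+x. \<integral>\<^sup>+y. f (c *\<^sub>R x - s *\<^sub>R y, s *\<^sub>R x + c *\<^sub>R y) \<partial>lborel \<partial>lborel) =
    (\<integral>\<^sup>+x. \<integral>\<^sup>+y. f (x, y) \<partial>lborel \<partial>lborel)"
proof -
  \<comment> \<open>A rotation is a product of three shears.\<close>
  define t where "t = (c - 1) / s"
  have c: "c = 1 + t * s" using s by (simp add: t_def)
  \<comment> \<open>For \<open>c = cos \<alpha>\<close> and \<open>s = sin \<alpha>\<close> the
    number \<open>t\<close> is minus the tangent of half the angle. This identity is the coefficient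
    of \<open>y\<close> after the two outer shears.\<close>
  have ts: "t * (1 + c) = - s"
    using cs s by (simp add: t_def field_simps power2_eq_square)
  define g1 where "g1 = (\<lambda>(x, y). f (x + t *\<^sub>R y, y))"
  define g2 where "g2 = (\<lambda>(x, y). g1 (x, y + s *\<^sub>R x))"
  have [measurable]: "g1 \<in> borel_measurable (borel \<Otimes>\<^sub>M borel)" "g2 \<in> borel_measurable (borel \<Otimes>\<^sub>M borel)"
    unfolding g1_def g2_def by measurable
  have "f (c *\<^sub>R x - s *\<^sub>R y, s *\<^sub>R x + c *\<^sub>R y) = g2 (x + t *\<^sub>R y, y)" for x y
  proof -
    have 1: "y + s *\<^sub>R (x + t *\<^sub>R y) = s *\<^sub>R x + c *\<^sub>R y"
      by (subst c) (simp add: algebra_simps)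
    have "x + t *\<^sub>R y + t *\<^sub>R (s *\<^sub>R x + c *\<^sub>R y) = (1 + t * s) *\<^sub>R x + (t * (1 + c)) *\<^sub>R y"
      by (simp add: algebra_simps)
    hence "x + t *\<^sub>R y + t *\<^sub>R (s *\<^sub>R x + c *\<^sub>R y) = c *\<^sub>R x - s *\<^sub>R y"
      unfolding ts c[symmetric] by simp
    with 1 show ?thesis by (simp add: g1_def g2_def)
  qed
  hence "(\<integral>\<^sup>+x. \<integral>\<^sup>+y. f (c *\<^sub>R x - s *\<^sub>R y, s *\<^sub>R x + c *\<^sub>R y) \<partial>lborel \<partial>lborel) =
      (\<integral>\<^sup>+x. \<integral>\<^sup>+y. g2 (x, y) \<partial>lborel \<partial>lborel)"
    using nn_integral_shear_fst[of g2 t] by simp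
  also have "\<dots> = (\<integral>\<^sup>+x. \<integral>\<^sup>+y. g1 (x, y) \<partial>lborel \<partial>lborel)"
    using nn_integral_shear_snd[of g1 s] by (simp add: g2_def)
  also have "\<dots> = (\<integral>\<^sup>+x. \<integral>\<^sup>+y. f (x, y) \<partial>lborel \<partial>lborel)"
    using nn_integral_shear_fst[of f t] by (simp add: g1_def)
  finally show ?thesis .
qed

lemma nn_integral_std_gauss_pair:
  fixes f :: "'a::euclidean_space \<times> 'a \<Rightarrow> ennreal"
  assumes [measurable]: "f \<in> borel_measurable (borel \<Otimes>\<^sub>M borel)"
  shows "(\<integral>\<^sup>+x. \<integral>\<^sup>+y. f (x, y) \<partial>std_gauss \<partial>std_gauss) =
    (\<integral>\<^sup>+x. \<integral>\<^sup>+y. ennreal (exp (- ((norm x)\<^sup>2 + (norm y)\<^sup>2) / 2) / (2 * pi) ^ DIM('a)) * f (x, y) \<partial>lborel \<partial>lborel)"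
proof -
  define d where "d = (\<lambda>x :: 'a. ennreal (exp (- (norm x)\<^sup>2 / 2) / sqrt (2 * pi) ^ DIM('a)))"
  have [measurable]: "d \<in> borel_measurable borel"
    unfolding d_def by measurable
  have K: "(sqrt (2 * pi) ^ DIM('a)) * (sqrt (2 * pi) ^ DIM('a)) = (2 * pi) ^ DIM('a)"
    by (simp only: power_mult_distrib[symmetric]) simp
  hence *: "d x * (d y * z) =
    ennreal (exp (- ((norm x)\<^sup>2 + (norm y)\<^sup>2) / 2) / (2 * pi) ^ DIM('a)) * z" for x y :: 'a and z
  proof -
    have assoc: "ennreal A * (ennreal B * z) = ennreal (A * B) * z" if "0 \<le> A" "0 \<le> B" for A B
      using that by (simp add: ennreal_mult mult.assoc)
    have "exp (- (norm x)\<^sup>2 / 2) / sqrt (2 * pi) ^ DIM('a) * (exp (- (norm y)\<^sup>2 / 2) / sqrt (2 * pi) ^ DIM('a)) =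
        exp (- (norm x)\<^sup>2 / 2 + - (norm y)\<^sup>2 / 2) / (2 * pi) ^ DIM('a)"
      unfolding times_divide_times_eq exp_add K ..
    also have "- (norm x)\<^sup>2 / 2 + - (norm y)\<^sup>2 / 2 = - ((norm x)\<^sup>2 + (norm y)\<^sup>2) / 2"
      by simp
    finally have "exp (- (norm x)\<^sup>2 / 2) / sqrt (2 * pi) ^ DIM('a) * (exp (- (norm y)\<^sup>2 / 2) / sqrt (2 * pi) ^ DIM('a)) =
        exp (- ((norm x)\<^sup>2 + (norm y)\<^sup>2) / 2) / (2 * pi) ^ DIM('a)" .
    thus ?thesis unfolding d_def by - (subst assoc, simp, simp, simp only:)
  qed
  have sd: "std_gauss = density lborel d" by (simp add: std_gauss_def d_def)
  have "(\<integral>\<^sup>+x. \<integral>\<^sup>+y. f (x, y) \<partial>std_gauss \<partial>std_gauss) = (\<integral>\<^sup>+x. \<integral>\<^sup>+y. d x * (d y * f (x, y)) \<partial>lborel \<partial>lborel)"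
    unfolding sd by (simp add: nn_integral_density nn_integral_cmult cong: nn_integral_cong)
  thus ?thesis unfolding * .
qed

text \<open>Rotations keep the sum of the squared norms, on which alone the joint density depends.
  The two arguments are vectors mixed with scalar coefficients, so that the lemma serves both for
  two particles and for two independent summands.\<close>

lemma nn_integral_std_gauss_rotate:
  fixes f :: "'a::euclidean_space \<times> 'a \<Rightarrow> ennreal"
  assumes f [measurable]: "f \<in> borel_measurable (borel \<Otimes>\<^sub>M borel)"
    and cs: "c\<^sup>2 + s\<^sup>2 = 1"
  shows "(\<integral>\<^sup>+x. \<integral>\<^sup>+y. f (c *\<^sub>R x - s *\<^sub>R y, s *\<^sub>R x + c *\<^sub>R y) \<partial>std_gauss \<partial>std_gauss) =
    (\<integral>\<^sup>+x. \<integral>\<^sup>+y. f (x, y) \<partial>std_gauss \<partial>std_gauss)"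
proof -
  have generic: "(\<integral>\<^sup>+x. \<integral>\<^sup>+y. f (c *\<^sub>R x - s *\<^sub>R y, s *\<^sub>R x + c *\<^sub>R y) \<partial>std_gauss \<partial>std_gauss) =
    (\<integral>\<^sup>+x. \<integral>\<^sup>+y. f (x, y) \<partial>std_gauss \<partial>std_gauss)"
    if [measurable]: "f \<in> borel_measurable (borel \<Otimes>\<^sub>M borel)" and cs: "c\<^sup>2 + s\<^sup>2 = 1" and s: "s \<noteq> 0"
    for f :: "'a \<times> 'a \<Rightarrow> ennreal" and c s
  proof -
    have n: "(norm (c *\<^sub>R x - s *\<^sub>R y))\<^sup>2 + (norm (s *\<^sub>R x + c *\<^sub>R y))\<^sup>2 = (norm x)\<^sup>2 + (norm y)\<^sup>2" for x y :: 'a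
    proof -
      have "(norm (c *\<^sub>R x - s *\<^sub>R y))\<^sup>2 + (norm (s *\<^sub>R x + c *\<^sub>R y))\<^sup>2 =
          (c\<^sup>2 + s\<^sup>2) * (x \<bullet> x) + (c\<^sup>2 + s\<^sup>2) * (y \<bullet> y)"
        unfolding power2_norm_eq_inner
        by (simp add: inner_simps inner_commute power2_eq_square algebra_simps)
      thus ?thesis by (simp add: cs power2_norm_eq_inner)
    qed
    define w where "w = (\<lambda>r. ennreal (exp (- r / 2) / (2 * pi) ^ DIM('a)))"
    have [measurable]: "w \<in> borel_measurable borel"
      unfolding w_def by measurable
    have pair: "(\<integral>\<^sup>+x. \<integral>\<^sup>+y. h (x, y) \<partial>std_gauss \<partial>std_gauss) =
        (\<integral>\<^sup>+x. \<integral>\<^sup>+y. w ((norm x)\<^sup>2 + (norm y)\<^sup>2) * h (x, y) \<partial>lborel \<partial>lborel)"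
      if "h \<in> borel_measurable (borel \<Otimes>\<^sub>M borel)" for h :: "'a \<times> 'a \<Rightarrow> ennreal"
      unfolding w_def by (rule nn_integral_std_gauss_pair[OF that])
    define g where "g = (\<lambda>(x, y). w ((norm x)\<^sup>2 + (norm y)\<^sup>2) * f (x, y))"
    have [measurable]: "g \<in> borel_measurable (borel \<Otimes>\<^sub>M borel)"
      unfolding g_def by measurable
    have "(\<integral>\<^sup>+x. \<integral>\<^sup>+y. f (c *\<^sub>R x - s *\<^sub>R y, s *\<^sub>R x + c *\<^sub>R y) \<partial>std_gauss \<partial>std_gauss) =
        (\<integral>\<^sup>+x. \<integral>\<^sup>+y. g (c *\<^sub>R x - s *\<^sub>R y, s *\<^sub>R x + c *\<^sub>R y) \<partial>lborel \<partial>lborel)"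
      using pair[of "\<lambda>(x, y). f (c *\<^sub>R x - s *\<^sub>R y, s *\<^sub>R x + c *\<^sub>R y)"]
      by (simp add: g_def n)
    also have "\<dots> = (\<integral>\<^sup>+x. \<integral>\<^sup>+y. g (x, y) \<partial>lborel \<partial>lborel)"
      by (rule nn_integral_lborel_rotate) (use cs s in auto)
    also have "\<dots> = (\<integral>\<^sup>+x. \<integral>\<^sup>+y. f (x, y) \<partial>std_gauss \<partial>std_gauss)"
      by (simp add: pair g_def)
    finally show ?thesis .
  qed
  show ?thesis
  proof (cases "s = 0")
    case False
    with generic[OF f cs] show ?thesis by simp
  next
    case True
    with cs have "c = 1 \<or> c = - 1" by (simp add: power2_eq_1_iff)
    thus ?thesis
    proof
      \<comment> \<open>The decomposition into shears divides by \<open>s\<close>. Minus the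
        identity is the square of a quarter turn, for which \<open>s = 1\<close>.\<close>
      assume c: "c = -1"
      have "(\<integral>\<^sup>+x. \<integral>\<^sup>+y. f (- x, - y) \<partial>std_gauss \<partial>std_gauss) =
          (\<integral>\<^sup>+x. \<integral>\<^sup>+y. f (- y, x) \<partial>std_gauss \<partial>std_gauss)"
        using generic[of "\<lambda>(x, y). f (- y, x)" 0 1] by simp
      also have "\<dots> = (\<integral>\<^sup>+x. \<integral>\<^sup>+y. f (x, y) \<partial>std_gauss \<partial>std_gauss)"
        using generic[of f 0 1] by simp
      finally show ?thesis using c True by simp
    qed (use True in simp)
  qed
qed

section \<open>Product structure in the particle coordinates\<close>

lemma borel_measurable_vec_nth [measurable]: "(\<lambda>x. x $ i) \<in> borel_measurable borel"
  by (intro borel_measurable_continuous_onI continuous_intros)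

lemma borel_measurable_vec_lambda [measurable (raw)]:
  fixes f :: "'i::finite \<Rightarrow> 'b \<Rightarrow> 'a::euclidean_space"
  assumes "\<And>i. f i \<in> borel_measurable M"
  shows "(\<lambda>x. \<chi> i. f i x) \<in> borel_measurable M"
proof (subst borel_measurable_euclidean_space, intro ballI)
  fix b :: "'a ^ 'i" assume "b \<in> Basis"
  then obtain i c where b: "b = axis i c" "c \<in> Basis"
    by (auto simp: Basis_vec_def)
  show "(\<lambda>x. (\<chi> i. f i x) \<bullet> b) \<in> borel_measurable M"
    using assms[of i] by (simp add: b inner_axis)
qed

lemma measurable_vec_lambda_PiM [measurable]:
  "vec_lambda \<in> PiM (UNIV :: 'i::finite set) (\<lambda>_. borel :: 'a::euclidean_space measure) \<rightarrow>\<^sub>M borel"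
  using borel_measurable_vec_lambda[of "\<lambda>i x. x i" "PiM UNIV (\<lambda>_. borel)"] by simp

lemma prod_Basis_vec:
  "(\<Prod>b\<in>(Basis :: ('a::euclidean_space ^ 'i::finite) set). g b) = (\<Prod>i\<in>UNIV. \<Prod>b\<in>Basis. g (axis i b))"
proof -
  have B: "(Basis :: ('a ^ 'i) set) = (\<lambda>(i, b). axis i b) ` (UNIV \<times> Basis)"
    by (auto simp: Basis_vec_def)
  have "inj_on (\<lambda>(i, b). axis i b) (UNIV \<times> (Basis :: 'a set) :: ('i \<times> 'a) set)"
    by (auto simp: inj_on_def axis_eq_axis)
  thus ?thesis
    unfolding B by (subst prod.reindex) (auto simp: prod.cartesian_product split_beta o_def)
qed

text \<open>Lebesgue measure on \<open>real^2^'n\<close> belongs to one Euclidean space, while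
  integrating out single particles is a statement about \<open>PiM\<close>. Both measures give a box
  the product of its side lengths, and this determines Lebesgue measure.\<close>

lemma lborel_vec:
  "(lborel :: ('a::euclidean_space ^ 'i::finite) measure) = distr (PiM UNIV (\<lambda>_. lborel)) borel vec_lambda"
proof (rule lborel_eqI)
  interpret product_sigma_finite "\<lambda>_. lborel :: 'a measure"
    by unfold_locales
  fix l u :: "'a ^ 'i" assume lu: "\<And>b. b \<in> Basis \<Longrightarrow> l \<bullet> b \<le> u \<bullet> b"
  have le: "l $ i \<bullet> b \<le> u $ i \<bullet> b" if "b \<in> Basis" for i b
    using lu[of "axis i b"] that by (simp add: inner_axis)
  have "vec_lambda -` box l u \<inter> space (PiM UNIV (\<lambda>_. lborel)) = PiE UNIV (\<lambda>i. box (l $ i) (u $ i))"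
    by (auto simp: mem_box Basis_vec_def inner_axis space_PiM PiE_def Pi_iff)
  hence "emeasure (distr (PiM UNIV (\<lambda>_. lborel)) borel vec_lambda) (box l u) =
      emeasure (PiM UNIV (\<lambda>_. lborel)) (PiE UNIV (\<lambda>i. box (l $ i) (u $ i)))"
    by (subst emeasure_distr) (auto cong: measurable_cong_sets sets_PiM_cong)
  also have "\<dots> = (\<Prod>i\<in>UNIV. emeasure lborel (box (l $ i) (u $ i)))"
    by (rule emeasure_PiM) auto
  also have "\<dots> = (\<Prod>b\<in>Basis. (u - l) \<bullet> b)"
    using le by (simp add: prod_Basis_vec inner_axis prod_ennreal emeasure_lborel_box inner_diff_left prod_nonneg)
  finally show "emeasure (distr (PiM UNIV (\<lambda>_. lborel)) borel vec_lambda) (box l u) = (\<Prod>b\<in>Basis. (u - l) \<bullet> b)" .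
qed simp

lemma density_PiM_lborel:
  fixes f :: "'a::euclidean_space \<Rightarrow> ennreal"
  assumes I: "finite I" and f[measurable]: "f \<in> borel_measurable borel"
    and sf: "sigma_finite_measure (density lborel f)"
  shows "density (PiM I (\<lambda>_. lborel)) (\<lambda>x. \<Prod>i\<in>I. f (x i)) = PiM I (\<lambda>_. density lborel f)"
proof -
  interpret L: product_sigma_finite "\<lambda>_. lborel :: 'a measure"
    by unfold_locales
  interpret D: product_sigma_finite "\<lambda>_. density lborel f"
    using sf by (simp add: product_sigma_finite_def)
  show ?thesis
  proof (rule D.PiM_eqI[OF I])
    show "sets (density (PiM I (\<lambda>_. lborel)) (\<lambda>x. \<Prod>i\<in>I. f (x i))) = sets (PiM I (\<lambda>_. density lborel f))"
      by (auto intro!: sets_PiM_cong)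
    fix A assume A: "\<And>i. i \<in> I \<Longrightarrow> A i \<in> sets (density lborel f)"
    have "emeasure (density (PiM I (\<lambda>_. lborel)) (\<lambda>x. \<Prod>i\<in>I. f (x i))) (PiE I A) =
        (\<integral>\<^sup>+x. (\<Prod>i\<in>I. f (x i)) * indicator (PiE I A) x \<partial>PiM I (\<lambda>_. lborel))"
      using I A by (subst emeasure_density) (auto intro!: sets_PiM_I_finite)
    also have "\<dots> = (\<integral>\<^sup>+x. (\<Prod>i\<in>I. f (x i) * indicator (A i) (x i)) \<partial>PiM I (\<lambda>_. lborel))"
      using I by (intro nn_integral_cong) (auto simp: space_PiM prod.distrib indicator_def PiE_def Pi_def)
    also have "\<dots> = (\<Prod>i\<in>I. \<integral>\<^sup>+x. f x * indicator (A i) x \<partial>lborel)"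
      using I A by (intro L.product_nn_integral_prod) auto
    also have "\<dots> = (\<Prod>i\<in>I. emeasure (density lborel f) (A i))"
      using A by (intro prod.cong refl) (auto simp: emeasure_density)
    finally show "emeasure (density (PiM I (\<lambda>_. lborel)) (\<lambda>x. \<Prod>i\<in>I. f (x i))) (PiE I A) =
       (\<Prod>i\<in>I. emeasure (density lborel f) (A i))" .
  qed
qed

lemma std_gauss_vec:
  "(std_gauss :: ('a::euclidean_space ^ 'i::finite) measure) = distr (PiM UNIV (\<lambda>_. std_gauss)) borel vec_lambda"
proof -
  let ?f = "\<lambda>x :: 'a. ennreal (exp (- (norm x)\<^sup>2 / 2) / sqrt (2 * pi) ^ DIM('a))"
  have vl: "vec_lambda \<in> PiM (UNIV :: 'i set) (\<lambda>_. lborel :: 'a measure) \<rightarrow>\<^sub>M borel"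
    using measurable_vec_lambda_PiM by (simp cong: measurable_cong_sets sets_PiM_cong)
  have "std_gauss = distr (density (PiM UNIV (\<lambda>_. lborel)) (\<lambda>x. \<Prod>i\<in>(UNIV :: 'i set). ?f (x i))) borel vec_lambda"
    unfolding std_gauss_def lborel_vec
    apply (subst density_distr[OF _ vl])
     apply measurable
    apply (intro arg_cong2[where f = "\<lambda>f. distr f borel"] arg_cong2[where f = density] refl ext)
    unfolding std_gauss_density_prod prod_Basis_vec
    by (simp add: inner_axis prod_ennreal prod_nonneg)
  also have "density (PiM UNIV (\<lambda>_. lborel)) (\<lambda>x. \<Prod>i\<in>(UNIV :: 'i set). ?f (x i)) =
      PiM UNIV (\<lambda>_. density lborel ?f)"
    by (rule density_PiM_lborel)
      (use prob_space_imp_sigma_finite[OF prob_space_std_gauss] in \<open>auto simp: std_gauss_def\<close>)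
  finally show ?thesis unfolding std_gauss_def .
qed

text \<open>For maps that move one particle: the others are frozen in \<open>w\<close>, and only the
  inner integral changes.\<close>

lemma nn_integral_std_gauss_vec_split:
  fixes f :: "'a::euclidean_space ^ 'i::finite \<Rightarrow> ennreal"
  assumes [measurable]: "f \<in> borel_measurable borel"
  shows "(\<integral>\<^sup>+x. f x \<partial>std_gauss) =
    (\<integral>\<^sup>+w. (\<integral>\<^sup>+y. f (\<chi> k. (w(i := y)) k) \<partial>std_gauss) \<partial>PiM (UNIV - {i}) (\<lambda>_. std_gauss))"
proof -
  have vl: "vec_lambda \<in> PiM (UNIV :: 'i set) (\<lambda>_. std_gauss :: 'a measure) \<rightarrow>\<^sub>M borel"
    using measurable_vec_lambda_PiM by (simp cong: measurable_cong_sets sets_PiM_cong)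
  note [measurable] = vl
  have UI: "insert i (UNIV - {i}) = UNIV" by auto
  have "(\<integral>\<^sup>+x. f x \<partial>std_gauss) = (\<integral>\<^sup>+w. f (vec_lambda w) \<partial>PiM (insert i (UNIV - {i})) (\<lambda>_. std_gauss))"
    unfolding std_gauss_vec UI by (subst nn_integral_distr) auto
  also have "\<dots> = (\<integral>\<^sup>+w. (\<integral>\<^sup>+y. f (vec_lambda (w(i := y))) \<partial>std_gauss) \<partial>PiM (UNIV - {i}) (\<lambda>_. std_gauss))"
    by (rule std_gauss_PiM.product_nn_integral_insert) (auto simp: UI)
  finally show ?thesis .
qed

lemma nn_integral_std_gauss_vec_split2:
  fixes f :: "'a::euclidean_space ^ 'i::finite \<Rightarrow> ennreal"
  assumes [measurable]: "f \<in> borel_measurable borel" and ij: "i \<noteq> j"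
  shows "(\<integral>\<^sup>+x. f x \<partial>std_gauss) =
    (\<integral>\<^sup>+w. (\<integral>\<^sup>+y. \<integral>\<^sup>+z. f (\<chi> k. (w(j := y, i := z)) k) \<partial>std_gauss \<partial>std_gauss) \<partial>PiM (UNIV - {i, j}) (\<lambda>_. std_gauss))"
proof -
  have UI: "insert j (UNIV - {i, j}) = UNIV - {i}" using ij by auto
  have "(\<integral>\<^sup>+x. f x \<partial>std_gauss) =
    (\<integral>\<^sup>+w. (\<integral>\<^sup>+y. f (\<chi> k. (w(i := y)) k) \<partial>std_gauss) \<partial>PiM (UNIV - {i}) (\<lambda>_. std_gauss))"
    by (rule nn_integral_std_gauss_vec_split) fact
  also have "\<dots> = (\<integral>\<^sup>+w. (\<integral>\<^sup>+y. \<integral>\<^sup>+z. f (\<chi> k. (w(j := y, i := z)) k) \<partial>std_gauss \<partial>std_gauss) \<partial>PiM (UNIV - {i, j}) (\<lambda>_. std_gauss))"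
    unfolding UI[symmetric]
  proof (rule std_gauss_PiM.product_nn_integral_insert)
    have m: "(\<lambda>p. (fst p)(i := snd p)) \<in> (PiM (UNIV - {i}) (\<lambda>_. std_gauss) \<Otimes>\<^sub>M std_gauss) \<rightarrow>\<^sub>M PiM UNIV (\<lambda>_. std_gauss :: 'a measure)"
      using measurable_add_dim[of i "UNIV - {i}" "\<lambda>_. std_gauss :: 'a measure"]
      by (simp add: split_beta' insert_absorb)
    have "vec_lambda \<in> PiM (UNIV :: 'i set) (\<lambda>_. std_gauss :: 'a measure) \<rightarrow>\<^sub>M borel"
      using measurable_vec_lambda_PiM by (simp cong: measurable_cong_sets sets_PiM_cong)
    from measurable_compose[OF m this]
    have [measurable]: "(\<lambda>(w, y). f (\<chi> k. (w(i := y)) k)) \<in> borel_measurable (PiM (UNIV - {i}) (\<lambda>_. std_gauss) \<Otimes>\<^sub>M std_gauss)"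
      by (simp add: split_beta' del: fun_upd_apply)
    show "(\<lambda>w. \<integral>\<^sup>+y. f (\<chi> k. (w(i := y)) k) \<partial>std_gauss) \<in> borel_measurable (PiM (insert j (UNIV - {i, j})) (\<lambda>_. std_gauss))"
      unfolding UI by measurable
  qed auto
  finally show ?thesis .
qed

section \<open>Maps that preserve all centred Gaussian measures\<close>

definition rotate_coords :: "'i \<Rightarrow> 'i \<Rightarrow> real \<Rightarrow> real \<Rightarrow> 'a::real_vector ^ 'i \<Rightarrow> 'a ^ 'i" where
  "rotate_coords i j c s x = (\<chi> k. if k = i then c *\<^sub>R (x $ i) - s *\<^sub>R (x $ j)
     else if k = j then s *\<^sub>R (x $ i) + c *\<^sub>R (x $ j) else x $ k)"

text \<open>The reference variance differs from step to step, hence all dilations at once. Dilating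
  the argument under \<open>std_gauss\<close> gives a meaning to \<sigma> = 0 too, where the
  condition says that \<open>T\<close> fixes the origin.\<close>

definition gauss_preserving :: "('a::euclidean_space \<Rightarrow> 'a) \<Rightarrow> bool" where
  "gauss_preserving T \<longleftrightarrow> T \<in> borel_measurable borel \<and>
     (\<forall>\<sigma>. \<forall>f\<in>borel_measurable borel. (\<integral>\<^sup>+x. f (T (\<sigma> *\<^sub>R x)) \<partial>std_gauss) = (\<integral>\<^sup>+x. f (\<sigma> *\<^sub>R x) \<partial>std_gauss))"

lemma gauss_preserving_measurable: "gauss_preserving T \<Longrightarrow> T \<in> borel_measurable borel"
  by (simp add: gauss_preserving_def)

lemma gauss_preservingD:
  "gauss_preserving T \<Longrightarrow> f \<in> borel_measurable borel \<Longrightarrow>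
    (\<integral>\<^sup>+x. f (T (\<sigma> *\<^sub>R x)) \<partial>std_gauss) = (\<integral>\<^sup>+x. f (\<sigma> *\<^sub>R x) \<partial>std_gauss)"
  by (simp add: gauss_preserving_def)

lemma gauss_preserving_id: "gauss_preserving (\<lambda>x. x)"
  by (simp add: gauss_preserving_def)

lemma gauss_preserving_compose:
  assumes S: "gauss_preserving S" and T: "gauss_preserving T"
  shows "gauss_preserving (\<lambda>x. S (T x))"
proof -
  note [measurable] = S[THEN gauss_preserving_measurable] T[THEN gauss_preserving_measurable]
  show ?thesis
    unfolding gauss_preserving_def
  proof (intro conjI allI ballI)
    fix \<sigma> and f :: "'a \<Rightarrow> ennreal" assume [measurable]: "f \<in> borel_measurable borel"
    show "(\<integral>\<^sup>+x. f (S (T (\<sigma> *\<^sub>R x))) \<partial>std_gauss) = (\<integral>\<^sup>+x. f (\<sigma> *\<^sub>R x) \<partial>std_gauss)"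
      using gauss_preservingD[OF T, of "\<lambda>x. f (S x)" \<sigma>] gauss_preservingD[OF S, of f \<sigma>] by simp
  qed measurable
qed

lemma gauss_preserving_rotate_coords:
  fixes i j :: "'i::finite"
  assumes ij: "i \<noteq> j" and cs: "c\<^sup>2 + s\<^sup>2 = 1"
  shows "gauss_preserving (rotate_coords i j c s :: 'a::euclidean_space ^ 'i \<Rightarrow> _)"
  unfolding gauss_preserving_def
proof (intro conjI allI ballI)
  show m[measurable]: "(rotate_coords i j c s :: 'a ^ 'i \<Rightarrow> _) \<in> borel_measurable borel"
    unfolding rotate_coords_def by measurable
  fix \<sigma> and f :: "'a ^ 'i \<Rightarrow> ennreal" assume [measurable]: "f \<in> borel_measurable borel"
  \<comment> \<open>Dilations commute with the linear map, so they can be absorbed into the test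
    function.\<close>
  define g where "g x = f (\<sigma> *\<^sub>R x)" for x
  have [measurable]: "g \<in> borel_measurable borel" unfolding g_def by measurable
  have g: "f (rotate_coords i j c s (\<sigma> *\<^sub>R x)) = g (rotate_coords i j c s x)" for x
    by (auto simp: g_def rotate_coords_def vec_eq_iff scaleR_diff_right scaleR_add_right
        mult.commute intro!: arg_cong[of _ _ f])
  have "(\<integral>\<^sup>+x. g (rotate_coords i j c s x) \<partial>std_gauss) =
    (\<integral>\<^sup>+w. (\<integral>\<^sup>+y. \<integral>\<^sup>+z. g (rotate_coords i j c s (\<chi> k. (w(j := y, i := z)) k)) \<partial>std_gauss \<partial>std_gauss)
      \<partial>PiM (UNIV - {i, j}) (\<lambda>_. std_gauss))"
    by (rule nn_integral_std_gauss_vec_split2) (use ij in auto)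
  also have "\<dots> = (\<integral>\<^sup>+w. (\<integral>\<^sup>+y. \<integral>\<^sup>+z. g (\<chi> k. (w(j := y, i := z)) k) \<partial>std_gauss \<partial>std_gauss)
      \<partial>PiM (UNIV - {i, j}) (\<lambda>_. std_gauss))"
  proof (rule nn_integral_cong)
    fix w :: "'i \<Rightarrow> 'a"
    define h where "h = (\<lambda>(y, z). g (\<chi> k. (w(j := y, i := z)) k))"
    have [measurable]: "(\<lambda>p. \<chi> k. (w(j := fst p, i := snd p)) k) \<in> borel_measurable (borel \<Otimes>\<^sub>M (borel :: 'a measure))"
    proof (rule borel_measurable_vec_lambda)
      fix k show "(\<lambda>p. (w(j := fst p, i := snd p)) k) \<in> borel_measurable (borel \<Otimes>\<^sub>M (borel :: 'a measure))"
        by (cases "k = i"; cases "k = j") auto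
    qed
    have [measurable]: "h \<in> borel_measurable (borel \<Otimes>\<^sub>M borel)"
      unfolding h_def split_beta' by measurable
    \<comment> \<open>The first argument of \<open>h\<close> is the particle \<open>j\<close>, the
      second is \<open>i\<close>; exchanging the axes reverses the orientation and thus the sign of
      the sine.\<close>
    have L: "g (rotate_coords i j c s (\<chi> k. (w(j := y, i := z)) k)) = h (c *\<^sub>R y - (- s) *\<^sub>R z, (- s) *\<^sub>R y + c *\<^sub>R z)" for y z
      using ij by (auto simp: h_def rotate_coords_def vec_eq_iff intro!: arg_cong[of _ _ g])
    have R: "g (\<chi> k. (w(j := y, i := z)) k) = h (y, z)" for y z
      by (simp only: h_def prod.case)
    show "(\<integral>\<^sup>+y. \<integral>\<^sup>+z. g (rotate_coords i j c s (\<chi> k. (w(j := y, i := z)) k)) \<partial>std_gauss \<partial>std_gauss) =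
        (\<integral>\<^sup>+y. \<integral>\<^sup>+z. g (\<chi> k. (w(j := y, i := z)) k) \<partial>std_gauss \<partial>std_gauss)"
      unfolding L R by (rule nn_integral_std_gauss_rotate) (use cs in auto)
  qed
  also have "\<dots> = (\<integral>\<^sup>+x. g x \<partial>std_gauss)"
    by (rule nn_integral_std_gauss_vec_split2[symmetric]) (use ij in auto)
  finally show "(\<integral>\<^sup>+x. f (rotate_coords i j c s (\<sigma> *\<^sub>R x)) \<partial>std_gauss) = (\<integral>\<^sup>+x. f (\<sigma> *\<^sub>R x) \<partial>std_gauss)"
    by (simp add: g) (simp add: g_def)
qed

definition map_coord :: "'i \<Rightarrow> ('a \<Rightarrow> 'a) \<Rightarrow> 'a ^ 'i \<Rightarrow> 'a ^ 'i" where
  "map_coord i T x = (\<chi> k. if k = i then T (x $ i) else x $ k)"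

lemma gauss_preserving_map_coord:
  fixes i :: "'i::finite" and T :: "'a::euclidean_space \<Rightarrow> 'a"
  assumes T: "gauss_preserving T"
  shows "gauss_preserving (map_coord i T)"
  unfolding gauss_preserving_def
proof (intro conjI allI ballI)
  note [measurable] = T[THEN gauss_preserving_measurable]
  show m[measurable]: "map_coord i T \<in> borel_measurable borel"
    unfolding map_coord_def by measurable
  fix \<sigma> and f :: "'a ^ 'i \<Rightarrow> ennreal" assume [measurable]: "f \<in> borel_measurable borel"
  have "(\<integral>\<^sup>+x. f (map_coord i T (\<sigma> *\<^sub>R x)) \<partial>std_gauss) =
    (\<integral>\<^sup>+w. (\<integral>\<^sup>+y. f (map_coord i T (\<sigma> *\<^sub>R (\<chi> k. (w(i := y)) k))) \<partial>std_gauss) \<partial>PiM (UNIV - {i}) (\<lambda>_. std_gauss))"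
    by (rule nn_integral_std_gauss_vec_split) auto
  also have "\<dots> = (\<integral>\<^sup>+w. (\<integral>\<^sup>+y. f (\<sigma> *\<^sub>R (\<chi> k. (w(i := y)) k)) \<partial>std_gauss) \<partial>PiM (UNIV - {i}) (\<lambda>_. std_gauss))"
  proof (rule nn_integral_cong)
    fix w :: "'i \<Rightarrow> 'a"
    define h where "h y = f (\<chi> k. ((\<lambda>k. \<sigma> *\<^sub>R w k)(i := y)) k)" for y
    have [measurable]: "(\<lambda>y. \<chi> k. ((\<lambda>k. \<sigma> *\<^sub>R w k)(i := y)) k) \<in> borel_measurable borel"
    proof (rule borel_measurable_vec_lambda)
      fix k show "(\<lambda>y. ((\<lambda>k. \<sigma> *\<^sub>R w k)(i := y)) k) \<in> borel_measurable borel"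
        by (cases "k = i") auto
    qed
    have [measurable]: "h \<in> borel_measurable borel"
      unfolding h_def by measurable
    have "f (map_coord i T (\<sigma> *\<^sub>R (\<chi> k. (w(i := y)) k))) = h (T (\<sigma> *\<^sub>R y))"
      "f (\<sigma> *\<^sub>R (\<chi> k. (w(i := y)) k)) = h (\<sigma> *\<^sub>R y)" for y
      by (auto simp: h_def map_coord_def vec_eq_iff intro!: arg_cong[of _ _ f])
    thus "(\<integral>\<^sup>+y. f (map_coord i T (\<sigma> *\<^sub>R (\<chi> k. (w(i := y)) k))) \<partial>std_gauss) =
        (\<integral>\<^sup>+y. f (\<sigma> *\<^sub>R (\<chi> k. (w(i := y)) k)) \<partial>std_gauss)"
      using gauss_preservingD[OF T, of h \<sigma>] by simp
  qed
  also have "\<dots> = (\<integral>\<^sup>+x. f (\<sigma> *\<^sub>R x) \<partial>std_gauss)"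
    by (rule nn_integral_std_gauss_vec_split[symmetric]) auto
  finally show "(\<integral>\<^sup>+x. f (map_coord i T (\<sigma> *\<^sub>R x)) \<partial>std_gauss) = (\<integral>\<^sup>+x. f (\<sigma> *\<^sub>R x) \<partial>std_gauss)" .
qed

subsection \<open>Twist maps\<close>

text \<open>Modulo the period the shift is some \<open>d\<close> with
  \<open>0 \<le> d < 2 * pi\<close>. The part of the shifted interval beyond \<open>2 * pi\<close>
  is then moved back by one period.\<close>

lemma nn_integral_periodic_shift:
  fixes F :: "real \<Rightarrow> ennreal"
  assumes [measurable]: "F \<in> borel_measurable borel"
    and per: "\<And>x. F (x + 2 * pi) = F x"
  shows "(\<integral>\<^sup>+x. F (x + c) * indicator {0..<2 * pi} x \<partial>lborel) = (\<integral>\<^sup>+x. F x * indicator {0..<2 * pi} x \<partial>lborel)"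
proof -
  have per_int: "F (x + 2 * pi * of_int m) = F x" for x m
  proof (induction m rule: int_induct[where k = 0])
    case (step1 i)
    have "F (x + 2 * pi * of_int (i + 1)) = F ((x + 2 * pi * of_int i) + 2 * pi)"
      by (simp add: algebra_simps)
    with step1 per show ?case by simp
  next
    case (step2 i)
    have "F (x + 2 * pi * of_int (i - 1)) = F ((x + 2 * pi * of_int (i - 1)) + 2 * pi)"
      by (simp add: per)
    also have "\<dots> = F (x + 2 * pi * of_int i)" by (simp add: algebra_simps)
    finally show ?case using step2 by simp
  qed simp
  define m where "m = \<lfloor>c / (2 * pi)\<rfloor>"
  define d where "d = c - 2 * pi * of_int m"
  have d: "0 \<le> d" "d < 2 * pi"
    using floor_divide_lower[of "2 * pi" c] floor_divide_upper[of "2 * pi" c]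
    by (auto simp: d_def m_def algebra_simps)
  have "F (x + c) = F (x + d)" for x
    using per_int[of "x + d" m] by (simp add: d_def)
  hence "(\<integral>\<^sup>+x. F (x + c) * indicator {0..<2 * pi} x \<partial>lborel) = (\<integral>\<^sup>+x. F (x + d) * indicator {0..<2 * pi} x \<partial>lborel)"
    by simp
  also have "\<dots> = (\<integral>\<^sup>+x. F (x + d) * indicator {d..<d + 2 * pi} (x + d) \<partial>lborel)"
    by (intro nn_integral_cong arg_cong2[where f = "(*)"]) (auto simp: indicator_def)
  also have "\<dots> = (\<integral>\<^sup>+x. F x * indicator {d..<d + 2 * pi} x \<partial>lborel)"
    by (rule nn_integral_lborel_plus) measurable
  also have "\<dots> = (\<integral>\<^sup>+x. F x * indicator {d..<2 * pi} x + F x * indicator {2 * pi..<d + 2 * pi} x \<partial>lborel)"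
    using d by (intro nn_integral_cong) (auto simp: indicator_def)
  also have "\<dots> = (\<integral>\<^sup>+x. F x * indicator {d..<2 * pi} x \<partial>lborel) + (\<integral>\<^sup>+x. F x * indicator {2 * pi..<d + 2 * pi} x \<partial>lborel)"
    by (rule nn_integral_add) auto
  also have "(\<integral>\<^sup>+x. F x * indicator {2 * pi..<d + 2 * pi} x \<partial>lborel) =
      (\<integral>\<^sup>+x. F (x + 2 * pi) * indicator {2 * pi..<d + 2 * pi} (x + 2 * pi) \<partial>lborel)"
    by (rule nn_integral_lborel_plus[symmetric]) measurable
  also have "\<dots> = (\<integral>\<^sup>+x. F x * indicator {0..<d} x \<partial>lborel)"
    by (intro nn_integral_cong arg_cong2[where f = "(*)"]) (auto simp: indicator_def per)
  also have "(\<integral>\<^sup>+x. F x * indicator {d..<2 * pi} x \<partial>lborel) + (\<integral>\<^sup>+x. F x * indicator {0..<d} x \<partial>lborel) =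
      (\<integral>\<^sup>+x. F x * indicator {d..<2 * pi} x + F x * indicator {0..<d} x \<partial>lborel)"
    by (rule nn_integral_add[symmetric]) auto
  also have "\<dots> = (\<integral>\<^sup>+x. F x * indicator {0..<2 * pi} x \<partial>lborel)"
    using d by (intro nn_integral_cong) (auto simp: indicator_def)
  finally show ?thesis .
qed

definition rot2 :: "real \<Rightarrow> real^2 \<Rightarrow> real^2" where
  "rot2 \<alpha> y = cos \<alpha> *\<^sub>R y + sin \<alpha> *\<^sub>R perp y"

lemma perp_nth [simp]: "perp x $ 1 = - x $ 2" "perp x $ 2 = x $ 1"
  by (simp_all add: perp_def)

lemma rot2_eq_rotate_coords: "rot2 \<alpha> = rotate_coords 1 2 (cos \<alpha>) (sin \<alpha>)"
  by (auto simp: fun_eq_iff rot2_def rotate_coords_def vec_eq_iff forall_2)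

lemma norm_rot2 [simp]: "norm (rot2 \<alpha> y) = norm y"
proof -
  have key: "(c * a - s * b)\<^sup>2 + (c * b + s * a)\<^sup>2 = (c\<^sup>2 + s\<^sup>2) * (a\<^sup>2 + b\<^sup>2)" for a b c s :: real
    by (simp add: power2_eq_square algebra_simps)
  have n: "(norm z)\<^sup>2 = (z $ 1)\<^sup>2 + (z $ 2)\<^sup>2" for z :: "real^2"
    unfolding power2_norm_eq_inner by (simp add: inner_vec_def sum_2 power2_eq_square)
  have "(norm (rot2 \<alpha> y))\<^sup>2 = (norm y)\<^sup>2"
    using key[of "cos \<alpha>" "y $ 1" "sin \<alpha>" "y $ 2"] by (simp add: n rot2_def)
  thus ?thesis by simp
qed

lemma rot2_rot2: "rot2 \<alpha> (rot2 \<beta> y) = rot2 (\<alpha> + \<beta>) y"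
  by (simp add: rot2_def vec_eq_iff forall_2 cos_add sin_add algebra_simps)

lemma rot2_scaleR: "rot2 \<alpha> (\<sigma> *\<^sub>R y) = \<sigma> *\<^sub>R rot2 \<alpha> y"
  by (simp add: rot2_def vec_eq_iff forall_2 algebra_simps)

lemma measurable_rot2 [measurable]:
  "(\<lambda>(\<alpha>, y). rot2 \<alpha> y) \<in> borel_measurable (borel \<Otimes>\<^sub>M borel)"
proof -
  have "(\<lambda>p. rot2 (fst p) (snd p)) = (\<lambda>p. \<chi> k. if k = 1 then cos (fst p) * snd p $ 1 - sin (fst p) * snd p $ 2
      else cos (fst p) * snd p $ 2 + sin (fst p) * snd p $ 1)"
    by (auto simp: fun_eq_iff vec_eq_iff forall_2 rot2_def)
  also have "\<dots> \<in> borel_measurable (borel \<Otimes>\<^sub>M borel)"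
    by (intro borel_measurable_vec_lambda measurable_If) auto
  finally show ?thesis by (simp add: split_beta')
qed

text \<open>This is the time-one flow of the field with value
  \<open>\<theta> (norm y) *\<^sub>R perp y\<close> at \<open>y\<close>: the norm, and with it the
  angular velocity, is constant along the flow.\<close>

definition twist :: "(real \<Rightarrow> real) \<Rightarrow> real^2 \<Rightarrow> real^2" where
  "twist \<theta> y = rot2 (\<theta> (norm y)) y"

lemma measurable_twist [measurable]:
  "\<theta> \<in> borel_measurable borel \<Longrightarrow> twist \<theta> \<in> borel_measurable borel"
  unfolding twist_def
  using measurable_compose[OF _ measurable_rot2, of "\<lambda>y. (\<theta> (norm y), y)" borel] by simp

lemma nn_integral_std_gauss_rot2:
  "f \<in> borel_measurable borel \<Longrightarrow> (\<integral>\<^sup>+y. f (rot2 \<alpha> y) \<partial>std_gauss) = (\<integral>\<^sup>+y. f y \<partial>std_gauss)"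
  using gauss_preservingD[OF gauss_preserving_rotate_coords, of 1 2 "cos \<alpha>" "sin \<alpha>" f 1]
  by (simp add: rot2_eq_rotate_coords)

text \<open>Averaging over an additional rotation by a constant angle, the radius-dependent angle
  is absorbed by a shift of the constant one.\<close>

lemma nn_integral_std_gauss_twist:
  assumes [measurable]: "\<theta> \<in> borel_measurable borel" "f \<in> borel_measurable borel"
  shows "(\<integral>\<^sup>+y. f (twist \<theta> y) \<partial>std_gauss) = (\<integral>\<^sup>+y. f y \<partial>std_gauss)"
proof -
  let ?I = "\<lambda>x :: real. indicator {0..<2 * pi} x :: ennreal"
  interpret P: pair_sigma_finite lborel "std_gauss :: (real^2) measure" ..
  have tot: "(\<integral>\<^sup>+\<alpha>. c * ?I \<alpha> \<partial>lborel) = c * ennreal (2 * pi)" for c :: ennreal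
    by (simp add: nn_integral_cmult)
  have tw: "twist \<theta> (rot2 \<alpha> y) = rot2 (\<alpha> + \<theta> (norm y)) y" for \<alpha> y
    by (simp add: twist_def rot2_rot2 add.commute)
  have "(\<integral>\<^sup>+y. f (twist \<theta> y) \<partial>std_gauss) * ennreal (2 * pi) =
      (\<integral>\<^sup>+\<alpha>. (\<integral>\<^sup>+y. f (twist \<theta> y) \<partial>std_gauss) * ?I \<alpha> \<partial>lborel)"
    by (rule tot[symmetric])
  also have "\<dots> = (\<integral>\<^sup>+\<alpha>. (\<integral>\<^sup>+y. f (twist \<theta> (rot2 \<alpha> y)) \<partial>std_gauss) * ?I \<alpha> \<partial>lborel)"
    by (subst nn_integral_std_gauss_rot2) auto
  also have "\<dots> = (\<integral>\<^sup>+\<alpha>. (\<integral>\<^sup>+y. f (rot2 (\<alpha> + \<theta> (norm y)) y) * ?I \<alpha> \<partial>std_gauss) \<partial>lborel)"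
    by (simp add: tw nn_integral_multc)
  also have "\<dots> = (\<integral>\<^sup>+y. (\<integral>\<^sup>+\<alpha>. f (rot2 (\<alpha> + \<theta> (norm y)) y) * ?I \<alpha> \<partial>lborel) \<partial>std_gauss)"
    by (rule P.Fubini'[symmetric]) measurable
  also have "\<dots> = (\<integral>\<^sup>+y. (\<integral>\<^sup>+\<alpha>. f (rot2 \<alpha> y) * ?I \<alpha> \<partial>lborel) \<partial>std_gauss)"
    by (intro nn_integral_cong nn_integral_periodic_shift) (auto simp: rot2_def)
  also have "\<dots> = (\<integral>\<^sup>+\<alpha>. (\<integral>\<^sup>+y. f (rot2 \<alpha> y) * ?I \<alpha> \<partial>std_gauss) \<partial>lborel)"
    by (rule P.Fubini') measurable
  also have "\<dots> = (\<integral>\<^sup>+\<alpha>. (\<integral>\<^sup>+y. f (rot2 \<alpha> y) \<partial>std_gauss) * ?I \<alpha> \<partial>lborel)"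
    by (simp add: nn_integral_multc)
  also have "\<dots> = (\<integral>\<^sup>+\<alpha>. (\<integral>\<^sup>+y. f y \<partial>std_gauss) * ?I \<alpha> \<partial>lborel)"
    by (subst nn_integral_std_gauss_rot2) auto
  also have "\<dots> = (\<integral>\<^sup>+y. f y \<partial>std_gauss) * ennreal (2 * pi)"
    by (rule tot)
  finally show ?thesis
    by (metis ennreal_mult_cancel_left ennreal_eq_0_iff ennreal_neq_top mult.commute not_le pi_gt_zero zero_less_mult_iff zero_less_numeral)
qed

lemma gauss_preserving_twist:
  assumes [measurable]: "\<theta> \<in> borel_measurable borel"
  shows "gauss_preserving (twist \<theta>)"
  unfolding gauss_preserving_def
proof (intro conjI allI ballI)
  fix \<sigma> and f :: "real^2 \<Rightarrow> ennreal" assume [measurable]: "f \<in> borel_measurable borel"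
  \<comment> \<open>A dilation only changes the radius at which \<theta> is evaluated, so the claim
    for \<sigma> is the undilated one for another profile.\<close>
  have "twist \<theta> (\<sigma> *\<^sub>R x) = \<sigma> *\<^sub>R twist (\<lambda>r. \<theta> (\<bar>\<sigma>\<bar> * r)) x" for x
    by (simp add: twist_def rot2_scaleR)
  moreover have "(\<lambda>r. \<theta> (\<bar>\<sigma>\<bar> * r)) \<in> borel_measurable borel" by measurable
  ultimately show "(\<integral>\<^sup>+x. f (twist \<theta> (\<sigma> *\<^sub>R x)) \<partial>std_gauss) = (\<integral>\<^sup>+x. f (\<sigma> *\<^sub>R x) \<partial>std_gauss)"
    using nn_integral_std_gauss_twist[of "\<lambda>r. \<theta> (\<bar>\<sigma>\<bar> * r)" "\<lambda>x. f (\<sigma> *\<^sub>R x)"] by simp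
qed measurable

text \<open>The two particles move by \<open>e\<close> and \<open>- e\<close>. Their midpoint stays,
  and the factor 1/2 in \<open>e\<close> makes the new distance vector equal to
  \<open>twist \<theta> d\<close>.\<close>

definition pair_twist :: "(real \<Rightarrow> real) \<Rightarrow> 'i \<times> 'i \<Rightarrow> real^2^'i \<Rightarrow> real^2^'i::finite" where
  "pair_twist \<theta> p x = (let d = x $ fst p - x $ snd p; e = (1 / 2) *\<^sub>R (twist \<theta> d - d) in
     x + (axis (fst p) e - axis (snd p) e))"

text \<open>A rotation by an eighth of a turn passes to the orthonormal coordinates formed by the
  difference and the sum of the two particles, both divided by \<open>sqrt 2\<close>. The pair twist
  acts on the first one only. The profile is read at \<open>sqrt 2 * r\<close> because this
  coordinate is shorter than the distance vector by the factor \<open>sqrt 2\<close>.\<close>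

lemma pair_twist_conv_rotate_coords:
  assumes "i \<noteq> j"
  shows "pair_twist \<theta> (i, j) x =
    rotate_coords i j (1 / sqrt 2) (- (1 / sqrt 2)) (map_coord i (twist (\<lambda>r. \<theta> (sqrt 2 * r)))
      (rotate_coords i j (1 / sqrt 2) (1 / sqrt 2) x))"
proof -
  define d where "d = x $ i - x $ j"
  have h: "1 / sqrt 2 * (1 / sqrt 2) = (1 / 2 :: real)" by simp
  have tw: "(1 / sqrt 2) *\<^sub>R twist (\<lambda>r. \<theta> (sqrt 2 * r)) ((1 / sqrt 2) *\<^sub>R d) = (1 / 2) *\<^sub>R twist \<theta> d"
    by (simp add: twist_def rot2_scaleR h)
  have di: "(1 / sqrt 2) *\<^sub>R x $ i - (1 / sqrt 2) *\<^sub>R x $ j = (1 / sqrt 2) *\<^sub>R d"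
    by (simp add: d_def scaleR_diff_right)
  have s: "(1 / sqrt 2) *\<^sub>R ((1 / sqrt 2) *\<^sub>R x $ i + (1 / sqrt 2) *\<^sub>R x $ j) = (1 / 2) *\<^sub>R (x $ i + x $ j)"
    by (simp only: scaleR_add_right scaleR_scaleR h)
  show ?thesis
  proof (rule vec_eq_iff[THEN iffD2], rule allI)
    fix k
    define y where "y = twist (\<lambda>r. \<theta> (sqrt 2 * r)) ((1 / sqrt 2) *\<^sub>R d)"
    consider "k = i" | "k = j" | "k \<noteq> i" "k \<noteq> j" by blast
    thus "pair_twist \<theta> (i, j) x $ k = rotate_coords i j (1 / sqrt 2) (- (1 / sqrt 2)) (map_coord i (twist (\<lambda>r. \<theta> (sqrt 2 * r)))
      (rotate_coords i j (1 / sqrt 2) (1 / sqrt 2) x)) $ k"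
    proof cases
      case 1
      hence "rotate_coords i j (1 / sqrt 2) (- (1 / sqrt 2)) (map_coord i (twist (\<lambda>r. \<theta> (sqrt 2 * r)))
        (rotate_coords i j (1 / sqrt 2) (1 / sqrt 2) x)) $ k = (1 / sqrt 2) *\<^sub>R y + (1 / 2) *\<^sub>R (x $ i + x $ j)"
        using assms by (simp add: rotate_coords_def map_coord_def di y_def s[symmetric])
      also have "\<dots> = x $ i + (1 / 2) *\<^sub>R (twist \<theta> d - d)"
        unfolding y_def tw by (simp add: vec_eq_iff d_def field_simps)
      finally show ?thesis using 1 assms by (simp add: pair_twist_def d_def Let_def axis_def)
    next
      case 2
      hence "rotate_coords i j (1 / sqrt 2) (- (1 / sqrt 2)) (map_coord i (twist (\<lambda>r. \<theta> (sqrt 2 * r)))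
        (rotate_coords i j (1 / sqrt 2) (1 / sqrt 2) x)) $ k = (1 / 2) *\<^sub>R (x $ i + x $ j) - (1 / sqrt 2) *\<^sub>R y"
        using assms by (simp add: rotate_coords_def map_coord_def di y_def s[symmetric])
      also have "\<dots> = x $ j - (1 / 2) *\<^sub>R (twist \<theta> d - d)"
        unfolding y_def tw by (simp add: vec_eq_iff d_def field_simps)
      finally show ?thesis using 2 assms by (simp add: pair_twist_def d_def Let_def axis_def)
    qed (simp add: pair_twist_def rotate_coords_def map_coord_def Let_def axis_def)
  qed
qed

lemma gauss_preserving_pair_twist:
  assumes "fst p \<noteq> snd p" and [measurable]: "\<theta> \<in> borel_measurable borel"
  shows "gauss_preserving (pair_twist \<theta> p)"
proof -
  obtain i j where p: "p = (i, j)" "i \<noteq> j" using assms(1) by (cases p) auto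
  have sq: "(1 / sqrt 2)\<^sup>2 + (1 / sqrt 2)\<^sup>2 = (1 :: real)" "(1 / sqrt 2)\<^sup>2 + (- (1 / sqrt 2))\<^sup>2 = (1 :: real)"
    by (simp_all add: power_divide)
  show ?thesis
    unfolding p(1) pair_twist_conv_rotate_coords[OF p(2)]
    apply (rule gauss_preserving_compose[of "rotate_coords i j (1 / sqrt 2) (- (1 / sqrt 2))"])
     apply (rule gauss_preserving_rotate_coords[OF p(2) sq(2)])
    apply (rule gauss_preserving_compose[of "map_coord i (twist (\<lambda>r. \<theta> (sqrt 2 * r)))"])
     apply (rule gauss_preserving_map_coord, rule gauss_preserving_twist, measurable)
    apply (rule gauss_preserving_rotate_coords[OF p(2) sq(1)])
    done
qed

lemma gauss_preserving_fold:
  assumes "\<And>p. p \<in> set ps \<Longrightarrow> gauss_preserving (T p)"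
  shows "gauss_preserving (fold T ps)"
  using assms
proof (induction ps)
  case Nil
  thus ?case using gauss_preserving_id by (simp add: id_def)
next
  case (Cons p ps)
  thus ?case using gauss_preserving_compose[of "fold T ps" "T p"] by (simp add: o_def)
qed

subsection \<open>A Loomis--Whitney inequality\<close>

lemma (in prob_space) integrable_bounded:
  fixes f :: "'a \<Rightarrow> real"
  assumes "f \<in> borel_measurable M" "\<And>x. x \<in> space M \<Longrightarrow> \<bar>f x\<bar> \<le> B"
  shows "integrable M f"
  by (rule integrable_const_bound[where B = B]) (use assms in auto)

lemma (in prob_space) abs_integral_le:
  fixes f :: "'a \<Rightarrow> real"
  assumes f: "f \<in> borel_measurable M" and B: "\<And>x. x \<in> space M \<Longrightarrow> \<bar>f x\<bar> \<le> B"
  shows "\<bar>\<integral>x. f x \<partial>M\<bar> \<le> B"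
proof -
  have "integrable M f" using assms by (rule integrable_bounded)
  moreover have "- B \<le> f x" "f x \<le> B" if "x \<in> space M" for x using B[OF that] by auto
  ultimately have "- B \<le> (\<integral>x. f x \<partial>M)" "(\<integral>x. f x \<partial>M) \<le> B"
    by (auto intro: integral_le_const integral_ge_const)
  thus ?thesis by (auto simp: abs_le_iff)
qed

lemma abs_weighted_sum_le:
  fixes f :: "'k \<Rightarrow> real" and p B :: real
  assumes "0 \<le> p" "\<And>k. k \<in> K \<Longrightarrow> \<bar>f k\<bar> \<le> B"
  shows "\<bar>p * (\<Sum>k\<in>K. f k)\<bar> \<le> p * (card K * B)"
proof -
  have "\<bar>\<Sum>k\<in>K. f k\<bar> \<le> card K * B"
    by (rule order_trans[OF sum_abs sum_bounded_above]) (rule assms(2))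
  thus ?thesis using assms(1) by (simp add: abs_mult mult_left_mono)
qed

text \<open>All test functions are bounded, which keeps the exponential integrals positive and
  finite. The bound on the logarithm has the same constant \<open>B\<close>, so that logarithms of
  partial integrals are again admissible test functions.\<close>

lemma (in prob_space) integral_exp_bounds:
  fixes f :: "'a \<Rightarrow> real"
  assumes [measurable]: "f \<in> borel_measurable M" and B: "\<And>x. x \<in> space M \<Longrightarrow> \<bar>f x\<bar> \<le> B"
  shows "integrable M (\<lambda>x. exp (f x))" "exp (- B) \<le> (\<integral>x. exp (f x) \<partial>M)" "(\<integral>x. exp (f x) \<partial>M) \<le> exp B"
    "0 < (\<integral>x. exp (f x) \<partial>M)" "\<bar>ln (\<integral>x. exp (f x) \<partial>M)\<bar> \<le> B"
proof -
  have b: "- B \<le> f x" "f x \<le> B" if "x \<in> space M" for x using B[OF that] by auto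
  show int: "integrable M (\<lambda>x. exp (f x))"
    by (rule integrable_bounded[of _ "exp B"]) (use b in auto)
  show l: "exp (- B) \<le> (\<integral>x. exp (f x) \<partial>M)"
    by (rule integral_ge_const[OF int]) (use b in auto)
  show u: "(\<integral>x. exp (f x) \<partial>M) \<le> exp B"
    by (rule integral_le_const[OF int]) (use b in auto)
  show pos: "0 < (\<integral>x. exp (f x) \<partial>M)"
    using l exp_gt_zero[of "- B"] by linarith
  have "ln (exp (- B)) \<le> ln (\<integral>x. exp (f x) \<partial>M)" "ln (\<integral>x. exp (f x) \<partial>M) \<le> ln (exp B)"
    using l u pos by (subst ln_le_cancel_iff; simp)+
  thus "\<bar>ln (\<integral>x. exp (f x) \<partial>M)\<bar> \<le> B" by auto
qed

text \<open>Subtracting \<open>L k\<close> from \<open>f k\<close> normalises each exponential to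
  integral 1. Convexity of \<open>exp\<close> then bounds the geometric mean of the normalised
  functions by their arithmetic mean, whose integral is 1.\<close>

lemma (in prob_space) Hoelder_exp:
  fixes f :: "'k \<Rightarrow> 'a \<Rightarrow> real"
  assumes K: "finite K" "K \<noteq> {}"
    and [measurable]: "\<And>k. k \<in> K \<Longrightarrow> f k \<in> borel_measurable M"
    and B: "\<And>k x. k \<in> K \<Longrightarrow> x \<in> space M \<Longrightarrow> \<bar>f k x\<bar> \<le> B"
    and p: "p = 1 / real (card K)"
  shows "(\<integral>x. exp (p * (\<Sum>k\<in>K. f k x)) \<partial>M) \<le> exp (p * (\<Sum>k\<in>K. ln (\<integral>x. exp (f k x) \<partial>M)))"
proof -
  have card: "card K > 0" using K by (simp add: card_gt_0_iff)
  have p0: "p > 0" using card by (simp add: p)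
  define L where "L k = ln (\<integral>x. exp (f k x) \<partial>M)" for k
  have pos: "0 < (\<integral>x. exp (f k x) \<partial>M)" and int: "integrable M (\<lambda>x. exp (f k x))" if "k \<in> K" for k
    using integral_exp_bounds[of "f k" B] that B by auto
  have pw: "exp (p * (\<Sum>k\<in>K. f k x) - p * (\<Sum>k\<in>K. L k)) \<le> (\<Sum>k\<in>K. p * exp (f k x - L k))" for x
  proof -
    have "p * (\<Sum>k\<in>K. f k x) - p * (\<Sum>k\<in>K. L k) = (\<Sum>k\<in>K. p *\<^sub>R (f k x - L k))"
      by (simp add: sum_subtractf sum_distrib_left right_diff_distrib)
    also have "exp \<dots> \<le> (\<Sum>k\<in>K. p * exp (f k x - L k))"
      by (rule convex_on_sum[OF K exp_convex]) (use p0 card p in auto)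
    finally show ?thesis .
  qed
  have int1: "integrable M (\<lambda>x. \<Sum>k\<in>K. p * exp (f k x - L k))"
    using int by (auto simp: exp_diff)
  have "(\<integral>x. exp (p * (\<Sum>k\<in>K. f k x)) \<partial>M) / exp (p * (\<Sum>k\<in>K. L k)) =
      (\<integral>x. exp (p * (\<Sum>k\<in>K. f k x) - p * (\<Sum>k\<in>K. L k)) \<partial>M)"
    by (simp add: exp_diff)
  also have "\<dots> \<le> (\<integral>x. (\<Sum>k\<in>K. p * exp (f k x - L k)) \<partial>M)"
  proof (rule integral_mono[OF _ int1 pw])
    show "integrable M (\<lambda>x. exp (p * (\<Sum>k\<in>K. f k x) - p * (\<Sum>k\<in>K. L k)))"
      by (rule Bochner_Integration.integrable_bound[OF int1]) (use pw in \<open>auto intro: order_trans[OF pw abs_ge_self]\<close>)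
  qed
  also have "\<dots> = (\<Sum>k\<in>K. p * ((\<integral>x. exp (f k x) \<partial>M) / exp (L k)))"
    using int by (subst Bochner_Integration.integral_sum) (auto simp: exp_diff)
  also have "\<dots> = (\<Sum>k\<in>K. p)"
  proof (rule sum.cong[OF refl])
    fix k assume "k \<in> K"
    with pos[OF this] show "p * ((\<integral>x. exp (f k x) \<partial>M) / exp (L k)) = p" by (simp add: L_def)
  qed
  also have "\<dots> = 1" using card by (simp add: p)
  finally show ?thesis by (simp add: L_def divide_le_eq)
qed

text \<open>The coordinates are integrated out one at a time, using Hoelder's inequality for the functions
  that depend on the coordinate.\<close>

lemma (in product_prob_space) Loomis_Whitney_exp:
  fixes f :: "'i \<Rightarrow> ('i \<Rightarrow> 'a) \<Rightarrow> real"
  assumes K: "finite K" "card K \<ge> 2" and J: "finite J" "J \<subseteq> K"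
    and "\<And>i. i \<in> K \<Longrightarrow> f i \<in> borel_measurable (PiM J M)"
    and "\<And>i x. i \<in> K \<Longrightarrow> x \<in> space (PiM J M) \<Longrightarrow> \<bar>f i x\<bar> \<le> B"
    and "\<And>i x y. i \<in> J \<Longrightarrow> x \<in> space (PiM J M) \<Longrightarrow> y \<in> space (M i) \<Longrightarrow> f i (x(i := y)) = f i x"
    and p: "p = 1 / real (card K - 1)"
  shows "(\<integral>x. exp (p * (\<Sum>i\<in>K. f i x)) \<partial>PiM J M) \<le> exp (p * (\<Sum>i\<in>K. ln (\<integral>x. exp (f i x) \<partial>PiM J M)))"
  \<comment> \<open>The induction removes coordinates from \<open>J\<close>, but no functions:
    \<open>K\<close> and the exponent \<open>p\<close> stay fixed, which is why \<open>J\<close> is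
    only a subset of \<open>K\<close> in the statement.\<close>
  using J assms(5-7)
proof (induction J arbitrary: f rule: finite_induct)
  case empty
  have "(\<integral>x. g x \<partial>PiM {} M) = g (\<lambda>_. undefined)" for g :: "_ \<Rightarrow> real"
    unfolding PiM_empty by (subst lebesgue_integral_count_space_finite) auto
  thus ?case by simp
next
  case (insert j J)
  interpret Jf: finite_product_prob_space M J by standard fact
  interpret iJ: finite_product_prob_space M "insert j J" by standard (use insert in simp)
  have jK: "j \<in> K" using insert.prems by simp
  note [measurable] = insert.prems(2)
  have fm: "(\<lambda>(x, y). f i (x(j := y))) \<in> borel_measurable (PiM J M \<Otimes>\<^sub>M M j)" if "i \<in> K" for i
    using measurable_compose[OF measurable_add_dim insert.prems(2)[OF that]] by (simp add: split_beta' del: fun_upd_apply)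
  have fm1: "(\<lambda>y. f i (x(j := y))) \<in> borel_measurable (M j)" if "i \<in> K" "x \<in> space (PiM J M)" for i x
    using measurable_compose[OF measurable_Pair1'[OF that(2)] fm[OF that(1)]] by simp
  \<comment> \<open>The logarithm of the marginal of \<open>exp (f i)\<close>. It obeys the bound
    \<open>B\<close> again and does not depend on more coordinates than \<open>f i\<close>, so the
    induction hypothesis applies to it.\<close>
  define g where "g i x = ln (\<integral>y. exp (f i (x(j := y))) \<partial>M j)" for i x
  have gm: "g i \<in> borel_measurable (PiM J M)" if "i \<in> K" for i
    unfolding g_def using fm[OF that]
    by (intro borel_measurable_ln M.borel_measurable_lebesgue_integral) (simp add: split_beta')
  have upd: "x(j := y) \<in> space (PiM (insert j J) M)" if "x \<in> space (PiM J M)" "y \<in> space (M j)" for x y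
    using that insert.hyps by (auto simp: space_PiM PiE_iff extensional_def)
  have bnd: "\<bar>f i (x(j := y))\<bar> \<le> B" if "i \<in> K" "x \<in> space (PiM J M)" "y \<in> space (M j)" for i x y
    using insert.prems(3)[OF that(1) upd[OF that(2,3)]] .
  have split_int: "(\<integral>x. exp (h x) \<partial>PiM (insert j J) M) = (\<integral>x. (\<integral>y. exp (h (x(j := y))) \<partial>M j) \<partial>PiM J M)"
    if h: "h \<in> borel_measurable (PiM (insert j J) M)" and b: "\<And>x. x \<in> space (PiM (insert j J) M) \<Longrightarrow> \<bar>h x\<bar> \<le> C" for h and C :: real
    by (rule product_integral_insert[OF insert.hyps(1,2) iJ.integral_exp_bounds(1)[where B = C]]) (use h b in auto)
  have gB: "\<bar>g i x\<bar> \<le> B" and gexp: "exp (g i x) = (\<integral>y. exp (f i (x(j := y))) \<partial>M j)"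
    if "i \<in> K" "x \<in> space (PiM J M)" for i x
    unfolding g_def using M.integral_exp_bounds(4,5)[where f = "\<lambda>y. f i (x(j := y))" and B = B, OF fm1[OF that]] bnd[OF that]
    by auto
  have p0: "0 \<le> p" by (simp add: p)
  have sumB: "\<bar>p * (\<Sum>i\<in>K. f i x)\<bar> \<le> p * (card K * B)" if "x \<in> space (PiM (insert j J) M)" for x
    using insert.prems(3)[OF _ that] by (rule abs_weighted_sum_le[OF p0])
  have step: "(\<integral>y. exp (p * (\<Sum>i\<in>K. f i (x(j := y)))) \<partial>M j) \<le> exp (p * (\<Sum>i\<in>K. g i x))"
    if x: "x \<in> space (PiM J M)" for x
  proof -
    obtain y0 where y0: "y0 \<in> space (M j)" using M.not_empty by blast
    define c where "c = f j (x(j := y0))"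
    have c: "f j (x(j := y)) = c" if "y \<in> space (M j)" for y
      using insert.prems(4)[of j "x(j := y0)" y] upd[OF x y0] that by (simp add: c_def del: fun_upd_apply)
    have gj: "g j x = c"
    proof -
      have "(\<integral>y. exp (f j (x(j := y))) \<partial>M j) = (\<integral>y. exp c \<partial>M j)"
        by (rule Bochner_Integration.integral_cong) (use c in auto)
      thus ?thesis by (simp add: g_def M.prob_space)
    qed
    \<comment> \<open>As \<open>f j\<close> does not see the coordinate \<open>j\<close>, it leaves
      the integral. The \<open>card K - 1\<close> functions that remain are just as many as
      Hoelder's inequality with weight \<open>p\<close> requires.\<close>
    have "(\<integral>y. exp (p * (\<Sum>i\<in>K. f i (x(j := y)))) \<partial>M j) =
        (\<integral>y. exp (p * c) * exp (p * (\<Sum>i\<in>K - {j}. f i (x(j := y)))) \<partial>M j)"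
      by (rule Bochner_Integration.integral_cong)
        (use K jK c in \<open>auto simp: sum.remove[of K j] distrib_left exp_add\<close>)
    also have "\<dots> = exp (p * c) * (\<integral>y. exp (p * (\<Sum>i\<in>K - {j}. f i (x(j := y)))) \<partial>M j)"
      by simp
    also have "\<dots> \<le> exp (p * c) * exp (p * (\<Sum>i\<in>K - {j}. g i x))"
      unfolding g_def
    proof (intro mult_left_mono M.Hoelder_exp)
      show "K - {j} \<noteq> {}" "p = 1 / real (card (K - {j}))"
        using K jK card_gt_0_iff[of "K - {j}"] by (auto simp: p card_Diff_singleton)
    qed (use K x fm1 bnd in auto)
    also have "\<dots> = exp (p * (\<Sum>i\<in>K. g i x))"
      using K jK by (simp add: sum.remove[of K j] gj distrib_left exp_add)
    finally show ?thesis .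
  qed
  have pm: "(\<lambda>x. p * (\<Sum>i\<in>K. f i x)) \<in> borel_measurable (PiM (insert j J) M)" by measurable
  have gsumB: "\<bar>p * (\<Sum>i\<in>K. g i x)\<bar> \<le> p * (card K * B)" if "x \<in> space (PiM J M)" for x
    using gB[OF _ that] by (rule abs_weighted_sum_le[OF p0])
  have gpm: "(\<lambda>x. p * (\<Sum>i\<in>K. g i x)) \<in> borel_measurable (PiM J M)" using gm by measurable
  have "(\<integral>x. exp (p * (\<Sum>i\<in>K. f i x)) \<partial>PiM (insert j J) M) =
      (\<integral>x. (\<integral>y. exp (p * (\<Sum>i\<in>K. f i (x(j := y)))) \<partial>M j) \<partial>PiM J M)"
    by (rule split_int[OF pm]) (rule sumB)
  also have "\<dots> \<le> (\<integral>x. exp (p * (\<Sum>i\<in>K. g i x)) \<partial>PiM J M)"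
  proof (rule integral_mono)
    show "integrable (PiM J M) (\<lambda>x. exp (p * (\<Sum>i\<in>K. g i x)))"
      by (rule Jf.integral_exp_bounds(1)[OF gpm]) (rule gsumB)
    have "(\<lambda>(x, y). exp (p * (\<Sum>i\<in>K. f i (x(j := y))))) \<in> borel_measurable (PiM J M \<Otimes>\<^sub>M M j)"
      using measurable_compose[OF measurable_add_dim pm] by (simp add: split_beta' del: fun_upd_apply)
    hence "(\<lambda>x. \<integral>y. exp (p * (\<Sum>i\<in>K. f i (x(j := y)))) \<partial>M j) \<in> borel_measurable (PiM J M)"
      by (rule M.borel_measurable_lebesgue_integral)
    thus "integrable (PiM J M) (\<lambda>x. \<integral>y. exp (p * (\<Sum>i\<in>K. f i (x(j := y)))) \<partial>M j)"
    proof (rule Jf.integrable_bounded)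
      fix x assume x: "x \<in> space (PiM J M)"
      have "\<bar>\<integral>y. exp (p * (\<Sum>i\<in>K. f i (x(j := y)))) \<partial>M j\<bar> = (\<integral>y. exp (p * (\<Sum>i\<in>K. f i (x(j := y)))) \<partial>M j)"
        by (intro abs_of_nonneg integral_nonneg_AE) auto
      also have "\<dots> \<le> exp (p * (card K * B))"
        using step[OF x] gsumB[OF x] by (smt (verit) exp_le_cancel_iff)
      finally show "\<bar>\<integral>y. exp (p * (\<Sum>i\<in>K. f i (x(j := y)))) \<partial>M j\<bar> \<le> exp (p * (card K * B))" .
    qed
  qed (rule step)
  also have "\<dots> \<le> exp (p * (\<Sum>i\<in>K. ln (\<integral>x. exp (g i x) \<partial>PiM J M)))"
  proof (rule insert.IH)
    fix i x y assume i: "i \<in> J" "x \<in> space (PiM J M)" "y \<in> space (M i)"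
    hence ij: "i \<noteq> j" using insert.hyps by auto
    show "g i (x(i := y)) = g i x"
      unfolding g_def
    proof (intro arg_cong[where f = ln] Bochner_Integration.integral_cong refl arg_cong[where f = exp])
      fix z assume "z \<in> space (M j)"
      thus "f i (x(i := y, j := z)) = f i (x(j := z))"
        using insert.prems(4)[of i "x(j := z)" y] i upd[OF i(2)] ij by (simp add: fun_upd_twist del: fun_upd_apply)
    qed
  qed (use insert.prems gm gB in auto)
  also have "(\<Sum>i\<in>K. ln (\<integral>x. exp (g i x) \<partial>PiM J M)) = (\<Sum>i\<in>K. ln (\<integral>x. exp (f i x) \<partial>PiM (insert j J) M))"
  proof (intro sum.cong refl arg_cong[where f = ln])
    fix i assume i: "i \<in> K"
    have "(\<integral>x. exp (f i x) \<partial>PiM (insert j J) M) = (\<integral>x. (\<integral>y. exp (f i (x(j := y))) \<partial>M j) \<partial>PiM J M)"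
      by (rule split_int[OF insert.prems(2)[OF i]]) (rule insert.prems(3)[OF i])
    also have "\<dots> = (\<integral>x. exp (g i x) \<partial>PiM J M)"
      by (rule Bochner_Integration.integral_cong) (use gexp[OF i] in auto)
    finally show "(\<integral>x. exp (g i x) \<partial>PiM J M) = (\<integral>x. exp (f i x) \<partial>PiM (insert j J) M)" ..
  qed
  finally show ?case .
qed

section \<open>Normalised sums of independent Gaussian vectors\<close>

lemma emeasure_std_gauss_UNIV [simp]: "emeasure std_gauss UNIV = 1"
  using std_gauss.emeasure_space_1 by simp

lemma nn_integral_std_gauss_lincomb:
  fixes f :: "'a::euclidean_space \<Rightarrow> ennreal"
  assumes [measurable]: "f \<in> borel_measurable borel" and cs: "c\<^sup>2 + s\<^sup>2 = 1"
  shows "(\<integral>\<^sup>+x. \<integral>\<^sup>+y. f (c *\<^sub>R x + s *\<^sub>R y) \<partial>std_gauss \<partial>std_gauss) = (\<integral>\<^sup>+x. f x \<partial>std_gauss)"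
  using nn_integral_std_gauss_rotate[of "\<lambda>p. f (fst p)" c "- s"] cs by simp

lemma nn_integral_std_gauss_uminus:
  fixes f :: "'a::euclidean_space \<Rightarrow> ennreal"
  assumes [measurable]: "f \<in> borel_measurable borel"
  shows "(\<integral>\<^sup>+x. f (- x) \<partial>std_gauss) = (\<integral>\<^sup>+x. f x \<partial>std_gauss)"
  using nn_integral_std_gauss_lincomb[of f "-1" 0] by simp

lemma nn_integral_std_gauss_sum:
  fixes f :: "'a::euclidean_space \<Rightarrow> ennreal"
  assumes J: "finite J" "J \<noteq> {}" and f: "f \<in> borel_measurable borel"
  shows "(\<integral>\<^sup>+x. f ((1 / sqrt (card J)) *\<^sub>R (\<Sum>j\<in>J. x j)) \<partial>PiM J (\<lambda>_. std_gauss)) = (\<integral>\<^sup>+x. f x \<partial>std_gauss)"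
  using J f
proof (induction J arbitrary: f rule: finite_ne_induct)
  case (singleton j)
  note [measurable] = singleton
  show ?case
    using std_gauss_PiM.product_nn_integral_singleton[of f j] by simp
next
  case (insert j J)
  note [measurable] = insert.prems
  define k where "k = real (card J)"
  have k: "k > 0" using insert.hyps by (simp add: k_def card_gt_0_iff)
  define c where "c = sqrt k / sqrt (k + 1)"
  define s where "s = 1 / sqrt (k + 1)"
  have cs: "c\<^sup>2 + s\<^sup>2 = 1"
    using k by (simp add: c_def s_def power_divide add_divide_distrib[symmetric])
  have eq: "(1 / sqrt (card (insert j J))) *\<^sub>R (\<Sum>i\<in>insert j J. (x(j := y)) i) =
      c *\<^sub>R ((1 / sqrt (card J)) *\<^sub>R (\<Sum>i\<in>J. x i)) + s *\<^sub>R y" for x and y :: 'a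
  proof -
    have "(\<Sum>i\<in>J. (x(j := y)) i) = (\<Sum>i\<in>J. x i)"
      by (rule sum.cong) (use insert.hyps in auto)
    moreover have "sqrt (real (card (insert j J))) = sqrt (k + 1)"
      using insert.hyps by (simp add: k_def add.commute)
    ultimately show ?thesis
      using insert.hyps k by (simp add: c_def s_def k_def[symmetric] scaleR_add_right add.commute)
  qed
  have "(\<integral>\<^sup>+x. f ((1 / sqrt (card (insert j J))) *\<^sub>R (\<Sum>j\<in>insert j J. x j)) \<partial>PiM (insert j J) (\<lambda>_. std_gauss)) =
      (\<integral>\<^sup>+x. \<integral>\<^sup>+y. f (c *\<^sub>R ((1 / sqrt (card J)) *\<^sub>R (\<Sum>i\<in>J. x i)) + s *\<^sub>R y) \<partial>std_gauss \<partial>PiM J (\<lambda>_. std_gauss))"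
    unfolding eq[symmetric] by (rule std_gauss_PiM.product_nn_integral_insert) (use insert.hyps in auto)
  also have "\<dots> = (\<integral>\<^sup>+x. \<integral>\<^sup>+y. f (c *\<^sub>R x + s *\<^sub>R y) \<partial>std_gauss \<partial>std_gauss)"
    by (rule insert.IH[of "\<lambda>u. \<integral>\<^sup>+y. f (c *\<^sub>R u + s *\<^sub>R y) \<partial>std_gauss"]) measurable
  also have "\<dots> = (\<integral>\<^sup>+x. f x \<partial>std_gauss)"
    by (rule nn_integral_std_gauss_lincomb) (use cs in auto)
  finally show ?case .
qed

text \<open>The joint law of the normalised sum without the index \<open>i\<close> and of the full
  normalised sum, disintegrated along the latter: given the full sum \<open>x\<close>, the shorter
  sum is Gaussian with mean \<open>sqrt ((n - 1) / n) *\<^sub>R x\<close> and variance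
  \<open>1 / n\<close>. The right-hand side does not depend on \<open>i\<close>.\<close>

lemma nn_integral_std_gauss_sum_pair:
  fixes F :: "'a::euclidean_space \<times> 'a \<Rightarrow> ennreal"
  assumes I: "finite I" "i \<in> I" "card I \<ge> 2"
    and F [measurable]: "F \<in> borel_measurable (borel \<Otimes>\<^sub>M borel)"
  defines "n \<equiv> real (card I)"
  shows "(\<integral>\<^sup>+x. F ((1 / sqrt (n - 1)) *\<^sub>R (\<Sum>j\<in>I - {i}. x j), (1 / sqrt n) *\<^sub>R (\<Sum>j\<in>I. x j)) \<partial>PiM I (\<lambda>_. std_gauss)) =
    (\<integral>\<^sup>+x. \<integral>\<^sup>+z. F (sqrt ((n - 1) / n) *\<^sub>R x + sqrt (1 / n) *\<^sub>R z, x) \<partial>std_gauss \<partial>std_gauss)"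
proof -
  have n: "n \<ge> 2" using I by (simp add: n_def)
  define c where "c = sqrt ((n - 1) / n)"
  define s where "s = sqrt (1 / n)"
  have cs: "c * c + s * s = 1"
    using n by (simp add: c_def s_def add_divide_distrib[symmetric])
  have ins: "I = insert i (I - {i})" using I by auto
  have cardJ: "real (card (I - {i})) = n - 1" using I by (simp add: n_def of_nat_diff)
  have "I - {i} \<noteq> {}"
  proof
    assume "I - {i} = {}"
    hence "real (card (I - {i})) = 0" by (simp only: card.empty of_nat_0)
    with cardJ n show False by simp
  qed
  with I have J: "finite (I - {i})" "I - {i} \<noteq> {}" by auto
  define U where "U x = (1 / sqrt (n - 1)) *\<^sub>R (\<Sum>j\<in>I - {i}. x j)" for x :: "_ \<Rightarrow> 'a"
  have U: "U (x(i := y)) = U x" for x y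
    unfolding U_def by (intro arg_cong2[where f = scaleR] sum.cong) auto
  have S: "(1 / sqrt n) *\<^sub>R (\<Sum>j\<in>I. (x(i := y)) j) = c *\<^sub>R U x + s *\<^sub>R y" for x y
  proof -
    have "(\<Sum>j\<in>I. (x(i := y)) j) = y + (\<Sum>j\<in>I - {i}. (x(i := y)) j)"
      using I by (subst sum.remove[of I i]) auto
    also have "(\<Sum>j\<in>I - {i}. (x(i := y)) j) = (\<Sum>j\<in>I - {i}. x j)"
      by (rule sum.cong) auto
    finally show ?thesis
      using n by (simp add: U_def c_def s_def real_sqrt_divide scaleR_add_right)
  qed
  have [measurable]: "U \<in> borel_measurable (PiM (I - {i}) (\<lambda>_. std_gauss))"
    "U \<in> borel_measurable (PiM I (\<lambda>_. std_gauss))"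
    unfolding U_def by measurable
  have "(\<integral>\<^sup>+x. F (U x, (1 / sqrt n) *\<^sub>R (\<Sum>j\<in>I. x j)) \<partial>PiM I (\<lambda>_. std_gauss)) =
      (\<integral>\<^sup>+x. \<integral>\<^sup>+y. F (U (x(i := y)), (1 / sqrt n) *\<^sub>R (\<Sum>j\<in>I. (x(i := y)) j)) \<partial>std_gauss \<partial>PiM (I - {i}) (\<lambda>_. std_gauss))"
    by (subst ins, rule std_gauss_PiM.product_nn_integral_insert)
      (use I in \<open>auto simp: ins[symmetric] insert_absorb\<close>)
  also have "\<dots> = (\<integral>\<^sup>+x. \<integral>\<^sup>+y. F (U x, c *\<^sub>R U x + s *\<^sub>R y) \<partial>std_gauss \<partial>PiM (I - {i}) (\<lambda>_. std_gauss))"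
    unfolding U S ..
  also have "\<dots> = (\<integral>\<^sup>+u. \<integral>\<^sup>+y. F (u, c *\<^sub>R u + s *\<^sub>R y) \<partial>std_gauss \<partial>std_gauss)"
    using nn_integral_std_gauss_sum[OF J, of "\<lambda>u. \<integral>\<^sup>+y. F (u, c *\<^sub>R u + s *\<^sub>R y) \<partial>std_gauss"]
    unfolding cardJ U_def by simp
  \<comment> \<open>Rotating the pair of independent vectors turns the full sum into the first
    variable, as \<open>c * c + s * s = 1\<close>.\<close>
  also have "\<dots> = (\<integral>\<^sup>+x. \<integral>\<^sup>+y. F (c *\<^sub>R x - s *\<^sub>R y, c *\<^sub>R (c *\<^sub>R x - s *\<^sub>R y) + s *\<^sub>R (s *\<^sub>R x + c *\<^sub>R y)) \<partial>std_gauss \<partial>std_gauss)"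
    using nn_integral_std_gauss_rotate[of "\<lambda>(u, y). F (u, c *\<^sub>R u + s *\<^sub>R y)" c s] cs
    by (simp add: power2_eq_square)
  also have "\<dots> = (\<integral>\<^sup>+x. \<integral>\<^sup>+y. F (c *\<^sub>R x + s *\<^sub>R (- y), x) \<partial>std_gauss \<partial>std_gauss)"
  proof -
    have "c *\<^sub>R (c *\<^sub>R x - s *\<^sub>R y) + s *\<^sub>R (s *\<^sub>R x + c *\<^sub>R y) = (c * c + s * s) *\<^sub>R x" for x y :: 'a
      by (simp add: algebra_simps)
    thus ?thesis by (simp add: cs)
  qed
  also have "\<dots> = (\<integral>\<^sup>+x. \<integral>\<^sup>+y. F (c *\<^sub>R x + s *\<^sub>R y, x) \<partial>std_gauss \<partial>std_gauss)"
    by (intro nn_integral_cong nn_integral_std_gauss_uminus) measurable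
  finally show ?thesis by (simp only: U_def c_def s_def)
qed

text \<open>The version for nonnegative functions identifies two laws on the product space, and
  hence also the integrals of bounded functions of arbitrary sign.\<close>

lemma integral_std_gauss_sum_pair:
  fixes F :: "'a::euclidean_space \<times> 'a \<Rightarrow> real"
  assumes I: "finite I" "i \<in> I" "card I \<ge> 2"
    and F [measurable]: "F \<in> borel_measurable (borel \<Otimes>\<^sub>M borel)" and B: "\<And>p. \<bar>F p\<bar> \<le> B"
  defines "n \<equiv> real (card I)"
  shows "(\<integral>x. F ((1 / sqrt (n - 1)) *\<^sub>R (\<Sum>j\<in>I - {i}. x j), (1 / sqrt n) *\<^sub>R (\<Sum>j\<in>I. x j)) \<partial>PiM I (\<lambda>_. std_gauss)) =
    (\<integral>x. \<integral>z. F (sqrt ((n - 1) / n) *\<^sub>R x + sqrt (1 / n) *\<^sub>R z, x) \<partial>std_gauss \<partial>std_gauss)"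
proof -
  let ?A = "\<lambda>x. ((1 / sqrt (n - 1)) *\<^sub>R (\<Sum>j\<in>I - {i}. x j), (1 / sqrt n) *\<^sub>R (\<Sum>j\<in>I. x j)) :: 'a \<times> 'a"
  let ?B = "\<lambda>(x, z). (sqrt ((n - 1) / n) *\<^sub>R x + sqrt (1 / n) *\<^sub>R z, x) :: 'a \<times> 'a"
  have A [measurable]: "?A \<in> PiM I (\<lambda>_. std_gauss) \<rightarrow>\<^sub>M borel \<Otimes>\<^sub>M borel" by measurable
  have Bm [measurable]: "?B \<in> std_gauss \<Otimes>\<^sub>M std_gauss \<rightarrow>\<^sub>M borel \<Otimes>\<^sub>M borel" by measurable
  have nn: "(\<integral>\<^sup>+x. G x \<partial>distr (PiM I (\<lambda>_. std_gauss)) (borel \<Otimes>\<^sub>M borel) ?A) =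
     (\<integral>\<^sup>+x. G x \<partial>distr (std_gauss \<Otimes>\<^sub>M std_gauss) (borel \<Otimes>\<^sub>M borel) ?B)"
    if [measurable]: "G \<in> borel_measurable (borel \<Otimes>\<^sub>M borel)" for G
    using nn_integral_std_gauss_sum_pair[OF I, of G]
    by (simp add: nn_integral_distr n_def split_beta' std_gauss.nn_integral_fst[symmetric])
  have eq: "distr (PiM I (\<lambda>_. std_gauss)) (borel \<Otimes>\<^sub>M borel) ?A = distr (std_gauss \<Otimes>\<^sub>M std_gauss) (borel \<Otimes>\<^sub>M borel) ?B"
  proof (rule measure_eqI)
    fix X assume "X \<in> sets (distr (PiM I (\<lambda>_. std_gauss)) (borel \<Otimes>\<^sub>M borel) ?A)"
    thus "emeasure (distr (PiM I (\<lambda>_. std_gauss)) (borel \<Otimes>\<^sub>M borel) ?A) X =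
        emeasure (distr (std_gauss \<Otimes>\<^sub>M std_gauss) (borel \<Otimes>\<^sub>M borel) ?B) X"
      using nn[of "indicator X"] by simp
  qed simp
  have "(\<integral>x. F (?A x) \<partial>PiM I (\<lambda>_. std_gauss)) = (\<integral>x. F x \<partial>distr (PiM I (\<lambda>_. std_gauss)) (borel \<Otimes>\<^sub>M borel) ?A)"
    by (rule integral_distr[symmetric]) measurable
  also have "\<dots> = (\<integral>p. F (?B p) \<partial>(std_gauss \<Otimes>\<^sub>M std_gauss))"
    unfolding eq by (rule integral_distr) measurable
  also have "\<dots> = (\<integral>x. \<integral>z. F (?B (x, z)) \<partial>std_gauss \<partial>std_gauss)"
    by (rule std_gauss_pair.integral_fst'[symmetric], rule std_gauss_pair.P.integrable_bounded[where B = B])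
      (use B in \<open>auto simp: split_beta'\<close>)
  finally show ?thesis by simp
qed

subsection \<open>Contraction of relative entropy along the heat flow\<close>

lemma measure_std_gauss_UNIV [simp]: "measure std_gauss UNIV = 1"
  using std_gauss.prob_space by simp

text \<open>Jensen's inequality for the conditional expectation given the normalised sum \<open>S\<close> is replaced
  by the tangent of \<open>exp\<close> at \<open>q * P (S x)\<close>, for which the orthogonality \<open>orth\<close> suffices.\<close>

lemma std_gauss_exp_contraction:
  fixes \<phi> :: "'a::euclidean_space \<Rightarrow> real"
  assumes [measurable]: "\<phi> \<in> borel_measurable borel" and B: "\<And>x. \<bar>\<phi> x\<bar> \<le> B" and m: "m \<ge> 2"
  defines "P \<equiv> \<lambda>x. \<integral>z. \<phi> (sqrt ((real m - 1) / real m) *\<^sub>R x + sqrt (1 / real m) *\<^sub>R z) \<partial>std_gauss"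
  shows "(\<integral>x. exp (real m / (real m - 1) * P x) \<partial>std_gauss) \<le>
    exp (real m / (real m - 1) * ln (\<integral>x. exp (\<phi> x) \<partial>std_gauss))"
proof -
  define I where "I = {..<m}"
  define n where "n = real m"
  define c where "c = sqrt ((n - 1) / n)"
  define s where "s = sqrt (1 / n)"
  \<comment> \<open>\<open>p\<close> is the Loomis-Whitney exponent for \<open>n\<close> functions
    of which each misses one of \<open>n\<close> coordinates. Summing \<open>n\<close> equal
    logarithms with this weight gives the power \<open>q = n * p\<close>.\<close>
  define p where "p = 1 / (n - 1)"
  define q where "q = n / (n - 1)"
  let ?M = "PiM I (\<lambda>_. std_gauss :: 'a measure)"
  define U where "U i x = (1 / sqrt (n - 1)) *\<^sub>R (\<Sum>j\<in>I - {i}. x j)" for i and x :: "nat \<Rightarrow> 'a"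
  define S where "S x = (1 / sqrt n) *\<^sub>R (\<Sum>j\<in>I. x j)" for x :: "nat \<Rightarrow> 'a"
  have PI: "prob_space ?M"
    by (intro prob_space_PiM prob_space_std_gauss)
  have I: "finite I" "card I = m" "real (card I) = n" "card I \<ge> 2" "I \<noteq> {}"
    using m by (auto simp: I_def n_def lessThan_empty_iff)
  have n: "n \<ge> 2" using m by (simp add: n_def)
  have cs: "c\<^sup>2 + s\<^sup>2 = 1"
    using n by (simp add: c_def s_def add_divide_distrib[symmetric])
  have np: "n * p = q" and q0: "q > 0" and p0: "p > 0" using n by (auto simp: p_def q_def)
  have P: "P x = (\<integral>z. \<phi> (c *\<^sub>R x + s *\<^sub>R z) \<partial>std_gauss)" for x
    by (simp add: P_def c_def s_def n_def)
  have [measurable]: "P \<in> borel_measurable borel"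
    unfolding P by measurable
  have b: "- B \<le> \<phi> x" "\<phi> x \<le> B" for x using B[of x] by auto
  have B0: "B \<ge> 0" using b[of 0] by linarith
  have PB: "\<bar>P x\<bar> \<le> B" for x
    unfolding P by (rule std_gauss.abs_integral_le) (use B in auto)
  have [measurable]: "U i \<in> borel_measurable ?M" "S \<in> borel_measurable ?M" for i
    unfolding U_def S_def by measurable
  have pair: "(\<integral>x. F (U i x, S x) \<partial>?M) = (\<integral>x. \<integral>z. F (c *\<^sub>R x + s *\<^sub>R z, x) \<partial>std_gauss \<partial>std_gauss)"
    if "i \<in> I" "F \<in> borel_measurable (borel \<Otimes>\<^sub>M borel)" "\<And>p. \<bar>F p\<bar> \<le> D" for i and F :: "'a \<times> 'a \<Rightarrow> real" and D
    using integral_std_gauss_sum_pair[OF I(1) that(1) I(4) that(2,3)]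
    unfolding I(3) U_def S_def c_def s_def .
  \<comment> \<open>The slope of the tangent. It is evaluated at \<open>S\<close> alone and is
    therefore a legitimate weight for \<open>orth\<close>.\<close>
  define w where "w x = exp (q * P x)" for x
  have [measurable]: "w \<in> borel_measurable borel" unfolding w_def by measurable
  have wB: "0 \<le> w x" "w x \<le> exp (q * B)" for x
    using PB[of x] q0 by (auto simp: w_def abs_le_iff)
  have wfB: "\<bar>w x * r\<bar> \<le> exp (q * B) * B" if "\<bar>r\<bar> \<le> B" for x r
    unfolding abs_mult using wB[of x] that B0 by (intro mult_mono) auto
  have orth: "(\<integral>x. w (S x) * \<phi> (U i x) \<partial>?M) = (\<integral>x. w (S x) * P (S x) \<partial>?M)" if i: "i \<in> I" for i
  proof -
    have "(\<integral>x. w (S x) * \<phi> (U i x) \<partial>?M) = (\<integral>x. \<integral>z. w x * \<phi> (c *\<^sub>R x + s *\<^sub>R z) \<partial>std_gauss \<partial>std_gauss)"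
      using pair[OF i, of "\<lambda>p. w (snd p) * \<phi> (fst p)" "exp (q * B) * B"] wfB[OF B] by simp
    also have "\<dots> = (\<integral>x. w x * P x \<partial>std_gauss)"
      by (simp add: P)
    also have "\<dots> = (\<integral>x. w (S x) * P (S x) \<partial>?M)"
      using pair[OF i, of "\<lambda>p. w (snd p) * P (snd p)" "exp (q * B) * B"] wfB[OF PB] by simp
    finally show ?thesis .
  qed
  \<comment> \<open>All \<open>n\<close> summands have the projection \<open>P (S x)\<close> onto
    functions of \<open>S\<close>. Since \<open>n * p = q\<close>, the functions \<open>u\<close>
    and \<open>q * P (S x)\<close> have the same integral against the weight
    \<open>w (S x)\<close>.\<close>
  define u where "u x = p * (\<Sum>i\<in>I. \<phi> (U i x))" for x
  have [measurable]: "u \<in> borel_measurable ?M" unfolding u_def by measurable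
  have int1: "integrable ?M (\<lambda>x. w (S x) * \<phi> (U i x))" "integrable ?M (\<lambda>x. w (S x) * P (S x))" for i
    by (rule prob_space.integrable_bounded[OF PI, where B = "exp (q * B) * B"]; use wfB[OF B] wfB[OF PB] in simp)+
  have intw: "integrable ?M (\<lambda>x. w (S x))"
    by (rule prob_space.integrable_bounded[OF PI, where B = "exp (q * B)"]) (use wB in auto)
  have uB: "\<bar>u x\<bar> \<le> p * (n * B)" for x
    unfolding u_def I(3)[symmetric] using p0 B by (intro abs_weighted_sum_le) auto
  have "(\<integral>x. w x \<partial>std_gauss) = (\<integral>x. w (S x) \<partial>?M)"
  proof -
    obtain i where "i \<in> I" using I by blast
    from pair[OF this, of "\<lambda>p. w (snd p)" "exp (q * B)"] wB show ?thesis
      by simp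
  qed
  \<comment> \<open>The added term has integral zero by \<open>orth\<close>; with it the integrand
    is the tangent of \<open>exp\<close>, evaluated at \<open>u x\<close>.\<close>
  also have "\<dots> = (\<integral>x. w (S x) + w (S x) * (u x - q * P (S x)) \<partial>?M)"
  proof -
    have "(\<integral>x. w (S x) * (u x - q * P (S x)) \<partial>?M) =
        (\<integral>x. p * (\<Sum>i\<in>I. w (S x) * \<phi> (U i x)) - q * (w (S x) * P (S x)) \<partial>?M)"
      by (rule Bochner_Integration.integral_cong) (simp_all add: u_def algebra_simps sum_distrib_left)
    also have "\<dots> = p * (\<Sum>i\<in>I. (\<integral>x. w (S x) * \<phi> (U i x) \<partial>?M)) - q * (\<integral>x. w (S x) * P (S x) \<partial>?M)"
      using int1 by (simp add: Bochner_Integration.integral_sum)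
    also have "\<dots> = 0" by (simp add: orth I(3) np[symmetric])
    finally have "(\<integral>x. w (S x) * (u x - q * P (S x)) \<partial>?M) = 0" .
    moreover have "integrable ?M (\<lambda>x. w (S x) * (u x - q * P (S x)))"
    proof -
      have "integrable ?M (\<lambda>x. p * (\<Sum>i\<in>I. w (S x) * \<phi> (U i x)) - q * (w (S x) * P (S x)))"
        using int1 by simp
      thus ?thesis
        by (rule Bochner_Integration.integrable_cong[THEN iffD1, rotated 2])
          (simp_all add: u_def algebra_simps sum_distrib_left)
    qed
    ultimately show ?thesis using intw by simp
  qed
  also have "\<dots> \<le> (\<integral>x. exp (u x) \<partial>?M)"
  proof (rule integral_mono_AE)
    have "integrable ?M (\<lambda>x. w (S x) * u x - q * (w (S x) * P (S x)))"
    proof (rule Bochner_Integration.integrable_diff)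
      have "\<bar>w (S x) * u x\<bar> \<le> exp (q * B) * (p * (n * B))" for x
        unfolding abs_mult using wB[of "S x"] uB[of x] p0 n B0 by (intro mult_mono) auto
      thus "integrable ?M (\<lambda>x. w (S x) * u x)"
        by (intro prob_space.integrable_bounded[OF PI]) auto
    qed (use int1 in simp)
    from Bochner_Integration.integrable_add[OF intw this]
    show "integrable ?M (\<lambda>x. w (S x) + w (S x) * (u x - q * P (S x)))"
      by (simp add: algebra_simps)
    show "integrable ?M (\<lambda>x. exp (u x))"
      by (rule prob_space.integral_exp_bounds(1)[OF PI _ uB]) measurable
    have "w (S x) + w (S x) * (u x - q * P (S x)) \<le> exp (u x)" for x
    proof -
      have "w (S x) * (1 + (u x - q * P (S x))) \<le> w (S x) * exp (u x - q * P (S x))"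
        by (intro mult_left_mono exp_ge_add_one_self wB)
      thus ?thesis by (simp add: w_def exp_diff algebra_simps)
    qed
    thus "AE x in ?M. w (S x) + w (S x) * (u x - q * P (S x)) \<le> exp (u x)" by simp
  qed
  \<comment> \<open>The sum \<open>U i\<close> omits the summand \<open>i\<close>, which is the
    independence of one coordinate that the inequality asks for.\<close>
  also have "\<dots> \<le> exp (p * (\<Sum>i\<in>I. ln (\<integral>x. exp (\<phi> (U i x)) \<partial>?M)))"
    unfolding u_def
  proof (rule std_gauss_PiM.Loomis_Whitney_exp)
    fix i x y assume "i \<in> I"
    show "\<phi> (U i (x(i := y))) = \<phi> (U i x)"
      unfolding U_def by (intro arg_cong[where f = \<phi>] arg_cong2[where f = scaleR] sum.cong) auto
  next
    show "p = 1 / real (card I - 1)"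
      using I n by (simp add: p_def of_nat_diff n_def)
  qed (use I B in auto)
  \<comment> \<open>Each \<open>U i\<close> is again a standard Gaussian vector.\<close>
  also have "(\<Sum>i\<in>I. ln (\<integral>x. exp (\<phi> (U i x)) \<partial>?M)) = (\<Sum>i\<in>I. ln (\<integral>x. exp (\<phi> x) \<partial>std_gauss))"
  proof (intro sum.cong refl arg_cong[where f = ln])
    fix i assume i: "i \<in> I"
    have "(\<integral>\<^sup>+x. ennreal (exp (\<phi> (U i x))) \<partial>?M) = (\<integral>\<^sup>+x. ennreal (exp (\<phi> x)) \<partial>std_gauss)"
      using nn_integral_std_gauss_sum_pair[OF I(1) i I(4), of "\<lambda>p. ennreal (exp (\<phi> (fst p)))"]
        nn_integral_std_gauss_lincomb[OF _ cs, of "\<lambda>x. ennreal (exp (\<phi> x))"]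
      by (simp add: I(3) U_def c_def s_def)
    thus "(\<integral>x. exp (\<phi> (U i x)) \<partial>?M) = (\<integral>x. exp (\<phi> x) \<partial>std_gauss)"
      by (simp add: integral_eq_nn_integral)
  qed
  finally show ?thesis
    by (simp add: w_def I(3) np[symmetric] q_def n_def p_def)
qed

section \<open>Entropy bounds in dual form\<close>

definition gauss :: "real \<Rightarrow> 'a::euclidean_space measure" where
  "gauss \<sigma> = distr std_gauss borel (\<lambda>x. \<sigma> *\<^sub>R x)"

text \<open>By the Donsker--Varadhan formula this says that the relative entropy of \<open>\<mu>\<close> with respect
  to \<open>g\<close> is at most \<open>C\<close>.\<close>

definition entropy_bound :: "'a::topological_space measure \<Rightarrow> 'a measure \<Rightarrow> real \<Rightarrow> bool" where
  "entropy_bound \<mu> g C \<longleftrightarrow> (\<forall>\<phi>\<in>borel_measurable borel. \<forall>B. (\<forall>x. \<bar>\<phi> x\<bar> \<le> B) \<longrightarrow>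
     (\<integral>x. \<phi> x \<partial>\<mu>) \<le> C + ln (\<integral>x. exp (\<phi> x) \<partial>g))"

lemma entropy_boundD:
  "entropy_bound \<mu> g C \<Longrightarrow> \<phi> \<in> borel_measurable borel \<Longrightarrow> (\<And>x. \<bar>\<phi> x\<bar> \<le> B) \<Longrightarrow>
    (\<integral>x. \<phi> x \<partial>\<mu>) \<le> C + ln (\<integral>x. exp (\<phi> x) \<partial>g)"
  unfolding entropy_bound_def by blast

lemma integral_gauss:
  fixes f :: "'a::euclidean_space \<Rightarrow> real"
  assumes "f \<in> borel_measurable borel"
  shows "(\<integral>x. f x \<partial>gauss \<sigma>) = (\<integral>x. f (\<sigma> *\<^sub>R x) \<partial>std_gauss)"
  unfolding gauss_def by (rule integral_distr) (use assms in auto)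

text \<open>Integrating \<phi> against the new law means integrating \<open>Q (\<Psi> y)\<close>
  against \<mu>, where \<open>Q\<close> averages \<phi> over the noise. The hypothesis is used with
  this function multiplied by \<open>q = m / (m - 1)\<close>. On the Gaussian side \<Psi> disappears
  by invariance and the exponential contraction returns a power with exponent \<open>q\<close>;
  division by \<open>q\<close> then shrinks \<open>C\<close> and leaves the logarithm with factor 1.
  The variances of the old reference measure and of the noise add up to
  \<open>\<sigma>\<^sup>2\<close>.\<close>

lemma entropy_bound_step:
  fixes \<mu> :: "'a::euclidean_space measure"
  assumes \<mu>: "prob_space \<mu>" and sets: "sets \<mu> = sets borel" and m: "m \<ge> 2"
    and bound: "entropy_bound \<mu> (gauss (\<sigma> * sqrt ((real m - 1) / real m))) C"
    and \<Psi>: "gauss_preserving \<Psi>"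
  shows "entropy_bound (distr (\<mu> \<Otimes>\<^sub>M std_gauss) borel (\<lambda>(y, z). \<Psi> y + (\<sigma> * sqrt (1 / real m)) *\<^sub>R z))
    (gauss \<sigma>) ((real m - 1) / real m * C)"
  unfolding entropy_bound_def
proof (intro ballI allI impI)
  fix \<phi> :: "'a \<Rightarrow> real" and B assume [measurable]: "\<phi> \<in> borel_measurable borel" and "\<forall>x. \<bar>\<phi> x\<bar> \<le> B"
  hence B: "\<bar>\<phi> x\<bar> \<le> B" for x by blast
  note [measurable] = gauss_preserving_measurable[OF \<Psi>]
  note [measurable_cong] = sets
  interpret \<mu>: prob_space \<mu> by fact
  interpret P: pair_prob_space \<mu> std_gauss ..
  define c where "c = sqrt ((real m - 1) / real m)"
  define s where "s = sqrt (1 / real m)"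
  define q where "q = real m / (real m - 1)"
  have q: "q > 0" using m by (simp add: q_def)
  define Q where "Q y = (\<integral>z. \<phi> (y + (\<sigma> * s) *\<^sub>R z) \<partial>std_gauss)" for y
  have [measurable]: "Q \<in> borel_measurable borel" unfolding Q_def by measurable
  have b: "- B \<le> \<phi> x" "\<phi> x \<le> B" for x using B[of x] by auto
  have QB: "\<bar>Q y\<bar> \<le> B" for y
    unfolding Q_def by (rule std_gauss.abs_integral_le) (use B in auto)
  have qQB: "\<bar>q * Q y\<bar> \<le> q * B" for y
    using QB[of y] q by (simp add: abs_mult)
  have "(\<integral>x. \<phi> x \<partial>distr (\<mu> \<Otimes>\<^sub>M std_gauss) borel (\<lambda>(y, z). \<Psi> y + (\<sigma> * s) *\<^sub>R z)) =
      (\<integral>p. (case p of (y, z) \<Rightarrow> \<phi> (\<Psi> y + (\<sigma> * s) *\<^sub>R z)) \<partial>(\<mu> \<Otimes>\<^sub>M std_gauss))"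
    by (subst integral_distr) (auto simp: split_beta')
  also have "\<dots> = (\<integral>y. Q (\<Psi> y) \<partial>\<mu>)"
    unfolding Q_def
    by (rule P.integral_fst[symmetric], rule P.P.integrable_bounded[where B = B]) (use B in \<open>auto simp: split_beta'\<close>)
  finally have 1: "(\<integral>x. \<phi> x \<partial>distr (\<mu> \<Otimes>\<^sub>M std_gauss) borel (\<lambda>(y, z). \<Psi> y + (\<sigma> * s) *\<^sub>R z)) = (\<integral>y. Q (\<Psi> y) \<partial>\<mu>)" .
  have "q * (\<integral>y. Q (\<Psi> y) \<partial>\<mu>) = (\<integral>y. q * Q (\<Psi> y) \<partial>\<mu>)" by simp
  also have "\<dots> \<le> C + ln (\<integral>x. exp (q * Q (\<Psi> x)) \<partial>gauss (\<sigma> * c))"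
    using entropy_boundD[OF bound, of "\<lambda>y. q * Q (\<Psi> y)" "q * B"] qQB by (simp add: c_def)
  also have "(\<integral>x. exp (q * Q (\<Psi> x)) \<partial>gauss (\<sigma> * c)) = (\<integral>x. exp (q * Q (\<Psi> ((\<sigma> * c) *\<^sub>R x))) \<partial>std_gauss)"
    by (rule integral_gauss) measurable
  also have "\<dots> = (\<integral>x. exp (q * Q ((\<sigma> * c) *\<^sub>R x)) \<partial>std_gauss)"
    using gauss_preservingD[OF \<Psi>, of "\<lambda>y. ennreal (exp (q * Q y))" "\<sigma> * c"]
    by (simp add: integral_eq_nn_integral)
  also have "C + ln \<dots> \<le> C + q * ln (\<integral>x. exp (\<phi> (\<sigma> *\<^sub>R x)) \<partial>std_gauss)"
  proof -
    have "Q ((\<sigma> * c) *\<^sub>R x) = (\<integral>z. \<phi> (\<sigma> *\<^sub>R (c *\<^sub>R x + s *\<^sub>R z)) \<partial>std_gauss)" for x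
      by (simp add: Q_def scaleR_add_right)
    hence "(\<integral>x. exp (q * Q ((\<sigma> * c) *\<^sub>R x)) \<partial>std_gauss) \<le> exp (q * ln (\<integral>x. exp (\<phi> (\<sigma> *\<^sub>R x)) \<partial>std_gauss))"
      using std_gauss_exp_contraction[of "\<lambda>x. \<phi> (\<sigma> *\<^sub>R x)" B m] B m by (simp add: q_def c_def s_def)
    moreover have "0 < (\<integral>x. exp (q * Q ((\<sigma> * c) *\<^sub>R x)) \<partial>std_gauss)"
      by (rule std_gauss.integral_exp_bounds(4)[OF _ qQB]) measurable
    ultimately have "ln (\<integral>x. exp (q * Q ((\<sigma> * c) *\<^sub>R x)) \<partial>std_gauss) \<le> q * ln (\<integral>x. exp (\<phi> (\<sigma> *\<^sub>R x)) \<partial>std_gauss)"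
      using ln_le_cancel_iff[of _ "exp (q * ln (\<integral>x. exp (\<phi> (\<sigma> *\<^sub>R x)) \<partial>std_gauss))"] by simp
    thus ?thesis by simp
  qed
  also have "(\<integral>x. exp (\<phi> (\<sigma> *\<^sub>R x)) \<partial>std_gauss) = (\<integral>x. exp (\<phi> x) \<partial>gauss \<sigma>)"
    by (rule integral_gauss[symmetric]) measurable
  finally have "(\<integral>y. Q (\<Psi> y) \<partial>\<mu>) \<le> (C + q * ln (\<integral>x. exp (\<phi> x) \<partial>gauss \<sigma>)) / q"
    using q by (simp add: pos_le_divide_eq mult.commute)
  also have "\<dots> = (real m - 1) / real m * C + ln (\<integral>x. exp (\<phi> x) \<partial>gauss \<sigma>)"
    using m by (simp add: q_def field_simps)
  finally show "(\<integral>x. \<phi> x \<partial>distr (\<mu> \<Otimes>\<^sub>M std_gauss) borel (\<lambda>(y, z). \<Psi> y + (\<sigma> * sqrt (1 / real m)) *\<^sub>R z)) \<le>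
      (real m - 1) / real m * C + ln (\<integral>x. exp (\<phi> x) \<partial>gauss \<sigma>)"
    unfolding 1[unfolded s_def] .
qed

subsection \<open>Relative entropy with respect to Gaussians\<close>

lemma gauss_eq_density:
  assumes "\<sigma> > 0"
  shows "(gauss \<sigma> :: 'a::euclidean_space measure) =
    density lborel (\<lambda>z. ennreal (exp (- (norm z)\<^sup>2 / (2 * \<sigma>\<^sup>2)) / (sqrt (2 * pi) * \<sigma>) ^ DIM('a)))"
proof (rule measure_eqI)
  let ?d = "\<lambda>x :: 'a. exp (- (norm x)\<^sup>2 / 2) / sqrt (2 * pi) ^ DIM('a)"
  let ?e = "\<lambda>z :: 'a. exp (- (norm z)\<^sup>2 / (2 * \<sigma>\<^sup>2)) / (sqrt (2 * pi) * \<sigma>) ^ DIM('a)"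
  fix A :: "'a set" assume "A \<in> sets (gauss \<sigma>)"
  hence A [measurable]: "A \<in> sets borel" by (simp add: gauss_def)
  have "emeasure (gauss \<sigma>) A = (\<integral>\<^sup>+x. indicator A x \<partial>gauss \<sigma>)"
    by (simp add: gauss_def)
  also have "\<dots> = (\<integral>\<^sup>+x. indicator A (\<sigma> *\<^sub>R x) \<partial>std_gauss)"
    unfolding gauss_def by (rule nn_integral_distr) auto
  also have "\<dots> = (\<integral>\<^sup>+x. ennreal (?d x) * indicator A (\<sigma> *\<^sub>R x) \<partial>lborel)"
    unfolding std_gauss_def by (rule nn_integral_density) auto
  also have "\<dots> = (\<integral>\<^sup>+x. ennreal (\<bar>\<sigma>\<bar> ^ DIM('a)) * (ennreal (?e (0 + \<sigma> *\<^sub>R x)) * indicator A (0 + \<sigma> *\<^sub>R x)) \<partial>lborel)"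
  proof (rule nn_integral_cong)
    fix x :: 'a
    have "?d x = \<bar>\<sigma>\<bar> ^ DIM('a) * ?e (0 + \<sigma> *\<^sub>R x)"
      using assms by (simp add: power_mult_distrib)
    thus "ennreal (?d x) * indicator A (\<sigma> *\<^sub>R x) =
        ennreal (\<bar>\<sigma>\<bar> ^ DIM('a)) * (ennreal (?e (0 + \<sigma> *\<^sub>R x)) * indicator A (0 + \<sigma> *\<^sub>R x))"
      using assms by (simp add: ennreal_mult[symmetric] mult.assoc[symmetric])
  qed
  also have "\<dots> = (\<integral>\<^sup>+z. ennreal (?e z) * indicator A z \<partial>lborel)"
    by (subst (2) lborel_affine[of \<sigma> 0])
      (use assms in \<open>simp_all add: nn_integral_density nn_integral_distr\<close>)
  also have "\<dots> = emeasure (density lborel (\<lambda>z. ennreal (?e z))) A"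
    by (rule emeasure_density[symmetric]) auto
  finally show "emeasure (gauss \<sigma>) A = emeasure (density lborel (\<lambda>z. ennreal (?e z))) A" .
qed (simp add: gauss_def)

text \<open>The reference density at time \<open>s\<close> is the centred Gaussian with variance
  \<open>2 * \<nu> * (1 + s)\<close> in each real coordinate, that is, the heat flow started from
  \<open>p_infty \<nu>\<close>.\<close>

lemma p_infty_density:
  fixes z :: "real^2^'n::finite"
  assumes \<nu>: "\<nu> > 0" and s: "s \<ge> 0"
  defines "\<sigma> \<equiv> sqrt (2 * \<nu> * (1 + s))"
  shows "exp (- (norm z)\<^sup>2 / (2 * \<sigma>\<^sup>2)) / (sqrt (2 * pi) * \<sigma>) ^ DIM(real^2^'n) =
    (1 + s) powi (- int CARD('n)) * p_infty \<nu> (z /\<^sub>R sqrt (1 + s))"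
proof -
  have \<sigma>2: "\<sigma>\<^sup>2 = 2 * \<nu> * (1 + s)" using \<nu> s by (simp add: \<sigma>_def)
  \<comment> \<open>The dimension is twice the number of particles, so the square roots in the
    normalising constant disappear.\<close>
  have "(sqrt (2 * pi) * \<sigma>) ^ DIM(real^2^'n) = ((sqrt (2 * pi) * \<sigma>)\<^sup>2) ^ CARD('n)"
    by (simp add: power_mult[symmetric] mult.commute)
  also have "(sqrt (2 * pi) * \<sigma>)\<^sup>2 = (1 + s) * (4 * pi * \<nu>)"
    by (simp add: power_mult_distrib \<sigma>2)
  finally have 1: "(sqrt (2 * pi) * \<sigma>) ^ DIM(real^2^'n) = (1 + s) ^ CARD('n) * (4 * pi * \<nu>) ^ CARD('n)"
    by (simp only: power_mult_distrib)
  have n: "(norm z)\<^sup>2 = (\<Sum>i\<in>UNIV. (norm (z $ i))\<^sup>2)"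
    by (simp add: power2_norm_eq_inner inner_vec_def)
  have "(\<Sum>i\<in>UNIV. (norm ((z /\<^sub>R sqrt (1 + s)) $ i))\<^sup>2) = (norm z)\<^sup>2 / (1 + s)"
    using s by (simp add: n power_mult_distrib power_inverse divide_inverse mult.commute sum_distrib_left)
  hence 2: "- (1 / (4 * \<nu>)) * (\<Sum>i\<in>UNIV. (norm ((z /\<^sub>R sqrt (1 + s)) $ i))\<^sup>2) = - (norm z)\<^sup>2 / (2 * \<sigma>\<^sup>2)"
    by (simp add: \<sigma>2)
  show ?thesis
  proof -
    have pw: "(1 + s) powi (- int CARD('n)) = inverse ((1 + s) ^ CARD('n))"
      by (simp add: power_int_minus)
    show ?thesis
      unfolding p_infty_def 1 2 pw by (simp only: divide_inverse inverse_mult_distrib mult_ac mult_1_left)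
  qed
qed

lemma gauss_eq_density_p_infty:
  assumes "\<nu> > 0" "s \<ge> 0"
  shows "(gauss (sqrt (2 * \<nu> * (1 + s))) :: (real^2^'n::finite) measure) =
    density lborel (\<lambda>z. ennreal ((1 + s) powi (- int CARD('n)) * p_infty \<nu> (z /\<^sub>R sqrt (1 + s))))"
  using gauss_eq_density[of "sqrt (2 * \<nu> * (1 + s))", where 'a = "real^2^'n"] p_infty_density[OF assms, where 'n = 'n] assms
  by simp

abbreviation with_density :: "('a::euclidean_space \<Rightarrow> real) \<Rightarrow> 'a measure" where
  "with_density p \<equiv> density lborel (\<lambda>z. ennreal (p z))"

lemma prob_space_gauss: "prob_space (gauss \<sigma>)"
  unfolding gauss_def by (rule std_gauss.prob_space_distr) auto

lemma integral_probability_density: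
  fixes p :: "'a::euclidean_space \<Rightarrow> real"
  assumes "p \<in> borel_measurable borel" "\<And>z. 0 \<le> p z" "prob_space (with_density p)"
  shows "integrable lborel p" "(\<integral>z. p z \<partial>lborel) = 1"
proof -
  interpret prob_space "with_density p" by fact
  have "(\<integral>\<^sup>+z. ennreal (p z) \<partial>lborel) = 1"
    using emeasure_space_1 assms(1) by (simp add: emeasure_density)
  thus "integrable lborel p" "(\<integral>z. p z \<partial>lborel) = 1"
    using assms by (auto intro!: integrableI_nonneg simp: integral_eq_nn_integral)
qed

text \<open>One half of the Donsker-Varadhan formula. It comes from \<open>ln y \<le> y - 1\<close>
  at \<open>y = q x * exp (\<phi> x) / (Z * p x)\<close>, multiplied by \<open>p x\<close>; the
  right-hand side integrates to zero because \<open>Z\<close> normalises the tilted density.\<close>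

lemma entropy_bound_relative_entropy:
  fixes p q :: "'a::euclidean_space \<Rightarrow> real"
  assumes p [measurable]: "p \<in> borel_measurable borel" and p0: "\<And>z. 0 \<le> p z"
    and p1: "prob_space (with_density p)"
    and q [measurable]: "q \<in> borel_measurable borel" and q0: "\<And>z. 0 < q z"
    and q1: "prob_space (with_density q)"
    and fin: "finite_relative_entropy p q"
  shows "entropy_bound (with_density p) (with_density q) (relative_entropy p q)"
  unfolding entropy_bound_def
proof (intro ballI allI impI)
  fix \<phi> :: "'a \<Rightarrow> real" and B assume [measurable]: "\<phi> \<in> borel_measurable borel" and B: "\<forall>x. \<bar>\<phi> x\<bar> \<le> B"
  note ip = integral_probability_density[OF p p0 p1]
  define Z where "Z = (\<integral>x. exp (\<phi> x) \<partial>with_density q)"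
  have Z0: "Z > 0" and intZ: "integrable (with_density q) (\<lambda>x. exp (\<phi> x))"
    unfolding Z_def using prob_space.integral_exp_bounds(1,4)[OF q1, of \<phi> B] B by auto
  have Z: "Z = (\<integral>x. q x * exp (\<phi> x) \<partial>lborel)" "integrable lborel (\<lambda>x. q x * exp (\<phi> x))"
    using intZ less_imp_le[OF q0] by (auto simp: Z_def integral_real_density integrable_real_density)
  have pw: "p x * \<phi> x - p x * ln (p x / q x) - ln Z * p x \<le> q x * exp (\<phi> x) / Z - p x" for x
  proof (cases "p x = 0")
    case True
    thus ?thesis using q0[of x] Z0 by simp
  next
    case False
    hence px: "p x > 0" using p0[of x] by simp
    have "\<phi> x - ln (p x / q x) - ln Z = ln (q x * exp (\<phi> x) / (Z * p x))"
      using px q0[of x] Z0 by (simp add: ln_div ln_mult)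
    also have "\<dots> \<le> q x * exp (\<phi> x) / (Z * p x) - 1"
      using px q0[of x] Z0 by (intro ln_le_minus_one) simp
    finally have "p x * (\<phi> x - ln (p x / q x) - ln Z) \<le> p x * (q x * exp (\<phi> x) / (Z * p x) - 1)"
      using px by (intro mult_left_mono) auto
    also have "\<dots> = q x * exp (\<phi> x) / Z - p x" using px by (simp add: right_diff_distrib)
    finally show ?thesis by (simp add: algebra_simps)
  qed
  have i1: "integrable lborel (\<lambda>x. p x * \<phi> x)"
    by (rule Bochner_Integration.integrable_bound[of _ "\<lambda>x. B * p x"])
      (use ip B p0 in \<open>auto simp: abs_mult mult.commute[of B] intro!: mult_left_mono AE_I2 order_trans[OF _ abs_ge_self]\<close>)
  have i2: "integrable lborel (\<lambda>x. p x * ln (p x / q x))"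
    using fin by (simp add: finite_relative_entropy_def)
  have "(\<integral>x. p x * \<phi> x \<partial>lborel) - relative_entropy p q - ln Z * 1 =
      (\<integral>x. p x * \<phi> x - p x * ln (p x / q x) - ln Z * p x \<partial>lborel)"
    using i1 i2 ip by (simp add: relative_entropy_def)
  also have "\<dots> \<le> (\<integral>x. q x * exp (\<phi> x) / Z - p x \<partial>lborel)"
    using i1 i2 ip Z by (intro integral_mono pw) auto
  also have "\<dots> = 0" using Z Z0 ip by simp
  finally show "(\<integral>x. \<phi> x \<partial>with_density p) \<le>
      relative_entropy p q + ln (\<integral>x. exp (\<phi> x) \<partial>with_density q)"
    using p0 by (simp add: integral_real_density Z_def)
qed

text \<open>Pathwise convergence of the scheme only controls continuous test functions. A measurable
  function is a limit of continuous ones outside a Lebesgue null set, and such a set is null for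
  both measures since they have densities.\<close>

lemma entropy_bound_of_continuous:
  fixes p q :: "'a::euclidean_space \<Rightarrow> real"
  assumes [measurable]: "p \<in> borel_measurable borel" and p1: "prob_space (with_density p)"
    and [measurable]: "q \<in> borel_measurable borel" and q1: "prob_space (with_density q)"
    and bound: "\<And>\<phi> B. continuous_on UNIV \<phi> \<Longrightarrow> (\<And>x. \<bar>\<phi> x\<bar> \<le> B) \<Longrightarrow>
      (\<integral>x. \<phi> x \<partial>with_density p) \<le> C + ln (\<integral>x. exp (\<phi> x) \<partial>with_density q)"
  shows "entropy_bound (with_density p) (with_density q) C"
  unfolding entropy_bound_def
proof (intro ballI allI impI)
  let ?P = "with_density p" and ?Q = "with_density q"
  fix \<phi> :: "'a \<Rightarrow> real" and B assume \<phi> [measurable]: "\<phi> \<in> borel_measurable borel" and B: "\<forall>x. \<bar>\<phi> x\<bar> \<le> B"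
  interpret P: prob_space ?P by fact
  interpret Q: prob_space ?Q by fact
  have b: "- B \<le> \<phi> x" "\<phi> x \<le> B" for x using B[rule_format, of x] by auto
  have B0: "B \<ge> 0" using b[of 0] by linarith
  have "\<phi> measurable_on UNIV"
    by (rule lebesgue_measurable_imp_measurable_on_real) (auto intro: measurable_completion)
  then obtain N g where N: "negligible N" and g: "\<And>n. continuous_on UNIV (g n)"
    and lim: "\<And>x. x \<notin> N \<Longrightarrow> (\<lambda>n. g n x) \<longlonglongrightarrow> \<phi> x"
    unfolding measurable_on_def by auto
  \<comment> \<open>Truncation at \<open>B\<close> keeps the approximations continuous and
    dominated, and does not affect the limit.\<close>
  define h where "h n x = max (- B) (min B (g n x))" for n :: nat and x
  have hc: "continuous_on UNIV (h n)" for n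
    unfolding h_def by (intro continuous_intros g)
  have [measurable]: "h n \<in> borel_measurable borel" for n
    using hc by (rule borel_measurable_continuous_onI)
  have hB: "\<bar>h n x\<bar> \<le> B" for n x
    using B0 by (auto simp: h_def)
  have hlim: "(\<lambda>n. h n x) \<longlonglongrightarrow> \<phi> x" if "x \<notin> N" for x
  proof -
    have "(\<lambda>n. h n x) \<longlonglongrightarrow> max (- B) (min B (\<phi> x))"
      unfolding h_def by (intro tendsto_intros lim that)
    thus ?thesis using b[of x] by (simp add: min_absorb2 max_absorb2)
  qed
  have "AE x in lebesgue. x \<notin> N"
    using N by (intro AE_not_in) (simp add: negligible_iff_null_sets)
  hence "AE x in lborel. x \<notin> N"
    by (rule AE_completion_iff[THEN iffD1])
  hence ae: "AE x in lborel. (\<lambda>n. h n x) \<longlonglongrightarrow> \<phi> x"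
    using hlim by auto
  hence aeP: "AE x in ?P. (\<lambda>n. h n x) \<longlonglongrightarrow> \<phi> x" and aeQ: "AE x in ?Q. (\<lambda>n. h n x) \<longlonglongrightarrow> \<phi> x"
    by (auto simp: AE_density elim: eventually_mono)
  have 1: "(\<lambda>n. \<integral>x. h n x \<partial>?P) \<longlonglongrightarrow> (\<integral>x. \<phi> x \<partial>?P)"
    by (rule integral_dominated_convergence[where w = "\<lambda>_. B"]) (use hB aeP in auto)
  have 2: "(\<lambda>n. \<integral>x. exp (h n x) \<partial>?Q) \<longlonglongrightarrow> (\<integral>x. exp (\<phi> x) \<partial>?Q)"
  proof (rule integral_dominated_convergence[where w = "\<lambda>_. exp B"])
    show "AE x in ?Q. (\<lambda>n. exp (h n x)) \<longlonglongrightarrow> exp (\<phi> x)"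
      using aeQ by (auto intro: tendsto_exp elim: eventually_mono)
    show "AE x in ?Q. norm (exp (h n x)) \<le> exp B" for n
      using hB[of n] by (auto simp: abs_le_iff)
  qed auto
  have pos: "(\<integral>x. exp (\<phi> x) \<partial>?Q) > 0"
    by (rule Q.integral_exp_bounds(4)[of \<phi> B]) (use B in auto)
  have "(\<lambda>n. C + ln (\<integral>x. exp (h n x) \<partial>?Q)) \<longlonglongrightarrow> C + ln (\<integral>x. exp (\<phi> x) \<partial>?Q)"
    using pos by (intro tendsto_intros 2) auto
  thus "(\<integral>x. \<phi> x \<partial>?P) \<le> C + ln (\<integral>x. exp (\<phi> x) \<partial>?Q)"
    by (rule LIMSEQ_le[OF 1]) (use bound[OF hc hB] in auto)
qed

text \<open>The other half of the Donsker-Varadhan formula: the optimal test function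
  \<open>ln (p / q)\<close> is truncated at level \<open>n\<close>. Its exponential has integral at
  most \<open>1 + exp (- n)\<close> under \<open>q\<close>, so the logarithmic term vanishes in the
  limit, and Fatou's lemma removes the truncation.\<close>

lemma relative_entropy_le_of_entropy_bound:
  fixes p q :: "'a::euclidean_space \<Rightarrow> real"
  assumes p [measurable]: "p \<in> borel_measurable borel" and p0: "\<And>z. 0 \<le> p z"
    and p1: "prob_space (with_density p)"
    and q [measurable]: "q \<in> borel_measurable borel" and q0: "\<And>z. 0 < q z"
    and q1: "prob_space (with_density q)"
    and bound: "entropy_bound (with_density p) (with_density q) C"
  shows "finite_relative_entropy p q" "relative_entropy p q \<le> C"
proof -
  note ip = integral_probability_density[OF p p0 p1] and iq = integral_probability_density[OF q less_imp_le[OF q0] q1]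
  define L where "L x = ln (p x / q x)" for x
  \<comment> \<open>The case \<open>p x = 0\<close> is separate because \<open>ln 0\<close> is 0 in
    the logic, while the true value is minus infinity. With 0 instead of \<open>- n\<close> the set
    where \<open>p\<close> vanishes would contribute its full mass under \<open>q\<close> to the
    exponential integral.\<close>
  define \<phi> where "\<phi> n x = (if p x = 0 then - real n else max (- real n) (min (real n) (L x)))" for n x
  have [measurable]: "L \<in> borel_measurable borel" "\<phi> n \<in> borel_measurable borel" for n
    unfolding L_def \<phi>_def by measurable
  have \<phi>B: "\<bar>\<phi> n x\<bar> \<le> real n" for n x
    by (auto simp: \<phi>_def)
  have intp: "integrable lborel (\<lambda>x. p x * \<phi> n x)" for n
    by (rule Bochner_Integration.integrable_bound[of _ "\<lambda>x. n * p x"])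
      (use ip \<phi>B p0 in \<open>auto simp: abs_mult mult.commute[of "real n"] intro!: mult_left_mono AE_I2 order_trans[OF _ abs_ge_self]\<close>)
  have le: "(\<integral>x. p x * \<phi> n x \<partial>lborel) \<le> C + exp (- real n)" for n
  proof -
    have pw: "q x * exp (\<phi> n x) \<le> p x + exp (- real n) * q x" for x
    proof (cases "p x = 0")
      case True
      thus ?thesis by (simp add: \<phi>_def)
    next
      case False
      hence px: "p x > 0" using p0[of x] by simp
      show ?thesis
      proof (cases "L x \<le> - real n")
        case True
        hence "\<phi> n x = - real n" using False by (simp add: \<phi>_def)
        thus ?thesis using px by simp
      next
        case nle: False
        hence "\<phi> n x \<le> L x" using False by (auto simp: \<phi>_def)
        hence "exp (\<phi> n x) \<le> exp (L x)" by simp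
        also have "exp (L x) = p x / q x" using px q0[of x] by (simp add: L_def)
        finally have "q x * exp (\<phi> n x) \<le> p x" using q0[of x] by (simp add: pos_le_divide_eq mult.commute)
        moreover have "0 \<le> exp (- real n) * q x" using q0[of x] by simp
        ultimately show ?thesis by linarith
      qed
    qed
    have "integrable (with_density q) (\<lambda>x. exp (\<phi> n x))"
      "0 < (\<integral>x. exp (\<phi> n x) \<partial>with_density q)"
      using prob_space.integral_exp_bounds(1,4)[OF q1, of "\<phi> n" n] \<phi>B by auto
    hence Z: "integrable lborel (\<lambda>x. q x * exp (\<phi> n x))" "0 < (\<integral>x. q x * exp (\<phi> n x) \<partial>lborel)"
      using less_imp_le[OF q0] by (auto simp: integral_real_density integrable_real_density)
    have "(\<integral>x. q x * exp (\<phi> n x) \<partial>lborel) \<le> (\<integral>x. p x + exp (- real n) * q x \<partial>lborel)"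
      using Z ip iq by (intro integral_mono pw) auto
    also have "\<dots> = 1 + exp (- real n)" using ip iq by simp
    finally have "ln (\<integral>x. q x * exp (\<phi> n x) \<partial>lborel) \<le> exp (- real n)"
      using ln_le_minus_one[OF Z(2)] by linarith
    moreover have "(\<integral>x. p x * \<phi> n x \<partial>lborel) \<le> C + ln (\<integral>x. q x * exp (\<phi> n x) \<partial>lborel)"
      using entropy_boundD[OF bound, of "\<phi> n" n] \<phi>B p0 less_imp_le[OF q0]
      by (simp add: integral_real_density)
    ultimately show ?thesis by simp
  qed
  \<comment> \<open>The integrands have no fixed sign, but
    \<open>p x * ln (p x / q x) \<ge> p x - q x\<close>. Adding \<open>q x\<close> makes them
    nonnegative and adds 1 to the integrals.\<close>
  define F where "F n x = p x * \<phi> n x + q x" for n x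
  have [measurable]: "F n \<in> borel_measurable borel" for n unfolding F_def by measurable
  have Lge: "p x * L x \<ge> - q x" for x
  proof (cases "p x = 0")
    case False
    hence px: "p x > 0" using p0[of x] by simp
    have "- L x = ln (q x / p x)" using px q0[of x] by (simp add: L_def ln_div)
    also have "\<dots> \<le> q x / p x - 1" using px q0[of x] by (intro ln_le_minus_one) simp
    finally have "p x * (- L x) \<le> p x * (q x / p x - 1)" using px by (intro mult_left_mono) auto
    also have "\<dots> \<le> q x" using px by (simp add: field_simps)
    finally show ?thesis by simp
  qed (use q0[of x] in simp)
  have LF0: "0 \<le> p x * L x + q x" for x using Lge[of x] by linarith
  have F0: "F n x \<ge> 0" for n x
  proof (cases "p x = 0 \<or> \<phi> n x \<ge> 0")
    case True
    thus ?thesis using p0[of x] q0[of x] by (auto simp: F_def)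
  next
    case False
    hence "\<phi> n x \<ge> L x" by (auto simp: \<phi>_def)
    hence "p x * \<phi> n x \<ge> p x * L x" using p0 by (intro mult_left_mono)
    with Lge[of x] show ?thesis by (simp add: F_def)
  qed
  have lim: "(\<lambda>n. F n x) \<longlonglongrightarrow> p x * L x + q x" for x
  proof (cases "p x = 0")
    case False
    obtain N where N: "real N \<ge> \<bar>L x\<bar>" using real_arch_simple by blast
    have "\<forall>\<^sub>F n in sequentially. F n x = p x * L x + q x"
      using eventually_ge_at_top[of N]
    proof eventually_elim
      case (elim n)
      hence "real n \<ge> \<bar>L x\<bar>" using N by (meson of_nat_mono order_trans)
      thus ?case using False by (auto simp: F_def \<phi>_def)
    qed
    thus ?thesis by (rule tendsto_eventually)
  qed (simp add: F_def)
  have int: "(\<integral>x. F n x \<partial>lborel) \<le> C + exp (- real n) + 1" "integrable lborel (F n)" for n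
    using le[of n] intp[of n] iq by (simp_all add: F_def[abs_def])
  have Fatou: "(\<integral>\<^sup>+x. ennreal (p x * L x + q x) \<partial>lborel) \<le> ennreal (C + 1)"
  proof -
    have "(\<integral>\<^sup>+x. ennreal (p x * L x + q x) \<partial>lborel) = (\<integral>\<^sup>+x. liminf (\<lambda>n. ennreal (F n x)) \<partial>lborel)"
      using lim by (intro nn_integral_cong lim_imp_Liminf[symmetric] tendsto_ennrealI) auto
    also have "\<dots> \<le> liminf (\<lambda>n. \<integral>\<^sup>+x. ennreal (F n x) \<partial>lborel)"
      by (rule nn_integral_liminf) measurable
    also have "\<dots> \<le> liminf (\<lambda>n. ennreal (C + exp (- real n) + 1))"
      using int F0 by (intro Liminf_mono) (auto simp: nn_integral_eq_integral ennreal_leI)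
    also have "\<dots> = ennreal (C + 0 + 1)"
    proof (intro lim_imp_Liminf tendsto_ennrealI tendsto_intros)
      show "(\<lambda>n. exp (- real n)) \<longlonglongrightarrow> 0" by real_asymp
    qed auto
    finally show ?thesis by simp
  qed
  have FI: "integrable lborel (\<lambda>x. p x * L x + q x)"
  proof (rule integrableI_nonneg)
    show "(\<integral>\<^sup>+x. ennreal (p x * L x + q x) \<partial>lborel) < \<infinity>"
      using Fatou by (rule le_less_trans) simp
  qed (use LF0 in auto)
  from Bochner_Integration.integrable_diff[OF FI iq(1)] show "finite_relative_entropy p q"
    by (simp add: finite_relative_entropy_def L_def)
  \<comment> \<open>\<open>ennreal\<close> maps negative numbers to 0, so the inequality between
    extended reals can only be read back once this sign is known.\<close>
  have C0: "0 \<le> C + 1"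
  proof (rule LIMSEQ_le_const)
    show "(\<lambda>n. C + exp (- real n) + 1) \<longlonglongrightarrow> C + 1" by real_asymp
    have "0 \<le> C + exp (- real n) + 1" for n
    proof -
      have "0 \<le> (\<integral>x. F n x \<partial>lborel)" by (rule Bochner_Integration.integral_nonneg) (rule F0)
      with int(1)[of n] show ?thesis by linarith
    qed
    thus "\<exists>N. \<forall>n\<ge>N. 0 \<le> C + exp (- real n) + 1" by blast
  qed
  have "(\<integral>x. p x * L x + q x \<partial>lborel) \<le> C + 1"
  proof -
    have "ennreal (\<integral>x. p x * L x + q x \<partial>lborel) \<le> ennreal (C + 1)"
      using Fatou FI LF0 by (subst nn_integral_eq_integral[symmetric]) auto
    thus ?thesis using C0 by (simp add: ennreal_le_iff)
  qed
  moreover have "(\<integral>x. p x * L x + q x \<partial>lborel) = (\<integral>x. p x * L x \<partial>lborel) + 1"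
    using Bochner_Integration.integrable_diff[OF FI iq(1)] iq by simp
  ultimately show "relative_entropy p q \<le> C"
    by (simp add: relative_entropy_def L_def)
qed

subsection \<open>Convergence of the splitting scheme\<close>

text \<open>A composition of maps that agree with Euler steps up to order \<open>h\<^sup>2\<close>
  agrees with the Euler step of the summed field to the same order. The fields of the later maps are
  evaluated at a point displaced by at most \<open>(D + \<kappa>) * h\<close>; by the Lipschitz
  bound, and after the factor \<open>h\<close> in front, this again costs order
  \<open>h\<^sup>2\<close>.\<close>

lemma fold_consistent:
  fixes T :: "real \<Rightarrow> 'p \<Rightarrow> 'e::real_normed_vector \<Rightarrow> 'e" and b :: "'p \<Rightarrow> 'e \<Rightarrow> 'e"
  assumes T: "\<And>h p x. 0 \<le> h \<Longrightarrow> h \<le> 1 \<Longrightarrow> p \<in> set ps \<Longrightarrow> norm (T h p x - x - h *\<^sub>R b p x) \<le> \<kappa> * h\<^sup>2"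
    and D: "\<And>p x. p \<in> set ps \<Longrightarrow> norm (b p x) \<le> D"
    and L: "\<And>p x y. p \<in> set ps \<Longrightarrow> norm (b p x - b p y) \<le> L * norm (x - y)"
    and pos: "0 \<le> \<kappa>" "0 \<le> L" "0 \<le> D"
  shows "\<exists>\<kappa>'\<ge>0. \<forall>h x. 0 \<le> h \<longrightarrow> h \<le> 1 \<longrightarrow> norm (fold (T h) ps x - x - h *\<^sub>R (\<Sum>p\<leftarrow>ps. b p x)) \<le> \<kappa>' * h\<^sup>2"
  using T D L
proof (induction ps)
  case Nil
  show ?case by (rule exI[of _ 0]) simp
next
  case (Cons p ps)
  have "\<exists>\<kappa>'\<ge>0. \<forall>h x. 0 \<le> h \<longrightarrow> h \<le> 1 \<longrightarrow> norm (fold (T h) ps x - x - h *\<^sub>R (\<Sum>p\<leftarrow>ps. b p x)) \<le> \<kappa>' * h\<^sup>2"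
    by (rule Cons.IH) (use Cons.prems in auto)
  then obtain \<kappa>' where \<kappa>': "\<kappa>' \<ge> 0"
    and IH: "\<And>h x. 0 \<le> h \<Longrightarrow> h \<le> 1 \<Longrightarrow> norm (fold (T h) ps x - x - h *\<^sub>R (\<Sum>p\<leftarrow>ps. b p x)) \<le> \<kappa>' * h\<^sup>2"
    by blast
  have Lps: "norm (b q x - b q y) \<le> L * norm (x - y)" if "q \<in> set ps" for q x y
    using Cons.prems(3) that by simp
  have sumL: "norm ((\<Sum>q\<leftarrow>ps. b q x) - (\<Sum>q\<leftarrow>ps. b q y)) \<le> length ps * L * norm (x - y)" for x y
  proof -
    have "norm ((\<Sum>q\<leftarrow>qs. b q x) - (\<Sum>q\<leftarrow>qs. b q y)) \<le> length qs * L * norm (x - y)" if "set qs \<subseteq> set ps" for qs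
      using that
    proof (induction qs)
      case (Cons q qs)
      have "norm (b q x - b q y) \<le> L * norm (x - y)"
        using Cons.prems by (intro Lps) auto
      moreover have "norm ((\<Sum>q\<leftarrow>q # qs. b q x) - (\<Sum>q\<leftarrow>q # qs. b q y)) \<le>
          norm (b q x - b q y) + norm ((\<Sum>q\<leftarrow>qs. b q x) - (\<Sum>q\<leftarrow>qs. b q y))"
        by (simp add: add_diff_add norm_triangle_ineq)
      ultimately show ?case using Cons by (simp add: algebra_simps)
    qed simp
    thus ?thesis by blast
  qed
  show ?case
  proof (intro exI[of _ "\<kappa>' + \<kappa> + length ps * L * (D + \<kappa>)"] conjI allI impI)
    fix h x assume h: "0 \<le> h" "(h :: real) \<le> 1"
    define y where "y = T h p x"
    have y: "norm (y - x - h *\<^sub>R b p x) \<le> \<kappa> * h\<^sup>2"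
      unfolding y_def by (rule Cons.prems(1)) (use h in auto)
    have "norm (y - x) \<le> norm (y - x - h *\<^sub>R b p x) + norm (h *\<^sub>R b p x)"
      by (metis diff_add_cancel norm_triangle_ineq)
    also have "\<dots> \<le> \<kappa> * h + D * h"
    proof (rule add_mono)
      have "\<kappa> * h\<^sup>2 \<le> \<kappa> * h" using h pos by (intro mult_left_mono) (auto simp: power2_eq_square mult_left_le)
      with y show "norm (y - x - h *\<^sub>R b p x) \<le> \<kappa> * h" by linarith
      show "norm (h *\<^sub>R b p x) \<le> D * h"
        using Cons.prems(2)[of p x] h by (simp add: mult.commute[of D] mult_left_mono)
    qed
    finally have yx: "norm (y - x) \<le> (D + \<kappa>) * h" by (simp add: algebra_simps)
    have "h * norm ((\<Sum>q\<leftarrow>ps. b q y) - (\<Sum>q\<leftarrow>ps. b q x)) \<le> h * (length ps * L * ((D + \<kappa>) * h))"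
      using h pos by (intro mult_left_mono order_trans[OF sumL] yx) auto
    hence B: "norm (h *\<^sub>R ((\<Sum>q\<leftarrow>ps. b q y) - (\<Sum>q\<leftarrow>ps. b q x))) \<le> length ps * L * (D + \<kappa>) * h\<^sup>2"
      using h by (simp add: power2_eq_square mult_ac)
    have "fold (T h) (p # ps) x - x - h *\<^sub>R (\<Sum>q\<leftarrow>p # ps. b q x) =
        (fold (T h) ps y - y - h *\<^sub>R (\<Sum>q\<leftarrow>ps. b q y)) + ((y - x - h *\<^sub>R b p x)
          + h *\<^sub>R ((\<Sum>q\<leftarrow>ps. b q y) - (\<Sum>q\<leftarrow>ps. b q x)))"
      by (simp add: y_def algebra_simps)
    also have "norm \<dots> \<le> \<kappa>' * h\<^sup>2 + (\<kappa> * h\<^sup>2 + length ps * L * (D + \<kappa>) * h\<^sup>2)"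
      by (intro norm_triangle_mono IH h y B)
    finally show "norm (fold (T h) (p # ps) x - x - h *\<^sub>R (\<Sum>q\<leftarrow>p # ps. b q x)) \<le>
        (\<kappa>' + \<kappa> + length ps * L * (D + \<kappa>)) * h\<^sup>2"
      by (simp add: algebra_simps)
  qed (use \<kappa>' pos in auto)
qed

primrec scheme :: "('e \<Rightarrow> 'e) \<Rightarrow> (nat \<Rightarrow> 'e) \<Rightarrow> 'e \<Rightarrow> nat \<Rightarrow> 'e::real_vector" where
  "scheme \<Psi> \<xi> y 0 = y"
| "scheme \<Psi> \<xi> y (Suc k) = \<Psi> (scheme \<Psi> \<xi> y k) + \<xi> k"

lemma discrete_Gronwall:
  fixes e :: "nat \<Rightarrow> real"
  assumes "e 0 = 0" "0 \<le> A" "0 \<le> l" and step: "\<And>k. k < n \<Longrightarrow> e (Suc k) \<le> (1 + l) * e k + A"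
  shows "e n \<le> n * A * exp (l * n)"
proof -
  have "e k \<le> k * A * (1 + l) ^ k" if "k \<le> n" for k
    using that
  proof (induction k)
    case (Suc k)
    have "e (Suc k) \<le> (1 + l) * e k + A" using Suc step by simp
    also have "\<dots> \<le> (1 + l) * (k * A * (1 + l) ^ k) + A * (1 + l) ^ Suc k"
    proof (rule add_mono)
      show "(1 + l) * e k \<le> (1 + l) * (k * A * (1 + l) ^ k)"
        using Suc assms by (intro mult_left_mono) auto
      have "1 \<le> (1 + l) ^ Suc k" using assms by (intro one_le_power) auto
      thus "A \<le> A * (1 + l) ^ Suc k" using assms by (simp add: mult_left_mono[of 1 "(1 + l) ^ Suc k" A, simplified])
    qed
    finally show ?case by (simp add: algebra_simps)
  qed (use assms in simp)
  from this[of n] have "e n \<le> n * A * (1 + l) ^ n" by simp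
  also have "\<dots> \<le> n * A * exp (l * n)"
  proof (rule mult_left_mono)
    have "(1 + l) ^ n \<le> exp l ^ n" using assms by (intro power_mono exp_ge_add_one_self) auto
    thus "(1 + l) ^ n \<le> exp (l * n)" by (simp add: exp_of_nat2_mult)
  qed (use assms in auto)
  finally show ?thesis .
qed

text \<open>The increments of \<open>w\<close> enter the path and the scheme identically and cancel,
  so no regularity of \<open>w\<close> is used. The path is merely continuous: a step has error
  \<open>h * (L * \<delta>)\<close> with \<delta> from uniform continuity, which is still summable
  over \<open>s / h\<close> steps. The index \<open>Suc N\<close> keeps the step size well defined
  for every \<open>N\<close>.\<close>

lemma scheme_converges:
  fixes x w :: "real \<Rightarrow> 'e::euclidean_space" and b :: "'e \<Rightarrow> 'e" and \<Psi> :: "real \<Rightarrow> 'e \<Rightarrow> 'e"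
  assumes s: "0 \<le> s" and cont: "continuous_on {0..s} x"
    and eq: "\<And>r t. 0 \<le> r \<Longrightarrow> r \<le> t \<Longrightarrow> t \<le> s \<Longrightarrow> x t - x r = w t - w r + integral {r..t} (\<lambda>u. b (x u))"
    and L: "\<And>y z. norm (b y - b z) \<le> L * norm (y - z)" and L0: "0 \<le> L"
    and \<Psi>: "\<And>h y. 0 \<le> h \<Longrightarrow> h \<le> 1 \<Longrightarrow> norm (\<Psi> h y - y - h *\<^sub>R b y) \<le> \<kappa> * h\<^sup>2" and \<kappa>: "0 \<le> \<kappa>"
  shows "(\<lambda>N. scheme (\<Psi> (1 / real (Suc N))) (\<lambda>k. w (real (Suc k) / real (Suc N)) - w (real k / real (Suc N))) (x 0)
      (nat \<lfloor>s * real (Suc N)\<rfloor>)) \<longlonglongrightarrow> x s"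
proof -
  have bc: "continuous_on UNIV b"
    by (rule lipschitz_on_continuous_on[of L], rule lipschitz_onI) (use L L0 in \<open>auto simp: dist_norm\<close>)
  have local: "norm (x t - x r - (w t - w r) - (t - r) *\<^sub>R b (x r)) \<le> (t - r) * (L * \<delta>)"
    if "0 \<le> r" "r \<le> t" "t \<le> s" and \<delta>: "\<And>u. u \<in> {r..t} \<Longrightarrow> norm (x u - x r) \<le> \<delta>" for r t \<delta>
  proof -
    have c: "continuous_on {r..t} (\<lambda>u. b (x u))"
      by (rule continuous_on_compose2[OF bc continuous_on_subset[OF cont]]) (use that in auto)
    have "x t - x r - (w t - w r) - (t - r) *\<^sub>R b (x r) = integral {r..t} (\<lambda>u. b (x u) - b (x r))"
      using that by (subst integral_diff) (auto simp: eq intro: integrable_continuous_real c)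
    also have "norm \<dots> \<le> (L * \<delta>) * (t - r)"
    proof (rule integral_bound)
      fix u assume "u \<in> {r..t}"
      from \<delta>[OF this] show "norm (b (x u) - b (x r)) \<le> L * \<delta>"
        by (intro order_trans[OF L] mult_left_mono L0)
    qed (use that in \<open>auto intro!: continuous_intros c\<close>)
    finally show ?thesis by (simp add: mult.commute)
  qed
  have unif: "uniformly_continuous_on {0..s} x"
    by (rule compact_uniformly_continuous[OF cont]) simp
  define Z where "Z N = scheme (\<Psi> (1 / real (Suc N))) (\<lambda>k. w (real (Suc k) / real (Suc N)) - w (real k / real (Suc N))) (x 0)
      (nat \<lfloor>s * real (Suc N)\<rfloor>)" for N
  have "Z \<longlonglongrightarrow> x s"
  proof (rule LIMSEQ_I)
    fix r :: real assume r: "r > 0"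
    define c where "c = s * exp (L * s)"
    have c0: "c \<ge> 0" using s by (simp add: c_def)
    \<comment> \<open>Chosen so that the total error
      \<open>(c * L + c * \<kappa> + 1) * \<delta>\<close> below equals \<open>r / 2\<close>. The
      summand 1 pays for the gap between the last grid point and \<open>s\<close>.\<close>
    define \<delta> where "\<delta> = r / (2 * (c * L + c * \<kappa> + 1))"
    have cc: "0 < c * L + c * \<kappa> + 1" using c0 L0 \<kappa> by (simp add: add_nonneg_pos)
    have \<delta>0: "\<delta> > 0" using cc r by (simp add: \<delta>_def)
    obtain \<eta> where \<eta>: "\<eta> > 0" "\<And>u v. u \<in> {0..s} \<Longrightarrow> v \<in> {0..s} \<Longrightarrow> dist u v < \<eta> \<Longrightarrow> dist (x u) (x v) < \<delta>"
      using unif \<delta>0 unfolding uniformly_continuous_on_def by (metis dist_commute)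
    obtain N0 where N0: "real N0 > 1 / \<eta>" "real N0 > 1 / \<delta>"
      using reals_Archimedean2[of "max (1 / \<eta>) (1 / \<delta>)"] by auto
    show "\<exists>no. \<forall>N\<ge>no. norm (Z N - x s) < r"
    proof (intro exI[of _ N0] allI impI)
      fix N assume N: "N \<ge> N0"
      define h where "h = 1 / real (Suc N)"
      have h: "0 < h" "h \<le> 1" by (simp_all add: h_def)
      have h\<eta>: "h < \<eta>"
      proof -
        have "1 / \<eta> < real (Suc N)" using N0 N by linarith
        thus ?thesis using \<eta>(1) by (simp add: h_def field_simps)
      qed
      have h\<delta>: "h < \<delta>"
      proof -
        have "1 / \<delta> < real (Suc N)" using N0 N by linarith
        thus ?thesis using \<delta>0 by (simp add: h_def field_simps)
      qed
      define n where "n = nat \<lfloor>s * real (Suc N)\<rfloor>"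
      have nle: "real n \<le> s * real (Suc N)" and ngt: "s * real (Suc N) < real n + 1"
        using s by (auto simp: n_def)
      have nh: "real n * h \<le> s" "s - real n * h < h"
      proof -
        have hS: "real (Suc N) * h = 1" by (simp add: h_def)
        have "real n * h \<le> s * real (Suc N) * h" using nle h by (intro mult_right_mono) auto
        thus "real n * h \<le> s" by (simp only: mult.assoc hS mult_1_right)
        have "s * real (Suc N) * h < (real n + 1) * h" using ngt h by (intro mult_strict_right_mono) auto
        hence "s < (real n + 1) * h" by (simp only: mult.assoc hS mult_1_right)
        thus "s - real n * h < h" by (simp add: algebra_simps)
      qed
      define Y where "Y = scheme (\<Psi> h) (\<lambda>k. w (real (Suc k) * h) - w (real k * h)) (x 0)"
      define e where "e k = norm (Y k - x (real k * h))" for k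
      have "e n \<le> n * (\<kappa> * h\<^sup>2 + h * (L * \<delta>)) * exp ((L * h) * n)"
      proof (rule discrete_Gronwall)
        fix k assume k: "k < n"
        define t0 where "t0 = real k * h"
        define t1 where "t1 = real (Suc k) * h"
        have t: "0 \<le> t0" "t0 \<le> t1" "t1 \<le> s" "t1 - t0 = h"
        proof -
          have "real (Suc k) * h \<le> real n * h" using k h by (intro mult_right_mono) auto
          also note nh(1)
          finally show "t1 \<le> s" unfolding t1_def .
        qed (use h in \<open>auto simp: t0_def t1_def algebra_simps\<close>)
        have "norm (x t1 - x t0 - (w t1 - w t0) - (t1 - t0) *\<^sub>R b (x t0)) \<le> (t1 - t0) * (L * \<delta>)"
        proof (rule local)
          fix u assume "u \<in> {t0..t1}"
          hence "dist (x u) (x t0) < \<delta>" using t h\<eta> by (intro \<eta>(2)) (auto simp: dist_real_def)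
          thus "norm (x u - x t0) \<le> \<delta>" by (simp add: dist_norm)
        qed (use t in auto)
        hence 1: "norm (x t0 + (w t1 - w t0) + h *\<^sub>R b (x t0) - x t1) \<le> h * (L * \<delta>)"
          unfolding t(4) by (subst norm_minus_commute) (simp add: algebra_simps)
        have 2: "norm (\<Psi> h (Y k) - Y k - h *\<^sub>R b (Y k)) \<le> \<kappa> * h\<^sup>2"
          using \<Psi> h by simp
        have 3: "norm (h *\<^sub>R (b (Y k) - b (x t0))) \<le> L * h * e k"
          using mult_left_mono[OF L[of "Y k" "x t0"], of h] h by (simp add: e_def t0_def mult_ac)
        \<comment> \<open>Four contributions: the inconsistency of the step map, the local error of
          the path, the drift at two different points, and the error inherited from the previous
          step.\<close>
        have "Y (Suc k) - x t1 = (\<Psi> h (Y k) - Y k - h *\<^sub>R b (Y k)) + ((x t0 + (w t1 - w t0) + h *\<^sub>R b (x t0) - x t1)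
            + (h *\<^sub>R (b (Y k) - b (x t0)) + (Y k - x t0)))"
          by (simp add: Y_def t0_def t1_def algebra_simps)
        also have "norm \<dots> \<le> \<kappa> * h\<^sup>2 + (h * (L * \<delta>) + (L * h * e k + e k))"
          using 1 2 3 by (intro norm_triangle_mono) (auto simp: e_def t0_def)
        finally show "e (Suc k) \<le> (1 + L * h) * e k + (\<kappa> * h\<^sup>2 + h * (L * \<delta>))"
          by (simp add: e_def t1_def algebra_simps)
      qed (use h L0 \<kappa> \<delta>0 in \<open>auto simp: e_def Y_def\<close>)
      also have "\<dots> = (real n * h) * exp (L * (real n * h)) * (\<kappa> * h + L * \<delta>)"
        by (simp add: power2_eq_square algebra_simps)
      also have "\<dots> \<le> c * (\<kappa> * \<delta> + L * \<delta>)"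
        unfolding c_def using nh h\<delta> h L0 \<kappa> \<delta>0 s
        by (intro mult_mono add_mono mult_left_mono) (auto intro!: mult_nonneg_nonneg add_nonneg_nonneg mult_left_mono)
      finally have en: "e n \<le> c * (\<kappa> * \<delta> + L * \<delta>)" .
      \<comment> \<open>The scheme stops at the last grid point, less than one step before
        \<open>s\<close>.\<close>
      have "dist (x (real n * h)) (x s) < \<delta>"
        using nh h h\<eta> s by (intro \<eta>(2)) (auto simp: dist_real_def)
      hence "norm (Y n - x s) < c * (\<kappa> * \<delta> + L * \<delta>) + \<delta>"
        using en norm_triangle_ineq[of "Y n - x (real n * h)" "x (real n * h) - x s"]
        by (simp add: e_def dist_norm)
      also have "\<dots> = (c * L + c * \<kappa> + 1) * \<delta>" by (simp add: algebra_simps)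
      also have "\<dots> < r"
      proof -
        have "D * (r / (2 * D)) < r" if "D > 0" for D using that r by simp
        from this[OF cc] show ?thesis unfolding \<delta>_def .
      qed
      finally show "norm (Z N - x s) < r"
        by (simp add: Z_def Y_def h_def n_def)
    qed
  qed
  thus ?thesis by (simp add: Z_def[abs_def])
qed

subsection \<open>The splitting scheme for the vortex system\<close>

text \<open>The resulting kernel is the original one outside the disc of radius \<epsilon> and a
  rigid rotation inside it. It is still \<open>perp d\<close> times a function of the norm of
  \<open>d\<close>, so its flow is a twist.\<close>

definition reg_factor :: "real \<Rightarrow> real \<Rightarrow> real" where
  "reg_factor \<epsilon> r = 1 / (2 * pi * (max \<epsilon> r)\<^sup>2)"

definition reg_kernel :: "real \<Rightarrow> real^2 \<Rightarrow> real^2" where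
  "reg_kernel \<epsilon> d = reg_factor \<epsilon> (norm d) *\<^sub>R perp d"

text \<open>Both particles move with coefficient \<open>a / 2\<close>, in opposite directions, so
  the distance vector turns with angular velocity \<open>a * reg_factor \<epsilon> r\<close>. This
  is the angle per unit of time in \<open>vortex_step\<close>.\<close>

definition pair_drift :: "real \<Rightarrow> real \<Rightarrow> 'n \<times> 'n \<Rightarrow> real^2^'n \<Rightarrow> real^2^'n::finite" where
  "pair_drift \<epsilon> a p x = (let u = (a / 2) *\<^sub>R reg_kernel \<epsilon> (x $ fst p - x $ snd p) in axis (fst p) u - axis (snd p) u)"

definition reg_drift :: "real \<Rightarrow> real \<Rightarrow> real^2^'n \<Rightarrow> real^2^'n::finite" where
  "reg_drift \<epsilon> a x = (\<chi> i. \<Sum>j\<in>UNIV - {i}. a *\<^sub>R reg_kernel \<epsilon> (x $ i - x $ j))"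

text \<open>Twists of different pairs do not commute in general, so an order has to be fixed;
  consistency to first order holds for any choice.\<close>

definition distinct_pairs :: "('n::finite \<times> 'n) list" where
  "distinct_pairs = (SOME ps. distinct ps \<and> set ps = {p. fst p \<noteq> snd p})"

text \<open>Every unordered pair of particles occurs twice among the ordered pairs, so each of the two
  twists only rotates by half of the angle.\<close>

definition vortex_step :: "real \<Rightarrow> real \<Rightarrow> real \<Rightarrow> real^2^'n \<Rightarrow> real^2^'n::finite" where
  "vortex_step \<epsilon> a h = fold (pair_twist (\<lambda>r. h * (a * reg_factor \<epsilon> r))) distinct_pairs"

lemma distinct_pairs:
  "distinct (distinct_pairs :: ('n::finite \<times> 'n) list)"
  "set distinct_pairs = {p :: 'n \<times> 'n. fst p \<noteq> snd p}"
proof -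
  have "\<exists>ps :: ('n \<times> 'n) list. distinct ps \<and> set ps = {p. fst p \<noteq> snd p}"
    using finite_distinct_list[of "{p :: 'n \<times> 'n. fst p \<noteq> snd p}"] by auto
  from someI_ex[OF this, folded distinct_pairs_def]
  show "distinct (distinct_pairs :: ('n \<times> 'n) list)" "set distinct_pairs = {p :: 'n \<times> 'n. fst p \<noteq> snd p}"
    by auto
qed

lemma gauss_preserving_vortex_step: "gauss_preserving (vortex_step \<epsilon> a h)"
  unfolding vortex_step_def
proof (rule gauss_preserving_fold)
  fix p :: "'a \<times> 'a" assume "p \<in> set distinct_pairs"
  thus "gauss_preserving (pair_twist (\<lambda>r. h * (a * reg_factor \<epsilon> r)) p)"
    by (intro gauss_preserving_pair_twist) (auto simp: distinct_pairs reg_factor_def)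
qed

lemma perp_diff: "perp x - perp y = perp (x - y)"
  and perp_minus: "perp (- x) = - perp x"
  by (simp_all add: vec_eq_iff forall_2)

lemma norm_perp [simp]: "norm (perp x) = norm x"
  using norm_rot2[of "pi / 2" x] by (simp add: rot2_def)

lemma reg_factor_bounds:
  assumes "\<epsilon> > 0" "r \<ge> 0"
  shows "0 \<le> reg_factor \<epsilon> r" "reg_factor \<epsilon> r \<le> 1 / (2 * pi * \<epsilon>\<^sup>2)" "reg_factor \<epsilon> r * r \<le> 1 / (2 * pi * \<epsilon>)"
proof -
  define m where "m = max \<epsilon> r"
  have m: "m \<ge> \<epsilon>" "m \<ge> r" "m > 0" using assms by (auto simp: m_def)
  show "0 \<le> reg_factor \<epsilon> r" by (simp add: reg_factor_def)
  show "reg_factor \<epsilon> r \<le> 1 / (2 * pi * \<epsilon>\<^sup>2)"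
    unfolding reg_factor_def m_def[symmetric] using m assms
    by (intro divide_left_mono mult_left_mono power_mono) auto
  have "r / (2 * pi * m\<^sup>2) \<le> m / (2 * pi * m\<^sup>2)" using m by (intro divide_right_mono) auto
  also have "\<dots> = 1 / (2 * pi * m)" using m by (simp add: power2_eq_square)
  also have "\<dots> \<le> 1 / (2 * pi * \<epsilon>)" using m assms by (intro divide_left_mono mult_left_mono) auto
  finally show "reg_factor \<epsilon> r * r \<le> 1 / (2 * pi * \<epsilon>)" by (simp add: reg_factor_def m_def)
qed

text \<open>The difference is split into \<open>perp (x - y)\<close> with the coefficient at
  \<open>x\<close>, and \<open>perp y\<close> with the difference of the coefficients. Truncation of
  the norm at \<epsilon> is a contraction, and \<open>norm y \<le> n\<close> absorbs the growth of
  the second term. The two parts contribute 1 and 2 to the constant 3; the gain of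
  \<open>2 * pi\<close> is given away.\<close>

lemma reg_kernel_Lipschitz:
  assumes "\<epsilon> > 0"
  shows "norm (reg_kernel \<epsilon> x - reg_kernel \<epsilon> y) \<le> 3 / \<epsilon>\<^sup>2 * norm (x - y)"
proof -
  define m where "m = max \<epsilon> (norm x)"
  define n where "n = max \<epsilon> (norm y)"
  have m: "m \<ge> \<epsilon>" "m > 0" and n: "n \<ge> \<epsilon>" "n \<ge> norm y" "n > 0" using assms by (auto simp: m_def n_def)
  have mn: "\<bar>n - m\<bar> \<le> norm (x - y)"
    using norm_triangle_ineq3[of x y] by (auto simp: m_def n_def max_def)
  have "1 / m\<^sup>2 - 1 / n\<^sup>2 = (n - m) * ((1 / n) * (1 / m\<^sup>2) + (1 / n\<^sup>2) * (1 / m))"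
    using m n by (simp add: field_simps power2_eq_square)
  hence "\<bar>1 / m\<^sup>2 - 1 / n\<^sup>2\<bar> * n = \<bar>n - m\<bar> * ((1 / n) * (1 / m\<^sup>2) + (1 / n\<^sup>2) * (1 / m)) * n"
    using m n by (simp add: abs_mult)
  also have "\<dots> = \<bar>n - m\<bar> * (1 / m\<^sup>2 + (1 / n) * (1 / m))"
    using n by (simp add: field_simps power2_eq_square)
  also have "\<dots> \<le> norm (x - y) * (1 / \<epsilon>\<^sup>2 + (1 / \<epsilon>) * (1 / \<epsilon>))"
    using m n assms by (intro mult_mono add_mono mn divide_left_mono power_mono) auto
  finally have 1: "\<bar>1 / m\<^sup>2 - 1 / n\<^sup>2\<bar> * n \<le> norm (x - y) * (2 / \<epsilon>\<^sup>2)"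
    by (simp add: power2_eq_square)
  have "(2 * pi) *\<^sub>R (reg_kernel \<epsilon> x - reg_kernel \<epsilon> y) = (1 / m\<^sup>2) *\<^sub>R perp x - (1 / n\<^sup>2) *\<^sub>R perp y"
    unfolding reg_kernel_def reg_factor_def m_def[symmetric] n_def[symmetric]
    by (simp add: scaleR_diff_right)
  also have "\<dots> = (1 / m\<^sup>2) *\<^sub>R perp (x - y) + (1 / m\<^sup>2 - 1 / n\<^sup>2) *\<^sub>R perp y"
    by (simp add: perp_diff[symmetric] scaleR_diff_left scaleR_diff_right)
  also have "norm \<dots> \<le> norm (x - y) * (1 / \<epsilon>\<^sup>2) + norm (x - y) * (2 / \<epsilon>\<^sup>2)"
  proof (rule norm_triangle_mono)
    have "1 / m\<^sup>2 \<le> 1 / \<epsilon>\<^sup>2" using m assms by (intro divide_left_mono power_mono) auto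
    thus "norm ((1 / m\<^sup>2) *\<^sub>R perp (x - y)) \<le> norm (x - y) * (1 / \<epsilon>\<^sup>2)"
      using mult_left_mono[of "1 / m\<^sup>2" "1 / \<epsilon>\<^sup>2" "norm (x - y)"] by (simp add: mult.commute)
    have "\<bar>1 / m\<^sup>2 - 1 / n\<^sup>2\<bar> * norm y \<le> \<bar>1 / m\<^sup>2 - 1 / n\<^sup>2\<bar> * n" using n by (intro mult_left_mono) auto
    with 1 show "norm ((1 / m\<^sup>2 - 1 / n\<^sup>2) *\<^sub>R perp y) \<le> norm (x - y) * (2 / \<epsilon>\<^sup>2)" by simp
  qed
  also have "\<dots> = 3 / \<epsilon>\<^sup>2 * norm (x - y)" by (simp add: algebra_simps)
  finally have "2 * pi * norm (reg_kernel \<epsilon> x - reg_kernel \<epsilon> y) \<le> 3 / \<epsilon>\<^sup>2 * norm (x - y)"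
    by simp
  moreover have "1 * norm (reg_kernel \<epsilon> x - reg_kernel \<epsilon> y) \<le> 2 * pi * norm (reg_kernel \<epsilon> x - reg_kernel \<epsilon> y)"
    using pi_ge_two by (intro mult_right_mono) auto
  ultimately show ?thesis by linarith
qed

lemma norm_rot2_expansion: "norm (rot2 \<theta> d - d - \<theta> *\<^sub>R perp d) \<le> \<theta>\<^sup>2 * norm d"
proof -
  have "\<bar>sin \<theta> - (\<Sum>m<2. sin_coeff m * \<theta> ^ m)\<bar> \<le> inverse (fact 2) * \<bar>\<theta>\<bar> ^ 2"
    by (rule Maclaurin_sin_bound)
  hence s: "\<bar>sin \<theta> - \<theta>\<bar> \<le> \<theta>\<^sup>2 / 2"
    by (simp add: numeral_2_eq_2 sin_coeff_def)
  have "1 - cos \<theta> = 2 * (sin (\<theta> / 2))\<^sup>2"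
    using cos_double_sin[of "\<theta> / 2"] by simp
  also have "(sin (\<theta> / 2))\<^sup>2 \<le> (\<theta> / 2)\<^sup>2"
    using abs_sin_x_le_abs_x[of "\<theta> / 2"] by (simp only: abs_le_square_iff)
  finally have c: "\<bar>cos \<theta> - 1\<bar> \<le> \<theta>\<^sup>2 / 2"
    using cos_le_one[of \<theta>] by (simp add: power_divide)
  have "rot2 \<theta> d - d - \<theta> *\<^sub>R perp d = (cos \<theta> - 1) *\<^sub>R d + (sin \<theta> - \<theta>) *\<^sub>R perp d"
    by (simp add: rot2_def algebra_simps)
  also have "norm \<dots> \<le> \<theta>\<^sup>2 / 2 * norm d + \<theta>\<^sup>2 / 2 * norm d"
    unfolding norm_perp[of d, symmetric]
    by (intro norm_triangle_mono) (simp_all only: norm_scaleR norm_perp mult_right_mono s c norm_ge_zero)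
  finally show ?thesis by (simp add: mult.commute)
qed

lemma norm_axis: "norm (axis i u :: 'a::real_inner ^ 'n::finite) = norm u"
  by (simp add: norm_eq_sqrt_inner inner_axis_axis)

lemma norm_axis_diff_le: "norm (axis i u - axis j u :: 'a::real_inner ^ 'n::finite) \<le> 2 * norm u"
  using norm_triangle_ineq4[of "axis i u" "axis j u"] by (simp add: norm_axis)

text \<open>The kernel is odd, so the ordered pairs (k, j) and (j, k) push the particle
  \<open>k\<close> in the same way, and the two halves of \<open>a\<close> add up.\<close>

lemma sum_pair_drift:
  fixes x :: "real^2^'n::finite"
  shows "(\<Sum>p\<leftarrow>distinct_pairs. pair_drift \<epsilon> a p x) = reg_drift \<epsilon> a x"
proof (rule vec_eq_iff[THEN iffD2], rule allI)
  fix k :: 'n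
  define u where "u i j = (a / 2) *\<^sub>R reg_kernel \<epsilon> (x $ i - x $ j)" for i j
  have anti: "u i j = - u j i" for i j
    using norm_minus_commute[of "x $ i" "x $ j"] perp_minus[of "x $ i - x $ j"]
    by (simp add: u_def reg_kernel_def)
  have "(\<Sum>p\<leftarrow>distinct_pairs. pair_drift \<epsilon> a p x) $ k = (\<Sum>p | fst p \<noteq> snd p. pair_drift \<epsilon> a p x $ k)"
    by (subst sum_list_distinct_conv_sum_set[OF distinct_pairs(1)]) (simp add: distinct_pairs(2))
  also have "{p :: 'n \<times> 'n. fst p \<noteq> snd p} = Sigma UNIV (\<lambda>i. UNIV - {i})" by auto
  also have "(\<Sum>p\<in>Sigma UNIV (\<lambda>i. UNIV - {i}). pair_drift \<epsilon> a p x $ k) =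
      (\<Sum>i\<in>UNIV. \<Sum>j\<in>UNIV - {i}. (if k = i then u i j else 0) - (if k = j then u i j else 0))"
    by (subst sum.Sigma) (auto simp: pair_drift_def Let_def axis_def u_def cong: if_cong intro!: sum.cong)
  also have "\<dots> = (\<Sum>i\<in>UNIV. \<Sum>j\<in>UNIV - {i}. (if k = i then u i j else 0)) -
      (\<Sum>i\<in>UNIV. \<Sum>j\<in>UNIV - {i}. (if k = j then u i j else 0))"
    by (simp add: sum_subtractf)
  also have "(\<Sum>i\<in>UNIV. \<Sum>j\<in>UNIV - {i}. (if k = i then u i j else 0)) = (\<Sum>i\<in>UNIV. if k = i then (\<Sum>j\<in>UNIV - {k}. u k j) else 0)"
    by (rule sum.cong) auto
  also have "\<dots> = (\<Sum>j\<in>UNIV - {k}. u k j)" by simp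
  also have "(\<Sum>i\<in>UNIV. \<Sum>j\<in>UNIV - {i}. (if k = j then u i j else 0)) = (\<Sum>i\<in>UNIV. if k = i then 0 else u i k)"
    by (intro sum.cong refl) (auto simp: sum.delta)
  also have "\<dots> = (\<Sum>j\<in>UNIV - {k}. u j k)"
    by (subst sum.remove[of UNIV k]) (auto intro!: sum.cong)
  also have "(\<Sum>j\<in>UNIV - {k}. u k j) - (\<Sum>j\<in>UNIV - {k}. u j k) = (\<Sum>j\<in>UNIV - {k}. a *\<^sub>R reg_kernel \<epsilon> (x $ k - x $ j))"
  proof -
    have "u k j - u j k = a *\<^sub>R reg_kernel \<epsilon> (x $ k - x $ j)" for j
      unfolding anti[of j k] by (simp add: u_def flip: scaleR_add_left)
    thus ?thesis by (simp flip: sum_subtractf)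
  qed
  also have "\<dots> = reg_drift \<epsilon> a x $ k" by (simp add: reg_drift_def)
  finally show "(\<Sum>p\<leftarrow>distinct_pairs. pair_drift \<epsilon> a p x) $ k = reg_drift \<epsilon> a x $ k" .
qed

lemma pair_drift_bound:
  assumes "\<epsilon> > 0"
  shows "norm (pair_drift \<epsilon> a p x) \<le> \<bar>a\<bar> * (1 / (2 * pi * \<epsilon>))"
proof -
  let ?d = "x $ fst p - x $ snd p"
  have "norm (pair_drift \<epsilon> a p x) \<le> 2 * norm ((a / 2) *\<^sub>R reg_kernel \<epsilon> ?d)"
    unfolding pair_drift_def Let_def by (rule norm_axis_diff_le)
  also have "\<dots> = \<bar>a\<bar> * (reg_factor \<epsilon> (norm ?d) * norm ?d)"
    using reg_factor_bounds(1)[OF assms norm_ge_zero[of ?d]] by (simp add: reg_kernel_def abs_mult)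
  also have "\<dots> \<le> \<bar>a\<bar> * (1 / (2 * pi * \<epsilon>))"
    by (intro mult_left_mono reg_factor_bounds assms) auto
  finally show ?thesis .
qed

lemma pair_drift_Lipschitz:
  assumes "\<epsilon> > 0"
  shows "norm (pair_drift \<epsilon> a p x - pair_drift \<epsilon> a p y) \<le> 6 * \<bar>a\<bar> / \<epsilon>\<^sup>2 * norm (x - y)"
proof -
  let ?d = "\<lambda>x. x $ fst p - x $ snd p"
  have "pair_drift \<epsilon> a p x - pair_drift \<epsilon> a p y =
      axis (fst p) ((a / 2) *\<^sub>R (reg_kernel \<epsilon> (?d x) - reg_kernel \<epsilon> (?d y))) -
      axis (snd p) ((a / 2) *\<^sub>R (reg_kernel \<epsilon> (?d x) - reg_kernel \<epsilon> (?d y)))"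
    by (simp add: pair_drift_def Let_def vec_eq_iff axis_def scaleR_diff_right)
  hence "norm (pair_drift \<epsilon> a p x - pair_drift \<epsilon> a p y) \<le> 2 * norm ((a / 2) *\<^sub>R (reg_kernel \<epsilon> (?d x) - reg_kernel \<epsilon> (?d y)))"
    by (simp only: norm_axis_diff_le)
  also have "\<dots> = \<bar>a\<bar> * norm (reg_kernel \<epsilon> (?d x) - reg_kernel \<epsilon> (?d y))" by simp
  also have "\<dots> \<le> \<bar>a\<bar> * (3 / \<epsilon>\<^sup>2 * norm (?d x - ?d y))"
    by (intro mult_left_mono reg_kernel_Lipschitz assms) auto
  also have "\<dots> \<le> \<bar>a\<bar> * (3 / \<epsilon>\<^sup>2 * (2 * norm (x - y)))"
  proof (intro mult_left_mono)
    have "?d x - ?d y = (x - y) $ fst p - (x - y) $ snd p" by simp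
    also have "norm \<dots> \<le> norm (x - y) + norm (x - y)"
      by (intro order_trans[OF norm_triangle_ineq4] add_mono Finite_Cartesian_Product.norm_nth_le)
    finally show "norm (?d x - ?d y) \<le> 2 * norm (x - y)" by simp
  qed (use assms in auto)
  finally show ?thesis by (simp add: algebra_simps)
qed

lemma reg_drift_Lipschitz:
  assumes "\<epsilon> > 0"
  shows "\<exists>L\<ge>0. \<forall>x y. norm (reg_drift \<epsilon> a x - reg_drift \<epsilon> a y :: real^2^'n::finite) \<le> L * norm (x - y)"
proof (intro exI conjI allI)
  let ?P = "{p :: 'n \<times> 'n. fst p \<noteq> snd p}"
  show "0 \<le> card ?P * (6 * \<bar>a\<bar> / \<epsilon>\<^sup>2)" by simp
  fix x y :: "real^2^'n"
  have "reg_drift \<epsilon> a x - reg_drift \<epsilon> a y = (\<Sum>p\<in>?P. pair_drift \<epsilon> a p x - pair_drift \<epsilon> a p y)"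
    unfolding sum_pair_drift[symmetric]
    by (simp add: sum_list_distinct_conv_sum_set[OF distinct_pairs(1)] distinct_pairs(2) sum_subtractf)
  also have "norm \<dots> \<le> of_nat (card ?P) * (6 * \<bar>a\<bar> / \<epsilon>\<^sup>2 * norm (x - y))"
    by (rule order_trans[OF norm_sum sum_bounded_above]) (rule pair_drift_Lipschitz[OF assms])
  finally show "norm (reg_drift \<epsilon> a x - reg_drift \<epsilon> a y) \<le> card ?P * (6 * \<bar>a\<bar> / \<epsilon>\<^sup>2) * norm (x - y)"
    by (simp add: mult.assoc)
qed

text \<open>Turning by an angle \<theta> instead of moving along the tangent costs at most
  \<open>\<theta>\<^sup>2 * norm d\<close>. Here \<open>\<theta> = h * (a * f)\<close>, and the
  decay of the kernel bounds both \<open>f\<close> and \<open>f * norm d\<close>. The constant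
  therefore holds uniformly in space, also for distant particles.\<close>

lemma vortex_step_consistent:
  assumes \<epsilon>: "\<epsilon> > 0"
  shows "\<exists>\<kappa>\<ge>0. \<forall>h x. 0 \<le> h \<longrightarrow> h \<le> 1 \<longrightarrow>
    norm (vortex_step \<epsilon> a h x - x - h *\<^sub>R reg_drift \<epsilon> a (x :: real^2^'n::finite)) \<le> \<kappa> * h\<^sup>2"
proof -
  let ?D = "1 / (2 * pi * \<epsilon>)" and ?F = "1 / (2 * pi * \<epsilon>\<^sup>2)"
  have "\<exists>\<kappa>'\<ge>0. \<forall>h x. 0 \<le> h \<longrightarrow> h \<le> 1 \<longrightarrow>
    norm (fold (pair_twist (\<lambda>r. h * (a * reg_factor \<epsilon> r))) distinct_pairs x - x -
      h *\<^sub>R (\<Sum>p\<leftarrow>distinct_pairs. pair_drift \<epsilon> a p (x :: real^2^'n))) \<le> \<kappa>' * h\<^sup>2"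
  proof (rule fold_consistent[where D = "\<bar>a\<bar> * ?D" and L = "6 * \<bar>a\<bar> / \<epsilon>\<^sup>2"])
    fix h and p :: "'n \<times> 'n" and x :: "real^2^'n"
    assume h: "0 \<le> h" "h \<le> (1 :: real)"
    define d where "d = x $ fst p - x $ snd p"
    define f where "f = reg_factor \<epsilon> (norm d)"
    have f: "0 \<le> f" "f \<le> ?F" "f * norm d \<le> ?D"
      unfolding f_def by (intro reg_factor_bounds \<epsilon> norm_ge_zero)+
    define e where "e = (1 / 2) *\<^sub>R (rot2 (h * (a * f)) d - d - (h * (a * f)) *\<^sub>R perp d)"
    have "pair_twist (\<lambda>r. h * (a * reg_factor \<epsilon> r)) p x - x - h *\<^sub>R pair_drift \<epsilon> a p x = axis (fst p) e - axis (snd p) e"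
      unfolding pair_twist_def pair_drift_def Let_def d_def[symmetric] twist_def reg_kernel_def f_def[symmetric] e_def
      by (simp add: vec_eq_iff[where 'a = "real^2"] axis_def algebra_simps)
    hence "norm (pair_twist (\<lambda>r. h * (a * reg_factor \<epsilon> r)) p x - x - h *\<^sub>R pair_drift \<epsilon> a p x) \<le> 2 * norm e"
      by (simp only: norm_axis_diff_le)
    also have "\<dots> \<le> (h * (a * f))\<^sup>2 * norm d"
      unfolding e_def using norm_rot2_expansion[of "h * (a * f)" d] by simp
    also have "\<dots> = a\<^sup>2 * (f * (f * norm d)) * h\<^sup>2" by (simp add: power2_eq_square mult_ac)
    also have "\<dots> \<le> a\<^sup>2 * (?F * ?D) * h\<^sup>2"
      using f \<epsilon> by (intro mult_right_mono mult_left_mono mult_mono) auto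
    finally show "norm (pair_twist (\<lambda>r. h * (a * reg_factor \<epsilon> r)) p x - x - h *\<^sub>R pair_drift \<epsilon> a p x) \<le> a\<^sup>2 * (?F * ?D) * h\<^sup>2" .
  next
    fix p :: "'n \<times> 'n" and x y :: "real^2^'n"
    show "norm (pair_drift \<epsilon> a p x - pair_drift \<epsilon> a p y) \<le> 6 * \<bar>a\<bar> / \<epsilon>\<^sup>2 * norm (x - y)"
      "norm (pair_drift \<epsilon> a p x) \<le> \<bar>a\<bar> * ?D"
      by (intro pair_drift_bound pair_drift_Lipschitz \<epsilon>)+
  qed (use \<epsilon> in auto)
  thus ?thesis by (simp add: vortex_step_def sum_pair_drift)
qed

lemma reg_kernel_eq_biot_savart:
  "\<epsilon> \<le> norm d \<Longrightarrow> reg_kernel \<epsilon> d = biot_savart d"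
  by (simp add: reg_kernel_def reg_factor_def biot_savart_def max_absorb2)

lemma continuous_on_reg_drift:
  fixes x :: "real \<Rightarrow> real^2^'n::finite"
  assumes "\<epsilon> > 0" "continuous_on S x"
  shows "continuous_on S (\<lambda>u. reg_drift \<epsilon> a (x u))"
proof -
  obtain L where L: "L \<ge> 0" "\<And>x y. norm (reg_drift \<epsilon> a x - reg_drift \<epsilon> a y :: real^2^'n) \<le> L * norm (x - y)"
    using reg_drift_Lipschitz[OF assms(1), of a] by blast
  have "continuous_on UNIV (reg_drift \<epsilon> a :: real^2^'n \<Rightarrow> _)"
    by (rule lipschitz_on_continuous_on[of L], rule lipschitz_onI) (use L in \<open>auto simp: dist_norm\<close>)
  from continuous_on_compose2[OF this assms(2)] show ?thesis by simp
qed

text \<open>Each distance is continuous and positive on a compact interval, and there are finitely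
  many pairs. The bound depends on the path, so \<epsilon> cannot be chosen once for all sample
  points.\<close>

lemma particles_separated:
  fixes x :: "real \<Rightarrow> real^2^'n::finite"
  assumes cont: "continuous_on {0..s} x" and s: "s \<ge> 0"
    and nocoll: "\<And>t i j. t \<ge> 0 \<Longrightarrow> i \<noteq> j \<Longrightarrow> x t $ i \<noteq> x t $ j"
  obtains \<epsilon> where "\<epsilon> > 0" "\<And>t i j. t \<in> {0..s} \<Longrightarrow> i \<noteq> j \<Longrightarrow> \<epsilon> \<le> norm (x t $ i - x t $ j)"
proof -
  have "\<exists>e>0. \<forall>t\<in>{0..s}. fst p \<noteq> snd p \<longrightarrow> e \<le> norm (x t $ fst p - x t $ snd p)" for p
  proof (cases "fst p = snd p")
    case False
    have "continuous_on {0..s} (\<lambda>t. norm (x t $ fst p - x t $ snd p))"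
      by (intro continuous_intros cont)
    from continuous_attains_inf[OF _ _ this] s obtain t0 where t0: "t0 \<in> {0..s}"
      "\<forall>t\<in>{0..s}. norm (x t0 $ fst p - x t0 $ snd p) \<le> norm (x t $ fst p - x t $ snd p)"
      by auto
    show ?thesis
      using nocoll[of t0 "fst p" "snd p"] t0 False
      by (intro exI[of _ "norm (x t0 $ fst p - x t0 $ snd p)"]) auto
  qed (auto intro: exI[of _ 1])
  then obtain e where e: "\<And>p. e p > 0"
    "\<And>p t. t \<in> {0..s} \<Longrightarrow> fst p \<noteq> snd p \<Longrightarrow> e p \<le> norm (x t $ fst p - x t $ snd p)"
    by metis
  have fin: "finite (range e)" by simp
  show thesis
  proof
    show "Min (range e) > 0" using e(1) fin by (subst Min_gr_iff) auto
    show "Min (range e) \<le> norm (x t $ i - x t $ j)" if "t \<in> {0..s}" "i \<noteq> j" for t i j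
    proof (rule order_trans)
      show "Min (range e) \<le> e (i, j)" by (rule Min_le[OF fin]) simp
      show "e (i, j) \<le> norm (x t $ i - x t $ j)" using e(2)[OF that(1), of "(i, j)"] that(2) by simp
    qed
  qed
qed

text \<open>For \<epsilon> up to the smallest distance along the path, the regularised drift and the
  true one agree on it, so the given path solves a Lipschitz equation. Convergence is stated for
  each such fixed \<epsilon>, with no uniformity in \<epsilon>.\<close>

lemma vortex_scheme_converges:
  fixes x :: "real \<Rightarrow> real^2^'n::finite" and w :: "'n \<Rightarrow> real \<Rightarrow> real^2"
  assumes s: "s \<ge> 0" and cont: "continuous_on {0..} x"
    and nocoll: "\<And>t i j. t \<ge> 0 \<Longrightarrow> i \<noteq> j \<Longrightarrow> x t $ i \<noteq> x t $ j"
    and eq: "\<And>t i. t \<ge> 0 \<Longrightarrow> x t $ i = x 0 $ i + c *\<^sub>R w i t +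
      (LINT u:{0..t}|lborel. (\<Sum>j\<in>UNIV - {i}. a *\<^sub>R biot_savart (x u $ i - x u $ j)))"
  shows "\<exists>\<epsilon>0>0. \<forall>\<epsilon>>0. \<epsilon> \<le> \<epsilon>0 \<longrightarrow>
    (\<lambda>N. scheme (vortex_step \<epsilon> a (1 / real (Suc N)))
       (\<lambda>k. c *\<^sub>R (\<chi> i. w i (real (Suc k) / real (Suc N)) - w i (real k / real (Suc N)))) (x 0)
       (nat \<lfloor>s * real (Suc N)\<rfloor>)) \<longlonglongrightarrow> x s"
proof -
  have conts: "continuous_on {0..s} x" by (rule continuous_on_subset[OF cont]) auto
  obtain \<epsilon>0 where \<epsilon>0: "\<epsilon>0 > 0" "\<And>t i j. t \<in> {0..s} \<Longrightarrow> i \<noteq> j \<Longrightarrow> \<epsilon>0 \<le> norm (x t $ i - x t $ j)"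
    using particles_separated[OF conts s nocoll] by blast
  show ?thesis
  proof (intro exI[of _ \<epsilon>0] conjI allI impI \<epsilon>0(1))
    fix \<epsilon> :: real assume \<epsilon>: "\<epsilon> > 0" "\<epsilon> \<le> \<epsilon>0"
    define b where "b = (reg_drift \<epsilon> a :: real^2^'n \<Rightarrow> _)"
    define v where "v t = c *\<^sub>R (\<chi> i. w i t)" for t
    have bc: "continuous_on {r..t} (\<lambda>u. b (x u))" if "r \<ge> 0" "t \<le> s" for r t
      unfolding b_def by (rule continuous_on_reg_drift[OF \<epsilon>(1) continuous_on_subset[OF cont]]) (use that in auto)
    have eq0: "x t = x 0 + v t + integral {0..t} (\<lambda>u. b (x u))" if t: "0 \<le> t" "t \<le> s" for t
    proof (rule vec_eq_iff[THEN iffD2], rule allI)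
      fix i
      have "(LINT u:{0..t}|lborel. (\<Sum>j\<in>UNIV - {i}. a *\<^sub>R biot_savart (x u $ i - x u $ j))) =
          (LINT u:{0..t}|lborel. b (x u) $ i)"
      proof (rule set_lebesgue_integral_cong)
        show "\<forall>u. u \<in> {0..t} \<longrightarrow> (\<Sum>j\<in>UNIV - {i}. a *\<^sub>R biot_savart (x u $ i - x u $ j)) = b (x u) $ i"
        proof (intro allI impI)
          fix u assume "u \<in> {0..t}"
          hence u: "u \<in> {0..s}" using t by auto
          have "\<epsilon> \<le> norm (x u $ i - x u $ j)" if "j \<noteq> i" for j
            using \<epsilon>0(2)[OF u, of i j] \<epsilon> that by auto
          thus "(\<Sum>j\<in>UNIV - {i}. a *\<^sub>R biot_savart (x u $ i - x u $ j)) = b (x u) $ i"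
            by (auto simp: b_def reg_drift_def reg_kernel_eq_biot_savart intro!: sum.cong)
        qed
      qed auto
      also have "\<dots> = integral {0..t} (\<lambda>u. b (x u) $ i)"
        by (intro set_borel_integral_eq_integral borel_integrable_atLeastAtMost' continuous_intros bc) (use t in auto)
      also have "\<dots> = integral {0..t} (\<lambda>u. b (x u)) $ i"
        using integral_linear[OF integrable_continuous_real[OF bc] bounded_linear_vec_nth, of 0 t i] t
        by (simp add: o_def)
      finally show "x t $ i = (x 0 + v t + integral {0..t} (\<lambda>u. b (x u))) $ i"
        by (subst eq[OF t(1)]) (simp add: v_def)
    qed
    obtain L where L: "L \<ge> 0" "\<And>x y. norm (b x - b y) \<le> L * norm (x - y)"
      using reg_drift_Lipschitz[OF \<epsilon>(1), of a] unfolding b_def by blast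
    obtain \<kappa> where \<kappa>: "\<kappa> \<ge> 0"
      "\<And>h y. 0 \<le> h \<Longrightarrow> h \<le> 1 \<Longrightarrow> norm (vortex_step \<epsilon> a h y - y - h *\<^sub>R b y) \<le> \<kappa> * h\<^sup>2"
      using vortex_step_consistent[OF \<epsilon>(1), of a] unfolding b_def by blast
    have "(\<lambda>N. scheme (vortex_step \<epsilon> a (1 / real (Suc N)))
       (\<lambda>k. v (real (Suc k) / real (Suc N)) - v (real k / real (Suc N))) (x 0)
       (nat \<lfloor>s * real (Suc N)\<rfloor>)) \<longlonglongrightarrow> x s"
    proof (rule scheme_converges[OF s conts _ L(2,1) \<kappa>(2,1)])
      fix r t assume rt: "0 \<le> r" "r \<le> t" "t \<le> s"
      have "integral {0..r} (\<lambda>u. b (x u)) + integral {r..t} (\<lambda>u. b (x u)) = integral {0..t} (\<lambda>u. b (x u))"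
        by (rule Henstock_Kurzweil_Integration.integral_combine) (use rt bc in \<open>auto intro: integrable_continuous_real\<close>)
      thus "x t - x r = v t - v r + integral {r..t} (\<lambda>u. b (x u))"
        using eq0[of t] eq0[of r] rt by (simp add: algebra_simps)
    qed
    moreover have "v t - v r = c *\<^sub>R (\<chi> i. w i t - w i r)" for t r
      by (simp add: v_def vec_eq_iff scaleR_diff_right)
    ultimately show "(\<lambda>N. scheme (vortex_step \<epsilon> a (1 / real (Suc N)))
       (\<lambda>k. c *\<^sub>R (\<chi> i. w i (real (Suc k) / real (Suc N)) - w i (real k / real (Suc N)))) (x 0)
       (nat \<lfloor>s * real (Suc N)\<rfloor>)) \<longlonglongrightarrow> x s" by simp
  qed
qed

subsection \<open>Independence of the increments\<close>

lemma generated_events_measurable: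
  assumes t: "t \<in> T"
  shows "Y t \<in> borel_measurable (sigma (space M) {Y t -` A \<inter> space M | t A. t \<in> T \<and> A \<in> sets borel})"
  by (rule measurableI) (use t in \<open>auto simp: sets_measure_of_conv space_measure_of_conv\<close>)

definition increment :: "('n::finite \<Rightarrow> real \<Rightarrow> 'a \<Rightarrow> real^2) \<Rightarrow> real \<Rightarrow> 'n \<Rightarrow> nat \<Rightarrow> 'a \<Rightarrow> real^2" where
  "increment W h i k \<omega> = W i (real (Suc k) * h) \<omega> - W i (real k * h) \<omega>"

text \<open>The increments are embedded with \<open>axis\<close>, since a family of independent variables has a
  common codomain.\<close>

definition elementary :: "('n::finite \<Rightarrow> real \<Rightarrow> 'a \<Rightarrow> real^2) \<Rightarrow> (real \<Rightarrow> 'a \<Rightarrow> real^2^'n) \<Rightarrow> real \<Rightarrow>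
    ('n \<times> nat) option \<Rightarrow> 'a \<Rightarrow> real^2^'n" where
  "elementary W X h r = (case r of None \<Rightarrow> X 0 | Some (i, k) \<Rightarrow> (\<lambda>\<omega>. axis i (increment W h i k \<omega>)))"

lemma borel_measurable_axis [measurable]: "(\<lambda>x :: 'a::euclidean_space. axis i x :: 'a ^ 'n::finite) \<in> borel_measurable borel"
  unfolding axis_def by measurable

context prob_space
begin

lemma brownian_measurable:
  assumes "standard_brownian_motion M B" "t \<ge> 0"
  shows "B t \<in> borel_measurable M"
  using assms by (simp add: standard_brownian_motion_def)

lemma brownian_increments_indep:
  assumes "standard_brownian_motion M B" "h \<ge> 0"
  shows "indep_vars (\<lambda>_. borel) (\<lambda>k \<omega>. B (real (Suc k) * h) \<omega> - B (real k * h) \<omega>) {..<m}"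
proof -
  have "mono (\<lambda>k. real k * h)" using assms by (auto intro!: monoI mult_right_mono)
  moreover have "0 \<le> real 0 * h" by simp
  ultimately show ?thesis
    using assms(1) unfolding standard_brownian_motion_def by blast
qed

text \<open>Independence is given on two levels: between the initial vector and the Brownian
  motions, and between the increments of one motion. An intersection of elementary events is
  therefore grouped into one event \<open>D i\<close> for each motion; its probability factors first
  over the groups and then within each of them.\<close>

lemma elementary_indep:
  assumes data: "vortex_data M W (X :: real \<Rightarrow> 'a \<Rightarrow> real^2^'n::finite)" and h: "h \<ge> 0"
  shows "indep_vars (\<lambda>_. borel) (elementary W X h) (insert None (Some ` (UNIV \<times> {..<m})))"
proof -
  let ?I = "insert None (Some ` (UNIV \<times> {..<m})) :: ('n \<times> nat) option set"
  have BM: "standard_brownian_motion M (W i)" and X0: "X 0 \<in> borel_measurable M"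
    and ind: "indep_sets (case_option (generated_events M X {0}) (\<lambda>i. generated_events M (W i) {0..})) UNIV" for i
    using data by (auto simp: vortex_data_def)
  have incm [measurable]: "increment W h i k \<in> borel_measurable M" for i k
    unfolding increment_def using brownian_measurable[OF BM] h by (intro borel_measurable_diff) auto
  have rv: "elementary W X h r \<in> borel_measurable M" for r
    using X0 by (auto simp: elementary_def split: option.splits prod.splits)
  define F where "F r = {elementary W X h r -` A \<inter> space M | A. A \<in> sets borel}" for r
  have gen: "increment W h i k -` A \<inter> space M \<in> generated_events M (W i) {0..}" if A: "A \<in> sets borel" for i k A
  proof -
    let ?G = "{W i t -` A \<inter> space M | t A. t \<in> {0..} \<and> A \<in> sets borel}"
    have W: "W i t \<in> borel_measurable (sigma (space M) ?G)" if "t \<ge> 0" for t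
      by (rule generated_events_measurable) (use that in auto)
    have "increment W h i k \<in> borel_measurable (sigma (space M) ?G)"
      unfolding increment_def using h by (intro borel_measurable_diff W) auto
    from measurable_sets[OF this A] show ?thesis
      by (subst (asm) sets_measure_of) (auto simp: generated_events_def space_measure_of_conv)
  qed
  have sa: "sigma_algebra (space M) (generated_events M (W i) {0..})" for i
    unfolding generated_events_def by (rule sigma_algebra_sigma_sets) auto
  have "indep_sets F ?I"
  proof (rule indep_sets_finite[THEN iffD2])
    \<comment> \<open>Since every family contains the whole space, it is enough to test
      intersections over the full finite index set.\<close>
    show "F r \<subseteq> events" "space M \<in> F r" for r
      using measurable_sets[OF rv[of r]] by (auto simp: F_def intro!: exI[of _ UNIV])
    show "\<forall>A\<in>Pi ?I F. prob (\<Inter>j\<in>?I. A j) = (\<Prod>j\<in>?I. prob (A j))"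
    proof
      fix A assume A: "A \<in> Pi ?I F"
      hence "A None \<in> F None" by auto
      then obtain A0 where A0: "A None = X 0 -` A0 \<inter> space M" "A0 \<in> sets borel"
        by (auto simp: F_def elementary_def)
      have "\<exists>C\<in>sets borel. A (Some (i, k)) = increment W h i k -` C \<inter> space M" if "k < m" for i k
      proof -
        have "A (Some (i, k)) \<in> F (Some (i, k))" using A that by auto
        then obtain C where C: "C \<in> sets borel" "A (Some (i, k)) = (\<lambda>\<omega>. axis i (increment W h i k \<omega>)) -` C \<inter> space M"
          by (auto simp: F_def elementary_def)
        have "axis i -` C \<inter> space borel \<in> sets borel" by (rule measurable_sets[OF borel_measurable_axis C(1)])
        thus ?thesis using C(2) by (intro bexI[of _ "axis i -` C"]) auto
      qed
      hence exC: "\<exists>C. C \<in> sets borel \<and> A (Some (i, k)) = increment W h i k -` C \<inter> space M" if "k < m" for i k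
        using that by blast
      define C where "C i k = (SOME C. C \<in> sets borel \<and> A (Some (i, k)) = increment W h i k -` C \<inter> space M)" for i k
      have C: "C i k \<in> sets borel" "A (Some (i, k)) = increment W h i k -` C i k \<inter> space M" if "k < m" for i k
        using someI_ex[OF exC[OF that, of i], folded C_def] by auto
      \<comment> \<open>The leading \<open>space M\<close> makes \<open>D i\<close> an event also
        for \<open>m = 0\<close>, where the intersection over no steps is
        \<open>UNIV\<close>.\<close>
      define D where "D i = space M \<inter> (\<Inter>k<m. increment W h i k -` C i k \<inter> space M)" for i
      have D_gen: "D i \<in> generated_events M (W i) {0..}" for i
      proof -
        interpret S: sigma_algebra "space M" "generated_events M (W i) {0..}" by (rule sa)
        show ?thesis
        proof (cases "m = 0")
          case False
          hence "(\<Inter>k<m. increment W h i k -` C i k \<inter> space M) \<in> generated_events M (W i) {0..}"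
            by (intro S.finite_INT gen C) auto
          thus ?thesis unfolding D_def by (intro S.Int S.top)
        qed (simp add: D_def)
      qed
      have D_prob: "prob (D i) = (\<Prod>k<m. prob (A (Some (i, k))))" for i
      proof (cases "m = 0")
        case False
        have "prob (\<Inter>k<m. increment W h i k -` C i k \<inter> space M) = (\<Prod>k<m. prob (increment W h i k -` C i k \<inter> space M))"
          by (rule indep_varsD_finite[OF brownian_increments_indep[OF BM[of i] h, folded increment_def]])
            (use False C in auto)
        moreover have "D i = (\<Inter>k<m. increment W h i k -` C i k \<inter> space M)"
          using False by (auto simp: D_def)
        ultimately show ?thesis by (simp add: C)
      qed (simp add: D_def prob_space)
      define E where "E r = (case r of None \<Rightarrow> A None | Some i \<Rightarrow> D i)" for r
      have "(\<Inter>j\<in>?I. A j) = (\<Inter>r\<in>UNIV. E r)"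
      proof (rule set_eqI)
        fix \<omega>
        have "\<omega> \<in> (\<Inter>j\<in>?I. A j) \<longleftrightarrow> \<omega> \<in> A None \<and> (\<forall>i. \<forall>k<m. \<omega> \<in> A (Some (i, k)))" by auto
        also have "\<dots> \<longleftrightarrow> \<omega> \<in> A None \<and> (\<forall>i. \<omega> \<in> D i)"
          using A0 C by (auto simp: D_def)
        also have "\<dots> \<longleftrightarrow> \<omega> \<in> (\<Inter>r\<in>UNIV. E r)"
          unfolding E_def by (auto simp: split_option_all split: option.splits)
        finally show "\<omega> \<in> (\<Inter>j\<in>?I. A j) \<longleftrightarrow> \<omega> \<in> (\<Inter>r\<in>UNIV. E r)" .
      qed
      also have "prob \<dots> = (\<Prod>r\<in>UNIV. prob (E r))"
      proof (rule indep_setsD[OF ind])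
        show "\<forall>r\<in>UNIV. E r \<in> case_option (generated_events M X {0}) (\<lambda>i. generated_events M (W i) {0..}) r"
          using D_gen A0 by (auto simp: E_def generated_events_def split: option.splits)
      qed auto
      also have "\<dots> = prob (A None) * (\<Prod>i\<in>UNIV. prob (D i))"
        by (simp add: UNIV_option_conv prod.insert prod.reindex E_def)
      also have "\<dots> = prob (A None) * (\<Prod>p\<in>UNIV \<times> {..<m}. prob (A (Some p)))"
        by (simp add: D_prob prod.cartesian_product)
      also have "\<dots> = (\<Prod>j\<in>?I. prob (A j))"
        by (subst prod.insert) (auto simp: prod.reindex)
      finally show "prob (\<Inter>j\<in>?I. A j) = (\<Prod>j\<in>?I. prob (A j))" .
    qed
  qed auto
  thus ?thesis
    unfolding indep_vars_def2 F_def using rv by blast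
qed

text \<open>All the randomness in one sequence: the state after \<open>k\<close> steps is a function
  of the entries up to \<open>k\<close>, and the noise of the next step is the entry
  \<open>Suc k\<close>.\<close>

definition vortex_input :: "('n::finite \<Rightarrow> real \<Rightarrow> 'a \<Rightarrow> real^2) \<Rightarrow> (real \<Rightarrow> 'a \<Rightarrow> real^2^'n) \<Rightarrow> real \<Rightarrow>
    nat \<Rightarrow> 'a \<Rightarrow> real^2^'n" where
  "vortex_input W X h k = (case k of 0 \<Rightarrow> X 0 | Suc k \<Rightarrow> (\<lambda>\<omega>. \<chi> i. increment W h i k \<omega>))"

lemma vortex_input_indep:
  assumes data: "vortex_data M W (X :: real \<Rightarrow> 'a \<Rightarrow> real^2^'n::finite)" and h: "h \<ge> 0"
  shows "indep_vars (\<lambda>_. borel) (vortex_input W X h) {..m}"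
proof -
  define K where "K k = (case k of 0 \<Rightarrow> {None} | Suc k \<Rightarrow> (\<lambda>i. Some (i, k)) ` (UNIV :: 'n set))" for k
  \<comment> \<open>Adding up the increments along the different axes reassembles the noise vector
    of a step.\<close>
  define Y :: "nat \<Rightarrow> (('n \<times> nat) option \<Rightarrow> real^2^'n) \<Rightarrow> real^2^'n" where
    "Y k v = (case k of 0 \<Rightarrow> v None | Suc k \<Rightarrow> (\<Sum>i\<in>UNIV. v (Some (i, k))))" for k v
  have "indep_vars (\<lambda>k. PiM (K k) (\<lambda>_. borel)) (\<lambda>k \<omega>. restrict (\<lambda>r. elementary W X h r \<omega>) (K k)) {..m}"
    by (rule indep_vars_restrict[OF elementary_indep[OF data h, of m]])
      (auto simp: K_def disjoint_family_on_def split: nat.splits)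
  hence "indep_vars (\<lambda>_. borel) (\<lambda>k \<omega>. Y k (restrict (\<lambda>r. elementary W X h r \<omega>) (K k))) {..m}"
  proof (rule indep_vars_compose2)
    fix k
    show "Y k \<in> borel_measurable (PiM (K k) (\<lambda>_. borel))"
      unfolding Y_def by (cases k) (auto simp: K_def intro!: borel_measurable_sum measurable_component_singleton)
  qed
  moreover have "Y k (restrict (\<lambda>r. elementary W X h r \<omega>) (K k)) = vortex_input W X h k \<omega>" for k \<omega>
  proof (cases k)
    case (Suc j)
    have "(\<Sum>i\<in>UNIV. axis i (increment W h i j \<omega>)) $ l = increment W h l j \<omega>" for l
      by (simp add: axis_def)
    thus ?thesis by (simp add: Y_def K_def vortex_input_def elementary_def Suc vec_eq_iff)
  qed (simp add: Y_def K_def vortex_input_def elementary_def)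
  ultimately show ?thesis by simp
qed

end

section \<open>The noise law and the entropy along the scheme\<close>

lemma distr_gauss_scaleR:
  "distr (gauss \<sigma>) borel (\<lambda>x :: 'a::euclidean_space. c *\<^sub>R x) = gauss (c * \<sigma>)"
  unfolding gauss_def by (subst distr_distr) (auto simp: o_def)

lemma gauss_1: "gauss 1 = std_gauss"
proof -
  have "distr std_gauss borel (\<lambda>x :: 'a. x) = distr std_gauss std_gauss (\<lambda>x. x)"
    by (rule distr_cong) auto
  thus ?thesis by (simp add: gauss_def distr_id)
qed

lemma scheme_cong: "(\<And>j. j < k \<Longrightarrow> \<xi> j = \<xi>' j) \<Longrightarrow> scheme \<Psi> \<xi> y k = scheme \<Psi> \<xi>' y k"
  by (induction k) auto

lemma measurable_scheme:
  fixes \<Psi> :: "'e::euclidean_space \<Rightarrow> 'e"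
  assumes "\<Psi> \<in> borel_measurable borel" "\<And>j. \<xi> j \<in> borel_measurable M" "y \<in> borel_measurable M"
  shows "(\<lambda>\<omega>. scheme \<Psi> (\<lambda>j. \<xi> j \<omega>) (y \<omega>) k) \<in> borel_measurable M"
proof (induction k)
  case (Suc k)
  from measurable_compose[OF this assms(1)] assms(2) show ?case by simp
qed (use assms in simp)

context prob_space
begin

lemma distr_brownian_increment:
  assumes "standard_brownian_motion M (B :: real \<Rightarrow> 'a \<Rightarrow> 'b::euclidean_space)" "0 \<le> r" "r < t"
  shows "distr M borel (\<lambda>\<omega>. B t \<omega> - B r \<omega>) = gauss (sqrt (t - r))"
proof -
  define \<sigma> where "\<sigma> = sqrt (t - r)"
  have \<sigma>: "\<sigma> > 0" using assms by (simp add: \<sigma>_def)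
  have "distributed M lborel (\<lambda>\<omega>. B t \<omega> - B r \<omega>)
      (\<lambda>x. ennreal (\<Prod>b\<in>Basis. normal_density 0 \<sigma> (x \<bullet> b)))"
    using assms unfolding standard_brownian_motion_def \<sigma>_def by blast
  hence "distr M lborel (\<lambda>\<omega>. B t \<omega> - B r \<omega>) = gauss \<sigma>"
    by (simp add: gauss_eq_density[OF \<sigma>] normal_density_prod[OF \<sigma>] distributed_distr_eq_density)
  moreover have "distr M lborel (\<lambda>\<omega>. B t \<omega> - B r \<omega>) = distr M borel (\<lambda>\<omega>. B t \<omega> - B r \<omega>)"
    by (rule distr_cong) auto
  ultimately show ?thesis by (simp add: \<sigma>_def)
qed

lemma measurable_vortex_input:
  assumes data: "vortex_data M W (X :: real \<Rightarrow> 'a \<Rightarrow> real^2^'n::finite)" and h: "h \<ge> 0"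
  shows "vortex_input W X h k \<in> borel_measurable M"
  using vortex_input_indep[OF data h, of k] by (auto simp: indep_vars_def)

lemma distr_vortex_noise:
  assumes data: "vortex_data M W (X :: real \<Rightarrow> 'a \<Rightarrow> real^2^'n::finite)" and h: "h > 0"
  shows "distr M borel (vortex_input W X h (Suc k)) = gauss (sqrt h)"
proof -
  define \<sigma> where "\<sigma> = sqrt h"
  have \<sigma>: "\<sigma> > 0" using h by (simp add: \<sigma>_def)
  have BM: "standard_brownian_motion M (W i)" for i
    using data by (auto simp: vortex_data_def)
  \<comment> \<open>Scaled to unit variance, since the identification of the product law in
    \<open>std_gauss_vec\<close> concerns standard Gaussians.\<close>
  define Z where "Z i \<omega> = (1 / \<sigma>) *\<^sub>R increment W h i k \<omega>" for i \<omega>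
  have incm: "increment W h i k \<in> borel_measurable M" for i
    unfolding increment_def using brownian_measurable[OF BM] h by (intro borel_measurable_diff) auto
  hence Zm [measurable]: "Z i \<in> borel_measurable M" for i
    unfolding Z_def by measurable
  have Zlaw: "distr M borel (Z i) = std_gauss" for i
  proof -
    have "distr M borel (Z i) = distr (distr M borel (increment W h i k)) borel (\<lambda>x. (1 / \<sigma>) *\<^sub>R x)"
      using incm by (subst distr_distr) (auto simp: o_def Z_def[abs_def])
    also have "distr M borel (increment W h i k) = gauss \<sigma>"
      using distr_brownian_increment[OF BM, of "real k * h" "real (Suc k) * h" i] h
      by (simp add: increment_def[abs_def] \<sigma>_def algebra_simps)
    finally show ?thesis
      using \<sigma> by (simp add: distr_gauss_scaleR gauss_1)
  qed
  have "indep_vars (\<lambda>i. PiM {Some (i, k)} (\<lambda>_. borel)) (\<lambda>i \<omega>. restrict (\<lambda>r. elementary W X h r \<omega>) {Some (i, k)}) UNIV"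
    by (rule indep_vars_restrict[OF elementary_indep[OF data less_imp_le[OF h], of "Suc k"]])
      (auto simp: disjoint_family_on_def)
  hence "indep_vars (\<lambda>_. borel) (\<lambda>i \<omega>. (1 / \<sigma>) *\<^sub>R (restrict (\<lambda>r. elementary W X h r \<omega>) {Some (i, k)} (Some (i, k)) $ i)) UNIV"
    by (rule indep_vars_compose2[where Y = "\<lambda>i v. (1 / \<sigma>) *\<^sub>R (v (Some (i, k)) $ i)"]) measurable
  hence "indep_vars (\<lambda>_. borel) Z UNIV"
    by (simp add: elementary_def Z_def[abs_def])
  hence PiM: "distr M (PiM UNIV (\<lambda>_. borel)) (\<lambda>\<omega>. \<lambda>i\<in>UNIV. Z i \<omega>) = PiM UNIV (\<lambda>i. distr M borel (Z i))"
    by (subst (asm) indep_vars_iff_distr_eq_PiM') auto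
  have "distr M borel (\<lambda>\<omega>. \<chi> i. Z i \<omega>) = distr (distr M (PiM UNIV (\<lambda>_. borel)) (\<lambda>\<omega>. \<lambda>i\<in>UNIV. Z i \<omega>)) borel vec_lambda"
    by (subst distr_distr[OF measurable_vec_lambda_PiM measurable_restrict]) (auto simp: o_def restrict_def)
  also have "\<dots> = std_gauss"
    unfolding PiM Zlaw by (rule std_gauss_vec[symmetric])
  finally have "distr M borel (\<lambda>\<omega>. \<chi> i. Z i \<omega>) = std_gauss" .
  hence "gauss \<sigma> = distr (distr M borel (\<lambda>\<omega>. \<chi> i. Z i \<omega>)) borel (\<lambda>x. \<sigma> *\<^sub>R x)"
    by (simp add: gauss_def)
  also have "\<dots> = distr M borel (\<lambda>\<omega>. \<sigma> *\<^sub>R (\<chi> i. Z i \<omega>))"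
    by (subst distr_distr) (auto simp: o_def)
  also have "(\<lambda>\<omega>. \<sigma> *\<^sub>R (\<chi> i. Z i \<omega>)) = vortex_input W X h (Suc k)"
    using \<sigma> by (simp add: vortex_input_def Z_def vec_eq_iff fun_eq_iff)
  finally show ?thesis by (simp add: \<sigma>_def)
qed

lemma scheme_indep_noise:
  assumes data: "vortex_data M W (X :: real \<Rightarrow> 'a \<Rightarrow> real^2^'n::finite)" and h: "h \<ge> 0"
    and [measurable]: "\<Psi> \<in> borel_measurable borel"
  shows "indep_var borel (\<lambda>\<omega>. scheme \<Psi> (\<lambda>j. c *\<^sub>R vortex_input W X h (Suc j) \<omega>) (X 0 \<omega>) k) borel (vortex_input W X h (Suc k))"
proof -
  \<comment> \<open>Noise from step \<open>k\<close> on is replaced by 0: measurability on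
    \<open>PiM {..k}\<close> concerns only the first entries, and \<open>scheme_cong\<close> shows
    that the later ones do not enter \<open>k\<close> steps.\<close>
  define G where "G v = scheme \<Psi> (\<lambda>j. if j < k then c *\<^sub>R v (Suc j) else 0) (v 0) k" for v :: "nat \<Rightarrow> real^2^'n"
  have "indep_var (PiM {..k} (\<lambda>_. borel)) (\<lambda>\<omega>. restrict (\<lambda>i. vortex_input W X h i \<omega>) {..k})
      (PiM {Suc k} (\<lambda>_. borel)) (\<lambda>\<omega>. restrict (\<lambda>i. vortex_input W X h i \<omega>) {Suc k})"
    by (rule indep_var_restrict[OF vortex_input_indep[OF data h, of "Suc k"]]) auto
  hence "indep_var borel (G \<circ> (\<lambda>\<omega>. restrict (\<lambda>i. vortex_input W X h i \<omega>) {..k}))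
      borel ((\<lambda>v. v (Suc k)) \<circ> (\<lambda>\<omega>. restrict (\<lambda>i. vortex_input W X h i \<omega>) {Suc k}))"
  proof (rule indep_var_compose)
    show "G \<in> borel_measurable (PiM {..k} (\<lambda>_. borel))"
      unfolding G_def
    proof (rule measurable_scheme)
      fix j show "(\<lambda>v :: nat \<Rightarrow> real^2^'n. if j < k then c *\<^sub>R v (Suc j) else 0) \<in> borel_measurable (PiM {..k} (\<lambda>_. borel))"
      proof (cases "j < k")
        case True
        hence [measurable]: "(\<lambda>v :: nat \<Rightarrow> real^2^'n. v (Suc j)) \<in> PiM {..k} (\<lambda>_. borel :: (real^2^'n) measure) \<rightarrow>\<^sub>M borel"
          by (intro measurable_component_singleton) simp
        show ?thesis using True by simp
      qed simp
    qed auto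
  qed auto
  moreover have "G (restrict (\<lambda>i. vortex_input W X h i \<omega>) {..k}) =
      scheme \<Psi> (\<lambda>j. c *\<^sub>R vortex_input W X h (Suc j) \<omega>) (X 0 \<omega>) k" for \<omega>
  proof -
    have "restrict (\<lambda>i. vortex_input W X h i \<omega>) {..k} 0 = X 0 \<omega>" by (simp add: vortex_input_def)
    thus ?thesis unfolding G_def by (simp only:) (rule scheme_cong, simp)
  qed
  ultimately show ?thesis by (simp add: o_def)
qed

text \<open>Both the variance and the constant follow \<open>1 + k / N\<close>, so each step
  reproduces the claim exactly and no error is left to be controlled as \<open>N\<close>
  grows.\<close>

lemma entropy_bound_scheme:
  assumes data: "vortex_data M W (X :: real \<Rightarrow> 'a \<Rightarrow> real^2^'n::finite)" and \<nu>: "\<nu> > 0"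
    and \<Psi>: "gauss_preserving \<Psi>"
    and init: "entropy_bound (distr M borel (X 0)) (gauss (sqrt (2 * \<nu>))) C"
    and N: "N > 0"
  shows "entropy_bound (distr M borel (\<lambda>\<omega>. scheme \<Psi> (\<lambda>j. sqrt (2 * \<nu>) *\<^sub>R vortex_input W X (1 / real N) (Suc j) \<omega>) (X 0 \<omega>) k))
    (gauss (sqrt (2 * \<nu> * (1 + real k / real N)))) (C / (1 + real k / real N))"
proof (induction k)
  case 0
  show ?case using init by simp
next
  case (Suc k)
  note [measurable] = gauss_preserving_measurable[OF \<Psi>]
  define h where "h = 1 / real N"
  have h: "h > 0" using N by (simp add: h_def)
  define c where "c = sqrt (2 * \<nu>)"
  define Y where "Y k \<omega> = scheme \<Psi> (\<lambda>j. c *\<^sub>R vortex_input W X h (Suc j) \<omega>) (X 0 \<omega>) k" for k \<omega>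
  have X0 [measurable]: "X 0 \<in> borel_measurable M" using data by (simp add: vortex_data_def)
  have V [measurable]: "vortex_input W X h k \<in> borel_measurable M" for k
    by (rule measurable_vortex_input[OF data less_imp_le[OF h]])
  have Ym [measurable]: "Y k \<in> borel_measurable M" for k
    unfolding Y_def by (rule measurable_scheme) auto
  define \<mu> where "\<mu> = distr M borel (Y k)"
  have \<mu>: "prob_space \<mu>" "sets \<mu> = sets borel"
    unfolding \<mu>_def by (auto intro: prob_space_distr)
  interpret \<mu>: prob_space \<mu> by fact
  \<comment> \<open>\<open>1 + k / N\<close> is \<open>(m - 1) / N\<close> and the next value is
    \<open>m / N\<close>, so this is the integer for which the variances have the ratio
    \<open>(m - 1) / m\<close>. As \<open>N > 0\<close>, it is at least 2.\<close>
  define m where "m = N + k + 1"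
  have m: "m \<ge> 2" using N by (simp add: m_def)
  define \<sigma> where "\<sigma> = sqrt (2 * \<nu> * (1 + real (Suc k) / real N))"
  have r: "1 + real (Suc k) / real N = real m / real N" "1 + real k / real N = (real m - 1) / real N"
    using N by (simp_all add: m_def field_simps)
  have \<sigma>k: "\<sigma> * sqrt ((real m - 1) / real m) = sqrt (2 * \<nu> * (1 + real k / real N))"
    unfolding \<sigma>_def r using m by (simp add: real_sqrt_mult[symmetric])
  have \<sigma>c: "\<sigma> * sqrt (1 / real m) = c * sqrt h"
    unfolding \<sigma>_def r c_def h_def using m by (simp add: real_sqrt_mult[symmetric])
  have "entropy_bound (distr (\<mu> \<Otimes>\<^sub>M std_gauss) borel (\<lambda>(y, z). \<Psi> y + (\<sigma> * sqrt (1 / real m)) *\<^sub>R z))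
      (gauss \<sigma>) ((real m - 1) / real m * (C / (1 + real k / real N)))"
    by (rule entropy_bound_step[OF \<mu> m _ \<Psi>])
      (use Suc in \<open>simp add: \<sigma>k \<mu>_def Y_def[abs_def] c_def h_def\<close>)
  moreover have "distr M borel (Y (Suc k)) = distr (\<mu> \<Otimes>\<^sub>M std_gauss) borel (\<lambda>(y, z). \<Psi> y + (\<sigma> * sqrt (1 / real m)) *\<^sub>R z)"
  proof -
    have "indep_var borel (Y k) borel (vortex_input W X h (Suc k))"
      unfolding Y_def by (rule scheme_indep_noise[OF data less_imp_le[OF h]]) measurable
    \<comment> \<open>Independence makes the joint law a product, so adding the noise becomes the
      convolution of \<open>entropy_bound_step\<close>.\<close>
    hence joint: "\<mu> \<Otimes>\<^sub>M gauss (sqrt h) = distr M (borel \<Otimes>\<^sub>M borel) (\<lambda>\<omega>. (Y k \<omega>, vortex_input W X h (Suc k) \<omega>))"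
      unfolding \<mu>_def distr_vortex_noise[OF data h, symmetric, of k] by (simp add: indep_var_distribution_eq)
    have YS: "Y (Suc k) = (\<lambda>\<omega>. \<Psi> (Y k \<omega>) + c *\<^sub>R vortex_input W X h (Suc k) \<omega>)"
      by (simp add: Y_def fun_eq_iff)
    have "distr M borel (Y (Suc k)) = distr (\<mu> \<Otimes>\<^sub>M gauss (sqrt h)) borel (\<lambda>(y, z). \<Psi> y + c *\<^sub>R z)"
      unfolding joint YS by (subst distr_distr) (auto simp: o_def split_beta')
    also have "\<mu> \<Otimes>\<^sub>M gauss (sqrt h) = distr (\<mu> \<Otimes>\<^sub>M std_gauss) (borel \<Otimes>\<^sub>M borel) (\<lambda>(y, z). (y, sqrt h *\<^sub>R z))"
    proof -
      have "distr \<mu> borel (\<lambda>y. y) = \<mu>"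
        using \<mu>(2) by (intro distr_id2) simp
      moreover have "distr \<mu> borel (\<lambda>y. y) \<Otimes>\<^sub>M distr std_gauss borel (\<lambda>z. sqrt h *\<^sub>R z) =
          distr (\<mu> \<Otimes>\<^sub>M std_gauss) (borel \<Otimes>\<^sub>M borel) (\<lambda>(y, z). (y, sqrt h *\<^sub>R z))"
        using \<mu>(2) prob_space_imp_sigma_finite[OF prob_space_gauss[of "sqrt h"]]
        by (intro pair_measure_distr) (auto simp: gauss_def[symmetric] intro: measurable_ident_sets)
      ultimately show ?thesis by (simp add: gauss_def)
    qed
    also have "distr \<dots> borel (\<lambda>(y, z). \<Psi> y + c *\<^sub>R z) = distr (\<mu> \<Otimes>\<^sub>M std_gauss) borel (\<lambda>(y, z). \<Psi> y + (c * sqrt h) *\<^sub>R z)"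
    proof -
      have "(\<lambda>(y, z). (y, sqrt h *\<^sub>R z)) \<in> \<mu> \<Otimes>\<^sub>M std_gauss \<rightarrow>\<^sub>M (borel :: (real^2^'n) measure) \<Otimes>\<^sub>M borel"
        using \<mu>(2) by (simp cong: measurable_cong_sets sets_pair_measure_cong)
      thus ?thesis by (subst distr_distr) (auto simp: o_def split_beta')
    qed
    finally show ?thesis by (simp only: \<sigma>c)
  qed
  moreover have "(real m - 1) / real m * (C / (1 + real k / real N)) = C / (1 + real (Suc k) / real N)"
    unfolding r using m N by (simp add: field_simps)
  ultimately show ?case by (simp only: Y_def[abs_def] \<sigma>_def c_def h_def)
qed

end

subsection \<open>The limit of the scheme\<close>

lemma p_infty_pos: "\<nu> > 0 \<Longrightarrow> p_infty \<nu> z > 0"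
  by (simp add: p_infty_def)

lemma p_infty_measurable [measurable]: "p_infty \<nu> \<in> borel_measurable borel"
  unfolding p_infty_def by measurable

lemma has_density_measurable:
  assumes "has_density M Y p"
  shows "p \<in> borel_measurable borel"
proof -
  have "(\<lambda>z. ennreal (p z)) \<in> borel_measurable borel" "\<And>z. 0 \<le> p z"
    using assms by (auto simp: has_density_def distributed_def)
  from borel_measurable_enn2real[OF this(1)] this(2) show ?thesis by simp
qed

context prob_space
begin

lemma has_density_distr:
  assumes "has_density M Y p"
  shows "distr M borel Y = with_density p" "Y \<in> borel_measurable M"
    "prob_space (with_density p)"
proof -
  have "distr M lborel Y = distr M borel Y" by (rule distr_cong) auto
  thus 1: "distr M borel Y = with_density p"
    using assms by (simp add: has_density_def distributed_def)
  show 2: "Y \<in> borel_measurable M"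
    using assms by (simp add: has_density_def distributed_def)
  show "prob_space (with_density p)"
    unfolding 1[symmetric] using 2 by (rule prob_space_distr)
qed

text \<open>Fatou's lemma is applied twice, since the number of steps after which the scheme is close to
  the solution depends on the regularisation, and the regularisation that can be removed depends
  on the path.\<close>

lemma vortex_expectation_bound:
  fixes X :: "real \<Rightarrow> 'a \<Rightarrow> real^2^'n::finite"
  assumes \<nu>: "\<nu> > 0" and data: "vortex_data M W X" and sol: "vortex_solution M \<nu> a W X"
    and init: "entropy_bound (distr M borel (X 0)) (gauss (sqrt (2 * \<nu>))) C"
    and s: "s \<ge> 0" and Xs [measurable]: "X s \<in> borel_measurable M"
    and \<phi>: "continuous_on UNIV \<phi>" and B: "\<And>x. \<bar>\<phi> x\<bar> \<le> B"
  shows "(\<integral>\<omega>. \<phi> (X s \<omega>) \<partial>M) \<le> C / (1 + s) + ln (\<integral>x. exp (\<phi> x) \<partial>gauss (sqrt (2 * \<nu> * (1 + s))))"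
proof -
  have [measurable]: "\<phi> \<in> borel_measurable borel"
    using \<phi> by (rule borel_measurable_continuous_onI)
  have b: "- B \<le> \<phi> x" "\<phi> x \<le> B" for x using B[of x] by auto
  define Y where "Y m N \<omega> = scheme (vortex_step (1 / real (Suc m)) a (1 / real (Suc N)))
     (\<lambda>k. sqrt (2 * \<nu>) *\<^sub>R vortex_input W X (1 / real (Suc N)) (Suc k) \<omega>) (X 0 \<omega>) (nat \<lfloor>s * real (Suc N)\<rfloor>)" for m N \<omega>
  \<comment> \<open>The last grid time not after \<open>s\<close>. The entropy bound is available at
    this time, so its right-hand side also has to pass to the limit.\<close>
  define t where "t N = real (nat \<lfloor>s * real (Suc N)\<rfloor>) / real (Suc N)" for N
  define \<sigma> where "\<sigma> t = sqrt (2 * \<nu> * (1 + t))" for t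
  define \<beta> where "\<beta> t = C / (1 + t) + ln (\<integral>x. exp (\<phi> x) \<partial>gauss (\<sigma> t))" for t
  have Ym [measurable]: "Y m N \<in> borel_measurable M" for m N
    unfolding Y_def using data measurable_vortex_input[OF data] gauss_preserving_measurable[OF gauss_preserving_vortex_step]
    by (intro measurable_scheme) (auto simp: vortex_data_def)
  have t: "t \<longlonglongrightarrow> s"
  proof (rule tendsto_sandwich)
    show "\<forall>\<^sub>F N in sequentially. s - 1 / real (Suc N) \<le> t N"
    proof (rule always_eventually, rule allI)
      fix N
      have "s * real (Suc N) - 1 \<le> real (nat \<lfloor>s * real (Suc N)\<rfloor>)" using s by linarith
      hence "(s * real (Suc N) - 1) / real (Suc N) \<le> t N" unfolding t_def by (intro divide_right_mono) auto
      thus "s - 1 / real (Suc N) \<le> t N" by (simp add: diff_divide_distrib del: of_nat_Suc)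
    qed
    show "\<forall>\<^sub>F N in sequentially. t N \<le> s"
    proof (rule always_eventually, rule allI)
      fix N
      have "real (nat \<lfloor>s * real (Suc N)\<rfloor>) \<le> s * real (Suc N)" using s by simp
      hence "t N \<le> s * real (Suc N) / real (Suc N)" unfolding t_def by (intro divide_right_mono) auto
      thus "t N \<le> s" by simp
    qed
    show "(\<lambda>N. s - 1 / real (Suc N)) \<longlonglongrightarrow> s" by real_asymp
  qed auto
  have int: "integrable M (\<lambda>\<omega>. \<phi> (Y m N \<omega>))" "integrable M (\<lambda>\<omega>. \<phi> (X s \<omega>))" for m N
    by (rule integrable_bounded[where B = B]; use B in auto)+
  have Y_bound: "(\<integral>\<omega>. \<phi> (Y m N \<omega>) \<partial>M) \<le> \<beta> (t N)" for m N
  proof -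
    have "entropy_bound (distr M borel (Y m N)) (gauss (\<sigma> (t N))) (C / (1 + t N))"
      unfolding Y_def \<sigma>_def t_def
      by (rule entropy_bound_scheme[OF data \<nu> gauss_preserving_vortex_step init]) simp
    from entropy_boundD[OF this _ B, of "\<lambda>x. x"]
    show ?thesis by (simp add: integral_distr \<beta>_def)
  qed
  have \<beta>_lim: "(\<lambda>N. \<beta> (t N)) \<longlonglongrightarrow> \<beta> s"
  proof -
    \<comment> \<open>With the variance moved into the argument of the continuous function \<phi>,
      the Gaussian integrals converge by domination under one fixed measure.\<close>
    have \<sigma>_lim: "(\<lambda>N. \<sigma> (t N)) \<longlonglongrightarrow> \<sigma> s"
      unfolding \<sigma>_def by (intro tendsto_intros t)
    have G: "(\<integral>x. exp (\<phi> x) \<partial>gauss \<tau>) = (\<integral>x. exp (\<phi> (\<tau> *\<^sub>R x)) \<partial>std_gauss)" for \<tau>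
      by (rule integral_gauss) measurable
    have "(\<lambda>N. \<integral>x. exp (\<phi> (\<sigma> (t N) *\<^sub>R x)) \<partial>std_gauss) \<longlonglongrightarrow> (\<integral>x. exp (\<phi> (\<sigma> s *\<^sub>R x)) \<partial>std_gauss)"
    proof (rule integral_dominated_convergence[where w = "\<lambda>_. exp B"])
      have "(\<lambda>N. exp (\<phi> (\<sigma> (t N) *\<^sub>R x))) \<longlonglongrightarrow> exp (\<phi> (\<sigma> s *\<^sub>R x))" for x
        by (intro tendsto_exp continuous_on_tendsto_compose[OF \<phi>] tendsto_scaleR \<sigma>_lim) auto
      thus "AE x in std_gauss. (\<lambda>N. exp (\<phi> (\<sigma> (t N) *\<^sub>R x))) \<longlonglongrightarrow> exp (\<phi> (\<sigma> s *\<^sub>R x))" by simp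
      show "AE x in std_gauss. norm (exp (\<phi> (\<sigma> (t N) *\<^sub>R x))) \<le> exp B" for N
        using b by simp
    qed auto
    moreover have "(\<integral>x. exp (\<phi> (\<sigma> s *\<^sub>R x)) \<partial>std_gauss) > 0"
      by (rule std_gauss.integral_exp_bounds(4)[of _ B]) (use B in auto)
    ultimately show ?thesis
      unfolding \<beta>_def G using s by (intro tendsto_intros t) auto
  qed
  have AE_conv: "AE \<omega> in M. \<exists>m0. \<forall>m\<ge>m0. (\<lambda>N. Y m N \<omega>) \<longlonglongrightarrow> X s \<omega>"
  proof -
    have "AE \<omega> in M. continuous_on {0..} (\<lambda>t. X t \<omega>)"
      "AE \<omega> in M. \<forall>t\<ge>0. \<forall>i j. i \<noteq> j \<longrightarrow> X t \<omega> $ i \<noteq> X t \<omega> $ j"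
      "AE \<omega> in M. \<forall>t\<ge>0. \<forall>i. X t \<omega> $ i = X 0 \<omega> $ i + sqrt (2 * \<nu>) *\<^sub>R W i t \<omega> +
          (LINT s:{0..t}|lborel. (\<Sum>j\<in>UNIV - {i}. a *\<^sub>R biot_savart (X s \<omega> $ i - X s \<omega> $ j)))"
      using sol unfolding vortex_solution_def by blast+
    thus ?thesis
    proof eventually_elim
      case (elim \<omega>)
      define A where "A \<epsilon> N = scheme (vortex_step \<epsilon> a (1 / real (Suc N)))
          (\<lambda>k. sqrt (2 * \<nu>) *\<^sub>R (\<chi> i. W i (real (Suc k) / real (Suc N)) \<omega> - W i (real k / real (Suc N)) \<omega>)) (X 0 \<omega>)
          (nat \<lfloor>s * real (Suc N)\<rfloor>)" for \<epsilon> N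
      have "\<exists>\<epsilon>0>0. \<forall>\<epsilon>>0. \<epsilon> \<le> \<epsilon>0 \<longrightarrow> (\<lambda>N. A \<epsilon> N) \<longlonglongrightarrow> X s \<omega>"
        unfolding A_def
        by (rule vortex_scheme_converges[where x = "\<lambda>t. X t \<omega>" and w = "\<lambda>i t. W i t \<omega>"])
          (use s elim in \<open>blast+\<close>)
      then obtain \<epsilon>0 where \<epsilon>0: "\<epsilon>0 > 0"
        "\<And>\<epsilon>. \<epsilon> > 0 \<Longrightarrow> \<epsilon> \<le> \<epsilon>0 \<Longrightarrow> (\<lambda>N. A \<epsilon> N) \<longlonglongrightarrow> X s \<omega>"
        by blast
      obtain m0 where m0: "1 / real (Suc m0) < \<epsilon>0"
        using reals_Archimedean[OF \<epsilon>0(1)] by (auto simp: inverse_eq_divide)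
      show ?case
      proof (intro exI[of _ m0] allI impI)
        fix m assume "m \<ge> m0"
        hence "1 / real (Suc m) \<le> 1 / real (Suc m0)" by (intro divide_left_mono) auto
        with m0 have "1 / real (Suc m) \<le> \<epsilon>0" by linarith
        from \<epsilon>0(2)[OF _ this] show "(\<lambda>N. Y m N \<omega>) \<longlonglongrightarrow> X s \<omega>"
          by (simp add: A_def Y_def vortex_input_def increment_def)
      qed
    qed
  qed
  \<comment> \<open>Shifted by \<open>B\<close> to be nonnegative, as Fatou's lemma
    requires.\<close>
  define f where "f m N \<omega> = ennreal (\<phi> (Y m N \<omega>) + B)" for m N \<omega>
  have [measurable]: "f m N \<in> borel_measurable M" for m N
    unfolding f_def by measurable
  have nn_eq: "(\<integral>\<^sup>+\<omega>. ennreal (g \<omega> + B) \<partial>M) = ennreal ((\<integral>\<omega>. g \<omega> \<partial>M) + B)"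
    if "integrable M g" "\<And>\<omega>. - B \<le> g \<omega>" for g
  proof -
    have "0 \<le> g \<omega> + B" for \<omega> using that(2)[of \<omega>] by linarith
    thus ?thesis using that by (subst nn_integral_eq_integral) (auto simp: prob_space)
  qed
  have "ennreal ((\<integral>\<omega>. \<phi> (X s \<omega>) \<partial>M) + B) = (\<integral>\<^sup>+\<omega>. ennreal (\<phi> (X s \<omega>) + B) \<partial>M)"
    by (rule nn_eq[symmetric]) (use int b in auto)
  also have "\<dots> = (\<integral>\<^sup>+\<omega>. liminf (\<lambda>m. liminf (\<lambda>N. f m N \<omega>)) \<partial>M)"
  proof (rule nn_integral_cong_AE)
    show "AE \<omega> in M. ennreal (\<phi> (X s \<omega>) + B) = liminf (\<lambda>m. liminf (\<lambda>N. f m N \<omega>))"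
      using AE_conv
    proof eventually_elim
      case (elim \<omega>)
      then obtain m0 where m0: "\<And>m. m \<ge> m0 \<Longrightarrow> (\<lambda>N. Y m N \<omega>) \<longlonglongrightarrow> X s \<omega>" by blast
      have "liminf (\<lambda>N. f m N \<omega>) = ennreal (\<phi> (X s \<omega>) + B)" if "m \<ge> m0" for m
        unfolding f_def
        by (intro lim_imp_Liminf tendsto_ennrealI tendsto_intros continuous_on_tendsto_compose[OF \<phi> m0[OF that]]) auto
      hence "\<forall>\<^sub>F m in sequentially. liminf (\<lambda>N. f m N \<omega>) = ennreal (\<phi> (X s \<omega>) + B)"
        using eventually_sequentially by blast
      from lim_imp_Liminf[OF _ tendsto_eventually[OF this]] show ?case by simp
    qed
  qed
  also have "\<dots> \<le> liminf (\<lambda>m. \<integral>\<^sup>+\<omega>. liminf (\<lambda>N. f m N \<omega>) \<partial>M)"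
    by (rule nn_integral_liminf) measurable
  also have "\<dots> \<le> liminf (\<lambda>m. liminf (\<lambda>N. \<integral>\<^sup>+\<omega>. f m N \<omega> \<partial>M))"
    by (intro Liminf_mono always_eventually allI nn_integral_liminf) measurable
  also have "\<dots> \<le> liminf (\<lambda>m :: nat. liminf (\<lambda>N. ennreal (\<beta> (t N) + B)))"
  proof (intro Liminf_mono always_eventually allI)
    fix m N
    have "(\<integral>\<^sup>+\<omega>. f m N \<omega> \<partial>M) = ennreal ((\<integral>\<omega>. \<phi> (Y m N \<omega>) \<partial>M) + B)"
      unfolding f_def by (rule nn_eq) (use int b in auto)
    also have "\<dots> \<le> ennreal (\<beta> (t N) + B)"
      using Y_bound by (intro ennreal_leI) auto
    finally show "(\<integral>\<^sup>+\<omega>. f m N \<omega> \<partial>M) \<le> ennreal (\<beta> (t N) + B)" .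
  qed
  also have "\<dots> = ennreal (\<beta> s + B)"
  proof -
    have "liminf (\<lambda>N. ennreal (\<beta> (t N) + B)) = ennreal (\<beta> s + B)"
      by (intro lim_imp_Liminf tendsto_ennrealI tendsto_intros \<beta>_lim) auto
    thus ?thesis by (simp add: Liminf_const)
  qed
  finally have "ennreal ((\<integral>\<omega>. \<phi> (X s \<omega>) \<partial>M) + B) \<le> ennreal (\<beta> s + B)" .
  \<comment> \<open>Needed to return from \<open>ennreal\<close> to the reals; it is inherited from
    the grid times, where the bound dominates an integral that is at least
    \<open>- B\<close>.\<close>
  moreover have "0 \<le> \<beta> s + B"
  proof (rule LIMSEQ_le_const)
    show "(\<lambda>N. \<beta> (t N) + B) \<longlonglongrightarrow> \<beta> s + B" by (intro tendsto_intros \<beta>_lim)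
    have "0 \<le> \<beta> (t N) + B" for N
    proof -
      have "- B \<le> (\<integral>\<omega>. \<phi> (Y 0 N \<omega>) \<partial>M)"
        by (rule integral_ge_const) (use int b in auto)
      with Y_bound[of 0 N] show ?thesis by linarith
    qed
    thus "\<exists>N. \<forall>n\<ge>N. 0 \<le> \<beta> (t n) + B" by blast
  qed
  ultimately show ?thesis by (simp add: ennreal_le_iff \<beta>_def \<sigma>_def)
qed

end

text \<open>The finiteness conjunct ensures that the entropy at time \<open>s\<close> is a genuine
  integral and not the default value 0.\<close>

theorem corollary2p5:
  fixes M :: "'a measure"
    and \<nu> a :: real
    and W :: "'n::finite \<Rightarrow> real \<Rightarrow> 'a \<Rightarrow> real^2"
    and X :: "real \<Rightarrow> 'a \<Rightarrow> real^2^'n"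
    and p0 :: "real^2^'n \<Rightarrow> real"
    and \<rho> :: "real \<Rightarrow> real^2^'n \<Rightarrow> real"
  assumes "prob_space M"
    and "\<nu> > 0"
    and "a \<noteq> 0"
    and "vortex_data M W X"
    and "vortex_solution M \<nu> a W X"
    and "has_density M (X 0) p0"
    and "finite_relative_entropy p0 (p_infty \<nu>)"
    and "\<rho> 0 = p0"
    and "\<And>s. s \<ge> 0 \<Longrightarrow> has_density M (X s) (\<rho> s)"
  shows "\<forall>s\<ge>0.
    finite_relative_entropy (\<rho> s)
      (\<lambda>z. (1 + s) powi (- int CARD('n)) * p_infty \<nu> (z /\<^sub>R sqrt (1 + s))) \<and>
    relative_entropy (\<rho> s)
      (\<lambda>z. (1 + s) powi (- int CARD('n)) * p_infty \<nu> (z /\<^sub>R sqrt (1 + s)))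
      \<le> 1 / (1 + s) * relative_entropy (\<rho> 0) (p_infty \<nu>) \<and>
    1 / (1 + s) * relative_entropy (\<rho> 0) (p_infty \<nu>)
      = 1 / (1 + s) * relative_entropy p0 (p_infty \<nu>)"
proof (intro allI impI, goal_cases)
  case (1 s)
  hence s: "s \<ge> 0" .
  interpret prob_space M by fact
  note \<nu> = \<open>\<nu> > 0\<close> and p0 = \<open>has_density M (X 0) p0\<close>
  define C where "C = relative_entropy p0 (p_infty \<nu>)"
  define q where "q = (\<lambda>z :: real^2^'n. (1 + s) powi (- int CARD('n)) * p_infty \<nu> (z /\<^sub>R sqrt (1 + s)))"
  have g0: "(gauss (sqrt (2 * \<nu>)) :: (real^2^'n) measure) = with_density (p_infty \<nu>)"
    using gauss_eq_density_p_infty[OF \<nu>, of 0, where 'n = 'n] by simp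
  have gs: "gauss (sqrt (2 * \<nu> * (1 + s))) = with_density q"
    unfolding q_def by (rule gauss_eq_density_p_infty[OF \<nu> s])
  have p0_nonneg: "\<And>z. 0 \<le> p0 z" using p0 by (simp add: has_density_def)
  have init: "entropy_bound (distr M borel (X 0)) (gauss (sqrt (2 * \<nu>))) C"
    unfolding g0 has_density_distr(1)[OF p0] C_def
    using prob_space_gauss[of "sqrt (2 * \<nu>)", where 'a = "real^2^'n"] p0_nonneg
    by (intro entropy_bound_relative_entropy has_density_measurable[OF p0] has_density_distr(3)[OF p0]
        p_infty_measurable p_infty_pos \<nu> assms(7)) (auto simp: g0)
  note \<rho> = assms(9)[OF s]
  have q1: "q \<in> borel_measurable borel"
    unfolding q_def by measurable
  have "q z > 0" for z
    unfolding q_def using s by (intro mult_pos_pos zero_less_power_int p_infty_pos \<nu>) auto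
  note q = q1 this
  have qp: "prob_space (with_density q)"
    unfolding gs[symmetric] by (rule prob_space_gauss)
  \<comment> \<open>The scheme reaches the law of \<open>X s\<close> only through continuous test
    functions; the existence of the density \<open>\<rho> s\<close> extends the bound to measurable
    ones, which the truncated logarithm requires.\<close>
  have bound: "entropy_bound (with_density (\<rho> s)) (with_density q) (C / (1 + s))"
  proof (rule entropy_bound_of_continuous[OF has_density_measurable[OF \<rho>] has_density_distr(3)[OF \<rho>] q(1) qp])
    fix \<phi> :: "real^2^'n \<Rightarrow> real" and B
    assume \<phi>: "continuous_on UNIV \<phi>" and B: "\<And>x. \<bar>\<phi> x\<bar> \<le> B"
    have "(\<integral>x. \<phi> x \<partial>distr M borel (X s)) = (\<integral>\<omega>. \<phi> (X s \<omega>) \<partial>M)"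
      by (rule integral_distr[OF has_density_distr(2)[OF \<rho>] borel_measurable_continuous_onI[OF \<phi>]])
    thus "(\<integral>x. \<phi> x \<partial>with_density (\<rho> s)) \<le>
        C / (1 + s) + ln (\<integral>x. exp (\<phi> x) \<partial>with_density q)"
      using vortex_expectation_bound[OF \<nu> assms(4,5) init s has_density_distr(2)[OF \<rho>] \<phi> B]
      by (simp add: has_density_distr(1)[OF \<rho>] gs)
  qed
  have "finite_relative_entropy (\<rho> s) q" "relative_entropy (\<rho> s) q \<le> C / (1 + s)"
    using \<rho> q by (intro relative_entropy_le_of_entropy_bound[OF has_density_measurable[OF \<rho>] _
        has_density_distr(3)[OF \<rho>] q(1) _ qp bound]; simp add: has_density_def)+
  thus ?case
    using assms(8) by (simp add: q_def C_def)
qed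

end
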